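(* Let $\mathscr G$ be an ample groupoid and $R$ a commutative ring with unit. (1) The groupoid algebra $R\mathscr G$ is Noetherian if and only if $\mathscr G$ has finitely many objects and $RG$ is Noetherian for each isotropy group $G$ of $\mathscr G$. (2) The groupoid algebra $R\mathscr G$ is Artinian if and only if $\mathscr G$ is finite and $R$ is Artinian. (3) The groupoid algebra $R\mathscr G$ is semisimple if and only if $\mathscr G$ is finite and $R$ is a finite direct product of fields whose characteristics do not divide the order of any isotropy subgroup of $\mathscr G$. Moreover, in any of these cases $R\mathscr G$ is (up to isomorphism) a finite direct product of matrix algebras over group algebras $RG$ of isotropy groups $G$ of $\mathscr G$.
   Context: Convention: a topological space is called compact if it is Hausdorff and every open cover has a finite subcover. A topological groupoid $\mathscr G$ is a groupoid (small category in which every morphism is invertible) whose object space $\mathscr G^{(0)}$ and arrow space $\mathscr G^{(1)}$ are topological spaces (not necessarily Hausdorff) such that the domain map $d$, range map $r$, multiplication, inversion and unit map $u\colon \mathscr G^{(0)}\to\mathscr G^{(1)}$ are continuous; the product $gh$ is defined when $d(g)=r(h)$. Objects are identified with the corresponding identity arrows, so that $\mathscr G^{(0)}$ is a subspace of $\mathscr G^{(1)}$. $\mathscr G$ is étale if $d$ is a local homeomorphism. An étale groupoid is ample if $\mathscr G^{(0)}$ is Hausdorff and has a basis of compact open sets. ($\mathscr G^{(1)}$ need not be Hausdorff.) $\mathscr G$ is finite if $\mathscr G^{(1)}$ is a finite set. The isotropy group (or isotropy subgroup) $G_x$ at $x\in\mathscr G^{(0)}$ is the group of all arrows $g\colon x\to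 x$. For a commutative ring with unit $R$, the groupoid algebra $R\mathscr G$ is the $R$-submodule of $R^{\mathscr G^{(1)}}$ (all functions $\mathscr G^{(1)}\to R$) spanned by the characteristic functions $\chi_U$ with $U\subseteq\mathscr G^{(1)}$ compact open, made into an associative (not necessarily unital) $R$-algebra by the convolution product $f_1\ast f_2(g)=\sum_{d(h)=d(g)}f_1(gh^{-1})f_2(h)$. A (not necessarily unital) ring is Noetherian (resp. Artinian) if it satisfies the ascending (resp. descending) chain condition on left ideals; for $R\mathscr G$ the left and right conditions are equivalent because $R\mathscr G$ has an involution. A ring is semisimple if it is unital and semisimple as a left module over itself (i.e. semisimple Artinian). For a group $G$, $RG$ is the usual group algebra.
   Formalization: R is assumed to be nonzero, and in (2) and (3) the groupoid is assumed to have at least one object; for R = 0, or for the empty groupoid over a non-Artinian R, the algebra is 0 and the stated equivalences fail. *)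

theory Defs
  imports "HOL-Analysis.Analysis" "HOL-Algebra.Chinese_Remainder" "HOL-Algebra.Module"
begin

section \<open>Ample groupoids\<close>

text \<open>
  Objects and arrows are the points of two topological spaces. Objects are not literally arrows;
  \<open>gunit\<close> identifies an object with its identity arrow. In a topological groupoid
  \<open>gunit\<close> is automatically a topological embedding, because it is a continuous section of
  \<open>dmap\<close>.
\<close>

record ('o, 'a) groupoid =
  objects :: "'o topology"
  arrows :: "'a topology"
  dmap :: "'a \<Rightarrow> 'o"
  rmap :: "'a \<Rightarrow> 'o"
  gunit :: "'o \<Rightarrow> 'a"
  gmult :: "'a \<Rightarrow> 'a \<Rightarrow> 'a"
  ginv :: "'a \<Rightarrow> 'a"

definition composable :: "('o, 'a, 'z) groupoid_scheme \<Rightarrow> ('a \<times> 'a) set" where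
  "composable G =
     {(g, h). g \<in> topspace (arrows G) \<and> h \<in> topspace (arrows G) \<and> dmap G g = rmap G h}"

locale groupoid =
  fixes G :: "('o, 'a, 'z) groupoid_scheme" (structure)
  assumes dmap_closed: "g \<in> topspace (arrows G) \<Longrightarrow> dmap G g \<in> topspace (objects G)"
    and rmap_closed: "g \<in> topspace (arrows G) \<Longrightarrow> rmap G g \<in> topspace (objects G)"
    and unit_closed: "x \<in> topspace (objects G) \<Longrightarrow> gunit G x \<in> topspace (arrows G)"
    and unit_dmap: "x \<in> topspace (objects G) \<Longrightarrow> dmap G (gunit G x) = x"
    and unit_rmap: "x \<in> topspace (objects G) \<Longrightarrow> rmap G (gunit G x) = x"
    and mult_closed: "(g, h) \<in> composable G \<Longrightarrow> gmult G g h \<in> topspace (arrows G)"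
    and mult_dmap: "(g, h) \<in> composable G \<Longrightarrow> dmap G (gmult G g h) = dmap G h"
    and mult_rmap: "(g, h) \<in> composable G \<Longrightarrow> rmap G (gmult G g h) = rmap G g"
    and mult_assoc: "\<lbrakk>(g, h) \<in> composable G; (h, k) \<in> composable G\<rbrakk>
          \<Longrightarrow> gmult G (gmult G g h) k = gmult G g (gmult G h k)"
    and unit_right: "g \<in> topspace (arrows G) \<Longrightarrow> gmult G g (gunit G (dmap G g)) = g"
    and unit_left: "g \<in> topspace (arrows G) \<Longrightarrow> gmult G (gunit G (rmap G g)) g = g"
    and inv_closed: "g \<in> topspace (arrows G) \<Longrightarrow> ginv G g \<in> topspace (arrows G)"
    and inv_dmap: "g \<in> topspace (arrows G) \<Longrightarrow> dmap G (ginv G g) = rmap G g"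
    and inv_rmap: "g \<in> topspace (arrows G) \<Longrightarrow> rmap G (ginv G g) = dmap G g"
    and inv_left: "g \<in> topspace (arrows G) \<Longrightarrow> gmult G (ginv G g) g = gunit G (dmap G g)"
    and inv_right: "g \<in> topspace (arrows G) \<Longrightarrow> gmult G g (ginv G g) = gunit G (rmap G g)"

locale topological_groupoid = groupoid +
  assumes continuous_dmap: "continuous_map (arrows G) (objects G) (dmap G)"
    and continuous_rmap: "continuous_map (arrows G) (objects G) (rmap G)"
    and continuous_unit: "continuous_map (objects G) (arrows G) (gunit G)"
    and continuous_inv: "continuous_map (arrows G) (arrows G) (ginv G)"
    and continuous_mult:
      "continuous_map (subtopology (prod_topology (arrows G) (arrows G)) (composable G)) (arrows G)
         (\<lambda>(g, h). gmult G g h)"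

definition local_homeomorphism :: "'a topology \<Rightarrow> 'b topology \<Rightarrow> ('a \<Rightarrow> 'b) \<Rightarrow> bool" where
  "local_homeomorphism X Y f \<longleftrightarrow>
     (\<forall>x\<in>topspace X. \<exists>U. openin X U \<and> x \<in> U \<and> openin Y (f ` U) \<and>
        homeomorphic_map (subtopology X U) (subtopology Y (f ` U)) f)"

text \<open>Compact means Hausdorff and quasi-compact; \<open>compactin\<close> is only the latter.\<close>

definition compact_open :: "'a topology \<Rightarrow> 'a set \<Rightarrow> bool" where
  "compact_open X U \<longleftrightarrow> openin X U \<and> compactin X U \<and> Hausdorff_space (subtopology X U)"

locale etale_groupoid = topological_groupoid +
  assumes local_homeomorphism_dmap: "local_homeomorphism (arrows G) (objects G) (dmap G)"

locale ample_groupoid = etale_groupoid +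
  assumes Hausdorff_objects: "Hausdorff_space (objects G)"
    and compact_open_basis:
      "\<exists>\<B>. (\<forall>K\<in>\<B>. compact_open (objects G) K) \<and>
           (\<forall>U. openin (objects G) U \<longrightarrow> (\<exists>\<C>. \<C> \<subseteq> \<B> \<and> U = \<Union>\<C>))"

definition isotropy_group :: "('o, 'a, 'z) groupoid_scheme \<Rightarrow> 'o \<Rightarrow> 'a monoid" where
  "isotropy_group G x =
     \<lparr> carrier = {g \<in> topspace (arrows G). dmap G g = x \<and> rmap G g = x},
       mult = gmult G,
       one = gunit G x \<rparr>"


section \<open>Algebras\<close>

text \<open>
  An algebra over \<open>R\<close>, possibly noncommutative and possibly without identity, is an element of
  the record type \<open>module\<close>, which carries both a ring multiplication and a scalar
  multiplication. No notion below refers to the field \<open>one\<close> of an algebra without identity.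
\<close>

text \<open>
  \<open>finsum\<close> over an infinite set is zero by convention, so a finitely supported sum has to be
  restricted to its support.
\<close>

definition supp_sum :: "('r, 'm) ring_scheme \<Rightarrow> ('b \<Rightarrow> 'r) \<Rightarrow> 'b set \<Rightarrow> 'r" where
  "supp_sum R f A = finsum R f {a \<in> A. f a \<noteq> \<zero>\<^bsub>R\<^esub>}"

definition char_fun :: "('r, 'm) ring_scheme \<Rightarrow> 'a set \<Rightarrow> 'a set \<Rightarrow> 'a \<Rightarrow> 'r" where
  "char_fun R X U = (\<lambda>g\<in>X. if g \<in> U then \<one>\<^bsub>R\<^esub> else \<zero>\<^bsub>R\<^esub>)"

text \<open>
  Functions on the arrow space are represented as extensional functions. The field \<open>one\<close> is the
  characteristic function of the set of identity arrows; it belongs to the carrier only if the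
  object space is compact.
\<close>

definition groupoid_algebra ::
    "('r, 'm) ring_scheme \<Rightarrow> ('o, 'a, 'z) groupoid_scheme \<Rightarrow> ('r, 'a \<Rightarrow> 'r) module" where
  "groupoid_algebra R G =
     \<lparr> carrier =
         {\<lambda>g\<in>topspace (arrows G).
             \<Oplus>\<^bsub>R\<^esub>U\<in>F. c U \<otimes>\<^bsub>R\<^esub> char_fun R (topspace (arrows G)) U g | F c.
           finite F \<and> (\<forall>U\<in>F. compact_open (arrows G) U \<and> c U \<in> carrier R)},
       mult = (\<lambda>f1 f2. \<lambda>g\<in>topspace (arrows G).
         supp_sum R (\<lambda>h. f1 (gmult G g (ginv G h)) \<otimes>\<^bsub>R\<^esub> f2 h)
           {h \<in> topspace (arrows G). dmap G h = dmap G g}),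
       one = char_fun R (topspace (arrows G)) (gunit G ` topspace (objects G)),
       zero = (\<lambda>g\<in>topspace (arrows G). \<zero>\<^bsub>R\<^esub>),
       add = (\<lambda>f1 f2. \<lambda>g\<in>topspace (arrows G). f1 g \<oplus>\<^bsub>R\<^esub> f2 g),
       smult = (\<lambda>r f. \<lambda>g\<in>topspace (arrows G). r \<otimes>\<^bsub>R\<^esub> f g) \<rparr>"

definition group_algebra ::
    "('r, 'm) ring_scheme \<Rightarrow> ('g, 'n) monoid_scheme \<Rightarrow> ('r, 'g \<Rightarrow> 'r) module" where
  "group_algebra R H =
     \<lparr> carrier =
         {f \<in> carrier H \<rightarrow>\<^sub>E carrier R. finite {g \<in> carrier H. f g \<noteq> \<zero>\<^bsub>R\<^esub>}},
       mult = (\<lambda>f1 f2. \<lambda>g\<in>carrier H.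
         supp_sum R (\<lambda>h. f1 (g \<otimes>\<^bsub>H\<^esub> inv\<^bsub>H\<^esub> h) \<otimes>\<^bsub>R\<^esub> f2 h) (carrier H)),
       one = char_fun R (carrier H) {\<one>\<^bsub>H\<^esub>},
       zero = (\<lambda>g\<in>carrier H. \<zero>\<^bsub>R\<^esub>),
       add = (\<lambda>f1 f2. \<lambda>g\<in>carrier H. f1 g \<oplus>\<^bsub>R\<^esub> f2 g),
       smult = (\<lambda>r f. \<lambda>g\<in>carrier H. r \<otimes>\<^bsub>R\<^esub> f g) \<rparr>"

definition matrix_algebra :: "nat \<Rightarrow> ('r, 'b) module \<Rightarrow> ('r, nat \<times> nat \<Rightarrow> 'b) module" where
  "matrix_algebra n A =
     \<lparr> carrier = {..<n} \<times> {..<n} \<rightarrow>\<^sub>E carrier A,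
       mult = (\<lambda>M N. \<lambda>(i, j)\<in>{..<n} \<times> {..<n}. \<Oplus>\<^bsub>A\<^esub>k\<in>{..<n}. M (i, k) \<otimes>\<^bsub>A\<^esub> N (k, j)),
       one = (\<lambda>(i, j)\<in>{..<n} \<times> {..<n}. if i = j then \<one>\<^bsub>A\<^esub> else \<zero>\<^bsub>A\<^esub>),
       zero = (\<lambda>_\<in>{..<n} \<times> {..<n}. \<zero>\<^bsub>A\<^esub>),
       add = (\<lambda>M N. \<lambda>p\<in>{..<n} \<times> {..<n}. M p \<oplus>\<^bsub>A\<^esub> N p),
       smult = (\<lambda>r M. \<lambda>p\<in>{..<n} \<times> {..<n}. r \<odot>\<^bsub>A\<^esub> M p) \<rparr>"

definition product_algebra :: "'i set \<Rightarrow> ('i \<Rightarrow> ('r, 'b) module) \<Rightarrow> ('r, 'i \<Rightarrow> 'b) module" where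
  "product_algebra I A =
     \<lparr> carrier = (\<Pi>\<^sub>E i\<in>I. carrier (A i)),
       mult = (\<lambda>f g. \<lambda>i\<in>I. f i \<otimes>\<^bsub>A i\<^esub> g i),
       one = (\<lambda>i\<in>I. \<one>\<^bsub>A i\<^esub>),
       zero = (\<lambda>i\<in>I. \<zero>\<^bsub>A i\<^esub>),
       add = (\<lambda>f g. \<lambda>i\<in>I. f i \<oplus>\<^bsub>A i\<^esub> g i),
       smult = (\<lambda>r f. \<lambda>i\<in>I. r \<odot>\<^bsub>A i\<^esub> f i) \<rparr>"

definition algebra_isomorphic ::
    "('r, 'm) ring_scheme \<Rightarrow> ('r, 'b) module \<Rightarrow> ('r, 'c) module \<Rightarrow> bool" where
  "algebra_isomorphic R A B \<longleftrightarrow>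
     (\<exists>\<phi>. bij_betw \<phi> (carrier A) (carrier B) \<and>
        (\<forall>x\<in>carrier A. \<forall>y\<in>carrier A.
           \<phi> (x \<oplus>\<^bsub>A\<^esub> y) = \<phi> x \<oplus>\<^bsub>B\<^esub> \<phi> y \<and> \<phi> (x \<otimes>\<^bsub>A\<^esub> y) = \<phi> x \<otimes>\<^bsub>B\<^esub> \<phi> y) \<and>
        (\<forall>r\<in>carrier R. \<forall>x\<in>carrier A. \<phi> (r \<odot>\<^bsub>A\<^esub> x) = r \<odot>\<^bsub>B\<^esub> \<phi> x))"


section \<open>Chain conditions and semisimplicity\<close>

text \<open>All rings here are allowed to lack an identity.\<close>

definition left_ideal :: "'b set \<Rightarrow> ('b, 'm) ring_scheme \<Rightarrow> bool" where
  "left_ideal I A \<longleftrightarrow>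
     additive_subgroup I A \<and> (\<forall>a\<in>carrier A. \<forall>x\<in>I. a \<otimes>\<^bsub>A\<^esub> x \<in> I)"

definition noetherian :: "('b, 'm) ring_scheme \<Rightarrow> bool" where
  "noetherian A \<longleftrightarrow>
     (\<forall>I :: nat \<Rightarrow> 'b set. (\<forall>n. left_ideal (I n) A \<and> I n \<subseteq> I (Suc n)) \<longrightarrow>
        (\<exists>N. \<forall>n\<ge>N. I n = I N))"

definition artinian :: "('b, 'm) ring_scheme \<Rightarrow> bool" where
  "artinian A \<longleftrightarrow>
     (\<forall>I :: nat \<Rightarrow> 'b set. (\<forall>n. left_ideal (I n) A \<and> I (Suc n) \<subseteq> I n) \<longrightarrow>
        (\<exists>N. \<forall>n\<ge>N. I n = I N))"

text \<open>The submodules of a ring, regarded as a left module over itself, are its left ideals.\<close>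

definition simple_left_ideal :: "'b set \<Rightarrow> ('b, 'm) ring_scheme \<Rightarrow> bool" where
  "simple_left_ideal M A \<longleftrightarrow>
     left_ideal M A \<and> M \<noteq> {\<zero>\<^bsub>A\<^esub>} \<and>
     (\<forall>I. left_ideal I A \<and> I \<subseteq> M \<longrightarrow> I = {\<zero>\<^bsub>A\<^esub>} \<or> I = M)"

definition internal_direct_sum :: "('b, 'm) ring_scheme \<Rightarrow> 'b set set \<Rightarrow> bool" where
  "internal_direct_sum A \<M> \<longleftrightarrow>
     (\<forall>x\<in>carrier A. \<exists>F c. finite F \<and> F \<subseteq> \<M> \<and> (\<forall>M\<in>F. c M \<in> M) \<and> x = (\<Oplus>\<^bsub>A\<^esub>M\<in>F. c M)) \<and>
     (\<forall>F c. finite F \<and> F \<subseteq> \<M> \<and> (\<forall>M\<in>F. c M \<in> M) \<and> (\<Oplus>\<^bsub>A\<^esub>M\<in>F. c M) = \<zero>\<^bsub>A\<^esub> \<longrightarrow>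
        (\<forall>M\<in>F. c M = \<zero>\<^bsub>A\<^esub>))"

definition semisimple :: "('b, 'm) ring_scheme \<Rightarrow> bool" where
  "semisimple A \<longleftrightarrow>
     (\<exists>e\<in>carrier A. \<forall>x\<in>carrier A. e \<otimes>\<^bsub>A\<^esub> x = x \<and> x \<otimes>\<^bsub>A\<^esub> e = x) \<and>
     (\<exists>\<M>. (\<forall>M\<in>\<M>. simple_left_ideal M A) \<and> internal_direct_sum A \<M>)"

definition characteristic :: "('b, 'm) ring_scheme \<Rightarrow> nat" where
  "characteristic F =
     (if \<exists>n>0. [(n::nat)] \<cdot>\<^bsub>F\<^esub> \<one>\<^bsub>F\<^esub> = \<zero>\<^bsub>F\<^esub>
      then LEAST n. 0 < n \<and> [(n::nat)] \<cdot>\<^bsub>F\<^esub> \<one>\<^bsub>F\<^esub> = \<zero>\<^bsub>F\<^esub> else 0)"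

end

theory Submission
  imports Defs
begin

text \<open>An infinite set of objects contains strictly monotone sequences of open sets in both
  directions, and the functions supported over them form strict chains of left ideals. If there are
  finitely many objects, the arrow space is discrete and the algebra consists of the finitely
  supported functions; choosing an arrow from a base point to every object of each orbit identifies
  it with a product of matrix algebras over group algebras, and chain conditions pass between the two
  through finite filtrations. An Artinian group algebra comes from a finite group (Connell's
  theorem), and semisimple means Artinian and von Neumann regular, which for group algebras is
  Maschke's averaging argument and its converse.\<close>

section \<open>Chain conditions\<close>

text \<open>With infinitely many objects the algebra may lack a unit. The arguments that force the
  objects to be finite are therefore arranged in \<open>distrib_algebra\<close>, which records an
  additive group, closure of the product and distributivity in the right factor. Associativity and
  the unit enter afterwards, for finitely supported functions over finitely many objects, where
  induction over point masses is available. A second obstacle is that the arrows need not form a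
  Hausdorff space: compact sets need not be closed there, so differences of compact open sets are
  formed inside a compact open set only. Connell's theorem is reached without the Jacobson radical:
  the involution and the trace of a group algebra supply the two-sided information with which a
  nonzero element annihilated by the augmentation ideal is found.\<close>

definition stabilizes :: "(nat \<Rightarrow> 'b) \<Rightarrow> bool" where
  "stabilizes I \<longleftrightarrow> (\<exists>N. \<forall>n\<ge>N. I n = I N)"

definition chain :: "bool \<Rightarrow> (nat \<Rightarrow> 'b set) \<Rightarrow> bool" where
  "chain up I \<longleftrightarrow> (\<forall>n. if up then I n \<subseteq> I (Suc n) else I (Suc n) \<subseteq> I n)"

text \<open>The parameter selects the ascending (\<open>True\<close>) or the descending (\<open>False\<close>) chain condition,
  so that arguments common to both are carried out once.\<close>

definition chain_condition :: "bool \<Rightarrow> ('b, 'm) ring_scheme \<Rightarrow> bool" where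
  "chain_condition up A \<longleftrightarrow> (\<forall>I. (\<forall>n. left_ideal (I n) A) \<and> chain up I \<longrightarrow> stabilizes I)"

lemma noetherian_iff: "noetherian A \<longleftrightarrow> chain_condition True A"
  by (auto simp: noetherian_def chain_condition_def chain_def stabilizes_def)

lemma artinian_iff: "artinian A \<longleftrightarrow> chain_condition False A"
  by (auto simp: artinian_def chain_condition_def chain_def stabilizes_def)

lemma chain_total:
  assumes "chain up I"
  shows "I m \<subseteq> I n \<or> I n \<subseteq> I m"
proof (cases up)
  case True
  then have "\<And>n. I n \<subseteq> I (Suc n)" using assms by (auto simp: chain_def)
  then have "\<And>m n. m \<le> n \<Longrightarrow> I m \<subseteq> I n" by (rule lift_Suc_mono_le)
  then show ?thesis using nat_le_linear by blast
next
  case False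
  then have "\<And>n. I (Suc n) \<subseteq> I n" using assms by (auto simp: chain_def)
  then have "\<And>m n. m \<le> n \<Longrightarrow> I n \<subseteq> I m" by (rule lift_Suc_antimono_le)
  then show ?thesis using nat_le_linear by blast
qed

lemma chain_image:
  assumes "chain up I" and "\<And>X Y. X \<subseteq> Y \<Longrightarrow> F X \<subseteq> F Y"
  shows "chain up (\<lambda>n. F (I n))"
  using assms by (auto simp: chain_def)

text \<open>A monotone sequence that has left its first value cannot return to it, and with only two
  values available a second change would be a return.\<close>

lemma stabilizes_two_values:
  assumes c: "chain up I" and two: "\<And>n. I n = X \<or> I n = Y"
  shows "stabilizes I"
proof (rule ccontr)
  assume "\<not> stabilizes I"
  then have *: "\<And>N. \<exists>n\<ge>N. I n \<noteq> I N" by (auto simp: stabilizes_def)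
  obtain n where n: "I n \<noteq> I 0" using * by blast
  obtain k where k: "k \<ge> n" "I k \<noteq> I n" using * by blast
  have eq: "I k = I 0" using two[of 0] two[of n] two[of k] n k by metis
  have mono: "I 0 \<subseteq> I n \<and> I n \<subseteq> I k \<or> I n \<subseteq> I 0 \<and> I k \<subseteq> I n"
  proof (cases up)
    case True
    then have "\<And>n. I n \<subseteq> I (Suc n)" using c by (auto simp: chain_def)
    then have "\<And>m n. m \<le> n \<Longrightarrow> I m \<subseteq> I n" by (rule lift_Suc_mono_le)
    then show ?thesis using k by blast
  next
    case False
    then have "\<And>n. I (Suc n) \<subseteq> I n" using c by (auto simp: chain_def)
    then have "\<And>m n. m \<le> n \<Longrightarrow> I n \<subseteq> I m" by (rule lift_Suc_antimono_le)
    then show ?thesis using k by blast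
  qed
  then show False using eq n by auto
qed

text \<open>The extension step of the finite filtrations below, phrased without quotients.
  \<open>P\<close> is the part already treated, \<open>Q\<close> the next one, and \<open>D\<close>
  is any invariant whose equality at \<open>m\<close> and \<open>n\<close> forces the parts of
  \<open>I m\<close> and \<open>I n\<close> in \<open>Q\<close> to have the same image modulo
  \<open>P\<close>. For nested subgroups, equal intersections with \<open>P\<close> and equal images
  modulo \<open>P\<close> give equality by the modular law.\<close>

lemma (in abelian_group) stabilizes_step:
  assumes add: "\<And>n. additive_subgroup (I n) G"
    and c: "chain up I"
    and P: "stabilizes (\<lambda>n. I n \<inter> P)"
    and D: "stabilizes D"
    and lift: "\<And>m n f. D m = D n \<Longrightarrow> f \<in> I n \<Longrightarrow> f \<in> Q \<Longrightarrow> \<exists>h\<in>I m \<inter> Q. f \<ominus> h \<in> P"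
  shows "stabilizes (\<lambda>n. I n \<inter> Q)"
proof -
  obtain N1 where N1: "\<And>n. n \<ge> N1 \<Longrightarrow> I n \<inter> P = I N1 \<inter> P" using P unfolding stabilizes_def by blast
  obtain N2 where N2: "\<And>n. n \<ge> N2 \<Longrightarrow> D n = D N2" using D unfolding stabilizes_def by blast
  define N where "N = max N1 N2"
  have key: "I n \<inter> Q \<subseteq> I m \<inter> Q" if "n \<ge> N" "m \<ge> N" "I m \<subseteq> I n" for m n
  proof
    fix f assume f: "f \<in> I n \<inter> Q"
    have DD: "D m = D n" using N2[of m] N2[of n] that by (simp add: N_def)
    obtain h where h: "h \<in> I m" "h \<in> Q" "f \<ominus> h \<in> P" using lift[OF DD] f by blast
    interpret n: additive_subgroup "I n" G by (rule add)
    interpret m: additive_subgroup "I m" G by (rule add)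
    have fc: "f \<in> carrier G" "h \<in> carrier G" using f h n.a_subset m.a_subset by auto
    have "f \<ominus> h \<in> I n" using f h that(3) unfolding minus_eq by auto
    then have "f \<ominus> h \<in> I m" using h(3) N1[of m] N1[of n] that by (auto simp: N_def)
    then have "(f \<ominus> h) \<oplus> h \<in> I m" using h by auto
    moreover have "(f \<ominus> h) \<oplus> h = f" using fc by (simp add: minus_eq a_assoc l_neg)
    ultimately show "f \<in> I m \<inter> Q" using f by auto
  qed
  have "I n \<inter> Q = I N \<inter> Q" if "n \<ge> N" for n
    using key[of n N] key[of N n] chain_total[OF c, of n N] that by auto
  then show ?thesis unfolding stabilizes_def by blast
qed

text \<open>Interpreted by unital rings and by the groupoid algebra over an arbitrary object
  space.\<close>

locale distrib_algebra = abelian_group A for A (structure) +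
  assumes mult_closed: "x \<in> carrier A \<Longrightarrow> y \<in> carrier A \<Longrightarrow> x \<otimes> y \<in> carrier A"
    and mult_add_distrib: "x \<in> carrier A \<Longrightarrow> y \<in> carrier A \<Longrightarrow> z \<in> carrier A \<Longrightarrow>
           x \<otimes> (y \<oplus> z) = x \<otimes> y \<oplus> x \<otimes> z"

sublocale ring < distrib_algebra R
  by unfold_locales (auto simp: r_distr)

definition simple_sum :: "('b, 'm) ring_scheme \<Rightarrow> 'b set set \<Rightarrow> 'b set" where
  "simple_sum A F = {\<Oplus>\<^bsub>A\<^esub>M\<in>F. c M | c. \<forall>M\<in>F. c M \<in> M}"

section \<open>Left ideals and finite sums of simple left ideals\<close>

context distrib_algebra
begin

lemma left_ideal_additive: "left_ideal I A \<Longrightarrow> additive_subgroup I A"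
  by (simp add: left_ideal_def)

lemma left_ideal_subset: "left_ideal I A \<Longrightarrow> I \<subseteq> carrier A"
  by (simp add: left_ideal_def additive_subgroup.a_subset)

lemma left_ideal_mult: "left_ideal I A \<Longrightarrow> a \<in> carrier A \<Longrightarrow> x \<in> I \<Longrightarrow> a \<otimes> x \<in> I"
  by (simp add: left_ideal_def)

lemma left_ideal_add: "left_ideal I A \<Longrightarrow> x \<in> I \<Longrightarrow> y \<in> I \<Longrightarrow> x \<oplus> y \<in> I"
  by (simp add: left_ideal_def additive_subgroup.a_closed)

lemma left_ideal_zero: "left_ideal I A \<Longrightarrow> \<zero> \<in> I"
  by (simp add: left_ideal_def additive_subgroup.zero_closed)

lemma left_ideal_neg: "left_ideal I A \<Longrightarrow> x \<in> I \<Longrightarrow> \<ominus> x \<in> I"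
  using additive_subgroup.a_inv_closed abelian_group_axioms by (auto simp: left_ideal_def)

lemma left_ideal_minus: "left_ideal I A \<Longrightarrow> x \<in> I \<Longrightarrow> y \<in> I \<Longrightarrow> x \<ominus> y \<in> I"
  by (simp add: minus_eq left_ideal_add left_ideal_neg)

lemma additive_subgroupI':
  assumes "I \<subseteq> carrier A" "\<zero> \<in> I" "\<And>x y. x \<in> I \<Longrightarrow> y \<in> I \<Longrightarrow> x \<oplus> y \<in> I" "\<And>x. x \<in> I \<Longrightarrow> \<ominus> x \<in> I"
  shows "additive_subgroup I A"
proof (rule additive_subgroupI, rule add.subgroupI)
  show "I \<subseteq> carrier A" "I \<noteq> {}" using assms by auto
qed (use assms in auto)

lemma left_idealI:
  assumes "I \<subseteq> carrier A" "\<zero> \<in> I" "\<And>x y. x \<in> I \<Longrightarrow> y \<in> I \<Longrightarrow> x \<oplus> y \<in> I" "\<And>x. x \<in> I \<Longrightarrow> \<ominus> x \<in> I"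
    "\<And>a x. a \<in> carrier A \<Longrightarrow> x \<in> I \<Longrightarrow> a \<otimes> x \<in> I"
  shows "left_ideal I A"
  using additive_subgroupI'[OF assms(1-4)] assms(5) by (auto simp: left_ideal_def)

lemma mult_zero: "x \<in> carrier A \<Longrightarrow> x \<otimes> \<zero> = \<zero>"
  using mult_add_distrib[of x \<zero> \<zero>] mult_closed[of x \<zero>] add.r_cancel_one[of "x \<otimes> \<zero>" "x \<otimes> \<zero>"] by auto

lemma left_ideal_zero_set: "left_ideal {\<zero>} A"
  by (rule left_idealI) (auto simp: mult_zero)

lemma left_ideal_Int: "left_ideal I A \<Longrightarrow> left_ideal J A \<Longrightarrow> left_ideal (I \<inter> J) A"
  by (rule left_idealI)
    (use left_ideal_subset in \<open>auto simp: left_ideal_add left_ideal_mult left_ideal_neg left_ideal_zero\<close>)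

lemma left_ideal_set_add:
  assumes I: "left_ideal I A" and J: "left_ideal J A"
  shows "left_ideal {i \<oplus> j | i j. i \<in> I \<and> j \<in> J} A"
proof (rule left_idealI)
  note IJ = left_ideal_subset[OF I] left_ideal_subset[OF J]
  show "{i \<oplus> j |i j. i \<in> I \<and> j \<in> J} \<subseteq> carrier A" using IJ by auto
  show "\<zero> \<in> {i \<oplus> j |i j. i \<in> I \<and> j \<in> J}"
    using left_ideal_zero[OF I] left_ideal_zero[OF J] l_zero[OF zero_closed] by force
  show "x \<oplus> y \<in> {i \<oplus> j |i j. i \<in> I \<and> j \<in> J}"
    if "x \<in> {i \<oplus> j |i j. i \<in> I \<and> j \<in> J}" "y \<in> {i \<oplus> j |i j. i \<in> I \<and> j \<in> J}" for x y
  proof -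
    obtain i j i' j' where *: "x = i \<oplus> j" "y = i' \<oplus> j'" "i \<in> I" "j \<in> J" "i' \<in> I" "j' \<in> J"
      using \<open>x \<in> _\<close> \<open>y \<in> _\<close> by blast
    then have "x \<oplus> y = (i \<oplus> i') \<oplus> (j \<oplus> j')" using IJ by (simp add: a_ac subset_iff)
    then show ?thesis using * left_ideal_add I J by blast
  qed
  show "\<ominus> x \<in> {i \<oplus> j |i j. i \<in> I \<and> j \<in> J}" if "x \<in> {i \<oplus> j |i j. i \<in> I \<and> j \<in> J}" for x
  proof -
    obtain i j where *: "x = i \<oplus> j" "i \<in> I" "j \<in> J" using \<open>x \<in> _\<close> by blast
    then have "\<ominus> x = \<ominus> i \<oplus> \<ominus> j" using IJ by (simp add: minus_add subset_iff)
    then show ?thesis using * left_ideal_neg I J by blast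
  qed
  show "a \<otimes> x \<in> {i \<oplus> j |i j. i \<in> I \<and> j \<in> J}"
    if a: "a \<in> carrier A" and "x \<in> {i \<oplus> j |i j. i \<in> I \<and> j \<in> J}" for a x
  proof -
    obtain i j where *: "x = i \<oplus> j" "i \<in> I" "j \<in> J" using \<open>x \<in> _\<close> by blast
    then have "a \<otimes> x = a \<otimes> i \<oplus> a \<otimes> j" using IJ a by (simp add: mult_add_distrib subset_iff)
    then show ?thesis using * left_ideal_mult I J a by blast
  qed
qed

lemma simple_left_ideal_left_ideal: "simple_left_ideal M A \<Longrightarrow> left_ideal M A"
  by (simp add: simple_left_ideal_def)

lemma simple_sum_empty: "simple_sum A {} = {\<zero>}"
  by (simp add: simple_sum_def)

lemma simple_sum_insert:
  assumes "finite F" "M \<notin> F" "\<And>N. N \<in> insert M F \<Longrightarrow> N \<subseteq> carrier A"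
  shows "simple_sum A (insert M F) = {m \<oplus> p | m p. m \<in> M \<and> p \<in> simple_sum A F}"
proof (intro equalityI subsetI)
  fix x assume "x \<in> simple_sum A (insert M F)"
  then obtain c where c: "\<forall>N\<in>insert M F. c N \<in> N" "x = (\<Oplus>N\<in>insert M F. c N)"
    by (auto simp: simple_sum_def)
  have "x = c M \<oplus> (\<Oplus>N\<in>F. c N)"
    unfolding c(2) using assms(1,2)
  proof (rule finsum_insert)
    show "c \<in> F \<rightarrow> carrier A" "c M \<in> carrier A" using c(1) assms(3) by blast+
  qed
  then show "x \<in> {m \<oplus> p | m p. m \<in> M \<and> p \<in> simple_sum A F}" using c(1) by (auto simp: simple_sum_def)
next
  fix x assume "x \<in> {m \<oplus> p | m p. m \<in> M \<and> p \<in> simple_sum A F}"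
  then obtain m c where c: "m \<in> M" "\<forall>N\<in>F. c N \<in> N" "x = m \<oplus> (\<Oplus>N\<in>F. c N)" by (auto simp: simple_sum_def)
  define c' where "c' = c(M := m)"
  have cc: "c \<in> F \<rightarrow> carrier A" and c': "m \<in> carrier A" using c assms by blast+
  have "(\<Oplus>N\<in>insert M F. c' N) = c' M \<oplus> (\<Oplus>N\<in>F. c' N)"
    using c assms(1,2) cc c'(1) by (intro finsum_insert) (auto simp: c'_def)
  also have "(\<Oplus>N\<in>F. c' N) = (\<Oplus>N\<in>F. c N)"
  proof (rule finsum_cong')
    show "c \<in> F \<rightarrow> carrier A" by (rule cc)
  qed (use assms in \<open>auto simp: c'_def\<close>)
  finally have "x = (\<Oplus>N\<in>insert M F. c' N)" by (simp add: c c'_def)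
  moreover have "\<forall>N\<in>insert M F. c' N \<in> N" using c by (auto simp: c'_def)
  ultimately show "x \<in> simple_sum A (insert M F)" unfolding simple_sum_def by blast
qed

lemma left_ideal_simple_sum:
  assumes "finite F" "\<And>N. N \<in> F \<Longrightarrow> left_ideal N A"
  shows "left_ideal (simple_sum A F) A"
  using assms
proof (induction F)
  case empty
  then show ?case by (simp add: simple_sum_empty left_ideal_zero_set)
next
  case (insert M F)
  show ?case
    using insert left_ideal_subset by (subst simple_sum_insert) (auto intro!: left_ideal_set_add)
qed

text \<open>Induction on the number of simple summands, a composition series in disguise: modulo the
  sum \<open>P\<close> of the earlier summands, a left ideal meets the next summand \<open>M\<close>
  in nothing or in all of it.\<close>

lemma simple_sum_chain_stabilizes:
  assumes F: "finite F" "\<And>M. M \<in> F \<Longrightarrow> simple_left_ideal M A"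
    and I: "\<And>n. left_ideal (I n) A" and c: "chain up I"
  shows "stabilizes (\<lambda>n. I n \<inter> simple_sum A F)"
  using F
proof (induction F)
  case empty
  have "\<And>n. I n \<inter> {\<zero>} = {\<zero>}" using left_ideal_zero[OF I] by auto
  then show ?case by (simp add: simple_sum_empty stabilizes_def)
next
  case (insert M F)
  define P where "P = simple_sum A F"
  have P: "left_ideal P A" unfolding P_def
    using insert by (intro left_ideal_simple_sum) (auto simp: simple_left_ideal_def)
  have M: "left_ideal M A" using insert by (auto simp: simple_left_ideal_def)
  note sub = left_ideal_subset[OF P] left_ideal_subset[OF M]
  \<comment> \<open>This is the intersection of \<open>M\<close> with \<open>X + P\<close>. For a
    left ideal \<open>X\<close> it is a left ideal inside the simple \<open>M\<close>, hence one of
    two sets, and it serves as the invariant \<open>D\<close>.\<close>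
  define K where "K X = {m \<in> M. \<exists>p\<in>P. m \<oplus> p \<in> X}" for X
  have Kideal: "left_ideal (K (I n)) A" for n
  proof (rule left_idealI)
    show "K (I n) \<subseteq> carrier A" using sub by (auto simp: K_def)
    show "\<zero> \<in> K (I n)"
      using left_ideal_zero[OF M] left_ideal_zero[OF P] left_ideal_zero[OF I, of n] l_zero
      by (auto simp: K_def intro!: bexI[of _ \<zero>])
    show "x \<oplus> y \<in> K (I n)" if xy: "x \<in> K (I n)" "y \<in> K (I n)" for x y
    proof -
      obtain p q where *: "x \<in> M" "y \<in> M" "p \<in> P" "q \<in> P" "x \<oplus> p \<in> I n" "y \<oplus> q \<in> I n"
        using xy by (auto simp: K_def)
      have "(x \<oplus> y) \<oplus> (p \<oplus> q) = (x \<oplus> p) \<oplus> (y \<oplus> q)" using * sub by (simp add: a_ac subset_iff)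
      then show ?thesis
        using * left_ideal_add[OF M, of x y] left_ideal_add[OF P, of p q]
          left_ideal_add[OF I, of "x \<oplus> p" n "y \<oplus> q"] unfolding K_def
        by (auto intro!: bexI[of _ "p \<oplus> q"])
    qed
    show "\<ominus> x \<in> K (I n)" if x: "x \<in> K (I n)" for x
    proof -
      obtain p where *: "x \<in> M" "p \<in> P" "x \<oplus> p \<in> I n" using x by (auto simp: K_def)
      have "\<ominus> x \<oplus> \<ominus> p = \<ominus> (x \<oplus> p)" using * sub by (simp add: minus_add subset_iff)
      then show ?thesis
        using * left_ideal_neg[OF M] left_ideal_neg[OF P] left_ideal_neg[OF I] by (force simp: K_def)
    qed
    show "a \<otimes> x \<in> K (I n)" if a: "a \<in> carrier A" and x: "x \<in> K (I n)" for a x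
    proof -
      obtain p where *: "x \<in> M" "p \<in> P" "x \<oplus> p \<in> I n" using x by (auto simp: K_def)
      have "a \<otimes> x \<oplus> a \<otimes> p = a \<otimes> (x \<oplus> p)" using * sub a by (simp add: mult_add_distrib subset_iff)
      then show ?thesis
        using * left_ideal_mult[OF M a] left_ideal_mult[OF P a] left_ideal_mult[OF I a] by (force simp: K_def)
    qed
  qed
  have two: "K (I n) = {\<zero>} \<or> K (I n) = M" for n
    using insert.prems[of M] Kideal[of n] unfolding simple_left_ideal_def by (auto simp: K_def)
  have Q: "simple_sum A (insert M F) = {m \<oplus> p | m p. m \<in> M \<and> p \<in> P}"
    unfolding P_def using insert left_ideal_subset
    by (intro simple_sum_insert) (auto simp: simple_left_ideal_def)
  show ?case
  proof (rule stabilizes_step[where P = P and D = "\<lambda>n. K (I n)"])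
    show "stabilizes (\<lambda>n. I n \<inter> P)" using insert by (simp add: P_def)
    show "stabilizes (\<lambda>n. K (I n))"
      by (rule stabilizes_two_values[OF _ two], rule chain_image[OF c]) (auto simp: K_def)
    fix m n f
    assume KK: "K (I m) = K (I n)" and f: "f \<in> I n" "f \<in> simple_sum A (insert M F)"
    obtain x p where xp: "f = x \<oplus> p" "x \<in> M" "p \<in> P" using f(2) Q by auto
    then have "x \<in> K (I m)" using f KK by (auto simp: K_def)
    then obtain q where q: "q \<in> P" "x \<oplus> q \<in> I m" by (auto simp: K_def)
    \<comment> \<open>\<open>x \<oplus> q\<close> lies in \<open>I m\<close> and has the same
      \<open>M\<close>-part as \<open>f\<close>, so the difference falls into
      \<open>P\<close>.\<close>
    have "f \<ominus> (x \<oplus> q) = (x \<oplus> \<ominus> x) \<oplus> (p \<ominus> q)"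
      using xp q sub by (simp add: minus_eq minus_add a_ac subset_iff)
    then have "f \<ominus> (x \<oplus> q) = p \<ominus> q" using xp q sub by (simp add: r_neg subset_iff)
    then have "f \<ominus> (x \<oplus> q) \<in> P" using left_ideal_minus[OF P] xp q by simp
    then show "\<exists>h\<in>I m \<inter> simple_sum A (insert M F). f \<ominus> h \<in> P"
      using q xp Q by blast
  qed (use c left_ideal_additive[OF I] in auto)
qed

lemma chain_condition_simple_sum:
  assumes "finite F" "\<And>M. M \<in> F \<Longrightarrow> simple_left_ideal M A" "carrier A \<subseteq> simple_sum A F"
  shows "chain_condition up A"
  unfolding chain_condition_def
proof (intro allI impI)
  fix I assume I: "(\<forall>n. left_ideal (I n) A) \<and> chain up I"
  then have "stabilizes (\<lambda>n. I n \<inter> simple_sum A F)"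
    using assms simple_sum_chain_stabilizes[of F I up] by blast
  moreover have "I n \<inter> simple_sum A F = I n" for n
    using I left_ideal_subset[of "I n"] assms(3) by auto
  ultimately show "stabilizes I" by simp
qed

lemma mult_finsum:
  assumes "finite F" "x \<in> carrier A" "c \<in> F \<rightarrow> carrier A"
  shows "x \<otimes> (\<Oplus>i\<in>F. c i) = (\<Oplus>i\<in>F. x \<otimes> c i)"
  using assms
proof (induction F)
  case empty
  then show ?case by (simp add: mult_zero)
next
  case (insert i F)
  have c: "c \<in> F \<rightarrow> carrier A" "c i \<in> carrier A" using insert.prems by auto
  have "(\<Oplus>j\<in>insert i F. x \<otimes> c j) = x \<otimes> c i \<oplus> (\<Oplus>j\<in>F. x \<otimes> c j)"
    using insert.hyps c insert.prems(1) by (intro finsum_insert) (auto intro!: mult_closed)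
  then show ?case
    using insert.hyps insert.IH[OF insert.prems(1) c(1)] c insert.prems(1)
    by (simp add: finsum_insert mult_add_distrib finsum_closed)
qed

text \<open>The unit already lies in the sum of finitely many of the simple summands. Writing
  \<open>x\<close> as \<open>x \<otimes> e\<close> puts every \<open>x\<close> into that finite
  sum.\<close>

lemma semisimple_simple_sum:
  assumes "semisimple A"
  obtains F where "finite F" "\<And>M. M \<in> F \<Longrightarrow> simple_left_ideal M A" "carrier A \<subseteq> simple_sum A F"
proof -
  obtain e \<M> where e: "e \<in> carrier A" "\<forall>x\<in>carrier A. e \<otimes> x = x \<and> x \<otimes> e = x"
    and M: "\<forall>M\<in>\<M>. simple_left_ideal M A" "internal_direct_sum A \<M>"
    using assms unfolding semisimple_def by blast
  obtain F c where F: "finite F" "F \<subseteq> \<M>" "\<forall>M\<in>F. c M \<in> M" "e = (\<Oplus>M\<in>F. c M)"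
    using M(2) e(1) unfolding internal_direct_sum_def by meson
  have li: "left_ideal N A" if "N \<in> F" for N
    using that F(2) M(1) simple_left_ideal_left_ideal by blast
  have cc: "c \<in> F \<rightarrow> carrier A" using F(3) li left_ideal_subset by blast
  have "x \<in> simple_sum A F" if x: "x \<in> carrier A" for x
  proof -
    have "x = x \<otimes> e" using e x by simp
    also have "\<dots> = (\<Oplus>M\<in>F. x \<otimes> c M)" unfolding F(4) by (rule mult_finsum[OF F(1) x cc])
    finally show ?thesis using left_ideal_mult[OF li x] F(3) unfolding simple_sum_def by blast
  qed
  then show ?thesis using that[OF F(1)] F(2) M(1) by blast
qed

lemma semisimple_chain_condition: "semisimple A \<Longrightarrow> chain_condition up A"
  by (erule semisimple_simple_sum) (rule chain_condition_simple_sum)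

lemma artinian_minimal:
  assumes art: "artinian A" and ne: "I0 \<in> S" and S: "\<And>I. I \<in> S \<Longrightarrow> left_ideal I A"
  obtains I where "I \<in> S" "\<And>J. J \<in> S \<Longrightarrow> J \<subseteq> I \<Longrightarrow> J = I"
proof (rule ccontr)
  assume "\<not> thesis"
  then have *: "\<And>I. I \<in> S \<Longrightarrow> \<exists>J\<in>S. J \<subset> I" using that by blast
  have "\<exists>I. \<forall>n. I n \<in> S \<and> I (Suc n) \<subset> I n"
    by (rule dependent_nat_choice) (use ne * in auto)
  then obtain I where I: "\<And>n. I n \<in> S \<and> I (Suc n) \<subset> I n" by blast
  have "\<exists>N. \<forall>n\<ge>N. I n = I N" using art I S unfolding artinian_def by blast
  then show False using I by (metis le_SucI order_refl psubset_eq)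
qed

end

definition von_neumann_regular :: "('b, 'm) ring_scheme \<Rightarrow> bool" where
  "von_neumann_regular A \<longleftrightarrow>
     (\<forall>a\<in>carrier A. \<exists>b\<in>carrier A. a \<otimes>\<^bsub>A\<^esub> b \<otimes>\<^bsub>A\<^esub> a = a)"

definition left_principal :: "('b, 'm) ring_scheme \<Rightarrow> 'b \<Rightarrow> 'b set" where
  "left_principal A a = {b \<otimes>\<^bsub>A\<^esub> a | b. b \<in> carrier A}"

section \<open>Semisimple rings and Artinian von Neumann regular rings\<close>

context ring
begin

lemma left_ideal_principal:
  assumes a: "a \<in> carrier R"
  shows "left_ideal (left_principal R a) R"
proof (rule left_idealI)
  show "left_principal R a \<subseteq> carrier R" using a by (auto simp: left_principal_def)
  show "\<zero> \<in> left_principal R a" using a by (auto simp: left_principal_def intro!: exI[of _ \<zero>])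
  show "x \<oplus> y \<in> left_principal R a" if xy: "x \<in> left_principal R a" "y \<in> left_principal R a" for x y
  proof -
    obtain b c where "b \<in> carrier R" "c \<in> carrier R" "x = b \<otimes> a" "y = c \<otimes> a"
      using xy by (auto simp: left_principal_def)
    then show ?thesis using a by (auto simp: left_principal_def l_distr intro!: exI[of _ "b \<oplus> c"])
  qed
  show "\<ominus> x \<in> left_principal R a" if "x \<in> left_principal R a" for x
    using that a by (auto simp: left_principal_def l_minus[symmetric])
  show "b \<otimes> x \<in> left_principal R a" if "b \<in> carrier R" "x \<in> left_principal R a" for b x
    using that a by (auto simp: left_principal_def m_assoc[symmetric])
qed

lemma principal_self: "a \<in> carrier R \<Longrightarrow> a \<in> left_principal R a"
  by (auto simp: left_principal_def intro!: exI[of _ \<one>])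

lemma principal_minimal: "left_ideal I R \<Longrightarrow> a \<in> I \<Longrightarrow> left_principal R a \<subseteq> I"
  by (auto simp: left_principal_def left_ideal_mult)

text \<open>The simple ideals are treated one at a time. One that lies in \<open>I + N\<close>
  changes nothing; any other meets \<open>I + N\<close> trivially by simplicity and is added to
  \<open>N\<close>.\<close>

lemma exists_complement:
  assumes "finite F" "\<And>M. M \<in> F \<Longrightarrow> simple_left_ideal M R" and I: "left_ideal I R"
  shows "\<exists>N. left_ideal N R \<and> I \<inter> N = {\<zero>} \<and> simple_sum R F \<subseteq> {i \<oplus> n | i n. i \<in> I \<and> n \<in> N}"
  using assms(1,2)
proof (induction F)
  case empty
  have "I \<inter> {\<zero>} = {\<zero>}" "\<zero> \<in> {i \<oplus> n | i n. i \<in> I \<and> n \<in> {\<zero>}}"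
    using left_ideal_zero[OF I] l_zero[of \<zero>] by (force+)
  then show ?case using left_ideal_zero_set by (auto simp: simple_sum_empty)
next
  case (insert M F)
  then obtain N where N: "left_ideal N R" "I \<inter> N = {\<zero>}"
      "simple_sum R F \<subseteq> {i \<oplus> n | i n. i \<in> I \<and> n \<in> N}" by auto
  have M: "left_ideal M R" "\<And>J. left_ideal J R \<Longrightarrow> J \<subseteq> M \<Longrightarrow> J = {\<zero>} \<or> J = M"
    using insert.prems by (auto simp: simple_left_ideal_def)
  have ins: "simple_sum R (insert M F) = {m \<oplus> p | m p. m \<in> M \<and> p \<in> simple_sum R F}"
    using insert left_ideal_subset by (intro simple_sum_insert) (auto simp: simple_left_ideal_def)
  define T where "T = {i \<oplus> n | i n. i \<in> I \<and> n \<in> N}"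
  have T: "left_ideal T R" unfolding T_def by (rule left_ideal_set_add[OF I N(1)])
  note sub = left_ideal_subset[OF I] left_ideal_subset[OF N(1)] left_ideal_subset[OF M(1)]
  consider "M \<subseteq> T" | "T \<inter> M = {\<zero>}"
    using M(2)[OF left_ideal_Int[OF T M(1)]] by blast
  then show ?case
  proof cases
    case 1
    have "simple_sum R (insert M F) \<subseteq> T"
      using 1 N(3) left_ideal_add[OF T] unfolding ins T_def[symmetric] by blast
    then show ?thesis using N T_def by blast
  next
    case 2
    define N' where "N' = {n \<oplus> m | n m. n \<in> N \<and> m \<in> M}"
    have N': "left_ideal N' R" unfolding N'_def by (rule left_ideal_set_add[OF N(1) M(1)])
    have "I \<inter> N' \<subseteq> {\<zero>}"
    proof
      fix x assume x: "x \<in> I \<inter> N'"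
      then obtain n m where nm: "x = n \<oplus> m" "n \<in> N" "m \<in> M" by (auto simp: N'_def)
      \<comment> \<open>For a common element \<open>x\<close> of \<open>I\<close> and
        \<open>N + M\<close>, the \<open>M\<close>-part lies in \<open>T\<close> and therefore
        vanishes, so \<open>x\<close> belongs to both \<open>I\<close> and \<open>N\<close>.\<close>
      have "m = x \<oplus> \<ominus> n" using nm sub by (simp add: a_ac r_neg r_neg1 r_neg2 subset_iff)
      then have "m \<in> T" using x nm left_ideal_neg[OF N(1)] by (auto simp: T_def)
      then have "m = \<zero>" using 2 nm by auto
      then have "x = n" using nm sub by (auto simp: subset_iff)
      then show "x \<in> {\<zero>}" using x nm N(2) by auto
    qed
    then have 3: "I \<inter> N' = {\<zero>}" using left_ideal_zero[OF I] left_ideal_zero[OF N'] by auto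
    have "simple_sum R (insert M F) \<subseteq> {i \<oplus> n | i n. i \<in> I \<and> n \<in> N'}"
    proof
      fix x assume "x \<in> simple_sum R (insert M F)"
      then obtain m p where mp: "x = m \<oplus> p" "m \<in> M" "p \<in> simple_sum R F" unfolding ins by blast
      then obtain i n where "p = i \<oplus> n" "i \<in> I" "n \<in> N" using N(3) by blast
      then have "x = i \<oplus> (n \<oplus> m)" "i \<in> I" "n \<oplus> m \<in> N'"
        using mp sub by (auto simp: a_assoc a_comm[of m] subset_iff N'_def)
      then show "x \<in> {i \<oplus> n | i n. i \<in> I \<and> n \<in> N'}" by blast
    qed
    then show ?thesis using N' 3 by blast
  qed
qed

text \<open>A complement \<open>N\<close> of the left ideal of \<open>a\<close> splits the unit as
  \<open>b \<otimes> a \<oplus> n\<close>. Then \<open>a \<otimes> n\<close>, being \<open>a\<close>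
  minus \<open>a \<otimes> b \<otimes> a\<close>, lies in both ideals and is zero.\<close>

lemma semisimple_von_neumann_regular:
  assumes "semisimple R"
  shows "von_neumann_regular R"
  unfolding von_neumann_regular_def
proof
  fix a assume a: "a \<in> carrier R"
  obtain F where F: "finite F" "\<And>M. M \<in> F \<Longrightarrow> simple_left_ideal M R" "carrier R \<subseteq> simple_sum R F"
    using semisimple_simple_sum[OF assms] by blast
  obtain N where N: "left_ideal N R" "left_principal R a \<inter> N = {\<zero>}"
      "simple_sum R F \<subseteq> {i \<oplus> n | i n. i \<in> left_principal R a \<and> n \<in> N}"
    using exists_complement[OF F(1,2) left_ideal_principal[OF a]] by blast
  have "\<one> \<in> {i \<oplus> n | i n. i \<in> left_principal R a \<and> n \<in> N}" using N(3) F(3) by blast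
  then obtain b n where bn: "\<one> = b \<otimes> a \<oplus> n" "b \<in> carrier R" "n \<in> N" by (auto simp: left_principal_def)
  have n: "n \<in> carrier R" using bn left_ideal_subset[OF N(1)] by auto
  have "a = a \<otimes> (b \<otimes> a \<oplus> n)" using a bn(1)[symmetric] by simp
  also have "\<dots> = a \<otimes> b \<otimes> a \<oplus> a \<otimes> n" using a bn n by (simp add: r_distr m_assoc)
  finally have eq: "a = a \<otimes> b \<otimes> a \<oplus> a \<otimes> n" .
  then have "a \<otimes> n = a \<ominus> a \<otimes> b \<otimes> a"
    using r_neg1[of "a \<otimes> b \<otimes> a" "a \<otimes> n"] a bn n by (simp add: a_minus_def a_comm r_neg2)
  moreover have "a \<ominus> a \<otimes> b \<otimes> a \<in> left_principal R a"
    using a bn by (intro left_ideal_minus left_ideal_principal principal_self)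
      (auto simp: left_principal_def)
  ultimately have "a \<otimes> n = \<zero>" using N(2) left_ideal_mult[OF N(1) a bn(3)] by auto
  then have "a \<otimes> b \<otimes> a = a" using eq a bn by simp
  then show "\<exists>b\<in>carrier R. a \<otimes> b \<otimes> a = a" using bn by blast
qed

lemma exists_simple_left_ideal:
  assumes art: "artinian R" and I: "left_ideal I R" "I \<noteq> {\<zero>}"
  obtains M where "simple_left_ideal M R" "M \<subseteq> I"
proof -
  define S where "S = {J. left_ideal J R \<and> J \<subseteq> I \<and> J \<noteq> {\<zero>}}"
  have "I \<in> S" "\<And>J. J \<in> S \<Longrightarrow> left_ideal J R" using I by (auto simp: S_def)
  then obtain M where M: "M \<in> S" "\<And>J. J \<in> S \<Longrightarrow> J \<subseteq> M \<Longrightarrow> J = M"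
    using artinian_minimal[OF art] by blast
  then have "simple_left_ideal M R" unfolding simple_left_ideal_def S_def by blast
  then show ?thesis using that M by (auto simp: S_def)
qed

lemma orthogonal_sum:
  assumes E: "finite E" "E \<subseteq> carrier R" "\<And>f. f \<in> E \<Longrightarrow> f \<otimes> f = f"
    "\<And>f g. f \<in> E \<Longrightarrow> g \<in> E \<Longrightarrow> f \<noteq> g \<Longrightarrow> f \<otimes> g = \<zero>" and f: "f \<in> E"
  shows "f \<otimes> (\<Oplus>g\<in>E. g) = f" and "(\<Oplus>g\<in>E. g) \<otimes> f = f"
proof -
  have "f \<otimes> (\<Oplus>g\<in>E. g) = (\<Oplus>g\<in>E. f \<otimes> g)"
    using E(1,2) f by (intro finsum_rdistr) auto
  also have "\<dots> = (\<Oplus>g\<in>E. if f = g then g else \<zero>)"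
    using E f by (intro finsum_cong') auto
  also have "\<dots> = f" using E(1,2) f by (subst finsum_singleton) auto
  finally show "f \<otimes> (\<Oplus>g\<in>E. g) = f" .
  have "(\<Oplus>g\<in>E. g) \<otimes> f = (\<Oplus>g\<in>E. g \<otimes> f)"
    using E(1,2) f by (intro finsum_ldistr) auto
  also have "\<dots> = (\<Oplus>g\<in>E. if f = g then g else \<zero>)"
    using E f by (intro finsum_cong') auto
  also have "\<dots> = f" using E(1,2) f by (subst finsum_singleton) auto
  finally show "(\<Oplus>g\<in>E. g) \<otimes> f = f" .
qed

lemma simple_left_ideal_eq_principal:
  assumes "simple_left_ideal M R" "x \<in> M" "x \<noteq> \<zero>"
  shows "left_principal R x = M"
proof -
  have M: "left_ideal M R" "\<And>J. left_ideal J R \<Longrightarrow> J \<subseteq> M \<Longrightarrow> J = {\<zero>} \<or> J = M"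
    using assms by (auto simp: simple_left_ideal_def)
  have x: "x \<in> carrier R" using M(1) assms(2) left_ideal_subset by blast
  show ?thesis
    using M(2)[OF left_ideal_principal[OF x] principal_minimal[OF M(1) assms(2)]]
      principal_self[OF x] assms(3) by auto
qed

text \<open>Orthogonal idempotents with simple left ideals are collected until the left ideal of the
  remainder \<open>e\<close>, the unit minus their sum, is minimal among all such remainders. If
  \<open>e\<close> were nonzero, a simple left ideal inside that of \<open>e\<close> would supply
  one more idempotent and a smaller remainder.\<close>

lemma artinian_regular_idempotents:
  assumes art: "artinian R" and reg: "von_neumann_regular R"
  obtains E where "finite E" "E \<subseteq> carrier R" "\<And>f. f \<in> E \<Longrightarrow> f \<otimes> f = f"
    "\<And>f. f \<in> E \<Longrightarrow> simple_left_ideal (left_principal R f) R"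
    "\<And>f g. f \<in> E \<Longrightarrow> g \<in> E \<Longrightarrow> f \<noteq> g \<Longrightarrow> f \<otimes> g = \<zero>" "(\<Oplus>f\<in>E. f) = \<one>"
proof -
  define good where "good E \<longleftrightarrow> finite E \<and> E \<subseteq> carrier R \<and> (\<forall>f\<in>E. f \<otimes> f = f) \<and>
    (\<forall>f\<in>E. simple_left_ideal (left_principal R f) R) \<and> (\<forall>f\<in>E. \<forall>g\<in>E. f \<noteq> g \<longrightarrow> f \<otimes> g = \<zero>)" for E
  define S where "S = {left_principal R (\<one> \<ominus> (\<Oplus>f\<in>E. f)) | E. good E}"
  have sumc: "(\<Oplus>f\<in>E. f) \<in> carrier R" if "good E" for E
    using that by (auto simp: good_def intro!: finsum_closed)
  have "left_principal R (\<one> \<ominus> (\<Oplus>f\<in>{}. f)) \<in> S"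
    unfolding S_def by (rule CollectI, rule exI[of _ "{}"]) (auto simp: good_def)
  moreover have "left_ideal I R" if "I \<in> S" for I
    using that sumc by (auto simp: S_def intro!: left_ideal_principal)
  ultimately obtain I where I: "I \<in> S" "\<And>J. J \<in> S \<Longrightarrow> J \<subseteq> I \<Longrightarrow> J = I"
    using artinian_minimal[OF art] by blast
  then obtain E where E: "good E" "I = left_principal R (\<one> \<ominus> (\<Oplus>f\<in>E. f))" by (auto simp: S_def)
  define s where "s = (\<Oplus>f\<in>E. f)"
  define e where "e = \<one> \<ominus> s"
  have Ef: "finite E" "E \<subseteq> carrier R" "\<And>f. f \<in> E \<Longrightarrow> f \<otimes> f = f"
    "\<And>f g. f \<in> E \<Longrightarrow> g \<in> E \<Longrightarrow> f \<noteq> g \<Longrightarrow> f \<otimes> g = \<zero>"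
    "\<And>f. f \<in> E \<Longrightarrow> simple_left_ideal (left_principal R f) R"
    using E(1) by (auto simp: good_def)
  have sc: "s \<in> carrier R" using sumc[OF E(1)] by (simp add: s_def)
  have ec: "e \<in> carrier R" using sc by (simp add: e_def)
  have fs: "f \<otimes> s = f" "s \<otimes> f = f" if "f \<in> E" for f
    using orthogonal_sum[OF Ef(1-4) that] by (auto simp: s_def)
  have fe: "f \<otimes> e = \<zero>" "e \<otimes> f = \<zero>" if "f \<in> E" for f
  proof -
    have f: "f \<in> carrier R" using that Ef(2) by auto
    show "f \<otimes> e = \<zero>" "e \<otimes> f = \<zero>"
      using f sc fs[OF that]
      by (simp_all add: e_def minus_eq r_distr l_distr r_minus l_minus r_neg)
  qed
  have "s \<otimes> s = (\<Oplus>f\<in>E. s \<otimes> f)" unfolding s_def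
    by (rule finsum_rdistr) (use Ef sc in \<open>auto simp: s_def\<close>)
  also have "\<dots> = s" unfolding s_def
    by (rule finsum_cong') (use Ef fs in \<open>auto simp: s_def\<close>)
  finally have ss: "s \<otimes> s = s" .
  have ee: "e \<otimes> e = e"
    using sc ss by (simp add: e_def minus_eq r_distr l_distr r_minus l_minus r_neg)
  have "e = \<zero>"
  proof (rule ccontr)
    assume e0: "e \<noteq> \<zero>"
    then have "left_principal R e \<noteq> {\<zero>}" using principal_self[OF ec] by auto
    then obtain M where M: "simple_left_ideal M R" "M \<subseteq> left_principal R e"
      using exists_simple_left_ideal[OF art left_ideal_principal[OF ec]] by blast
    have Ml: "left_ideal M R" using M(1) by (simp add: simple_left_ideal_def)
    then obtain x where x: "x \<in> M" "x \<noteq> \<zero>"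
      using M(1) left_ideal_zero[OF Ml] by (auto simp: simple_left_ideal_def)
    have xc: "x \<in> carrier R" using x left_ideal_subset[OF Ml] by auto
    \<comment> \<open>Regularity turns a nonzero element of the simple ideal into a nonzero
      idempotent: \<open>h = y \<otimes> x\<close> satisfies
      \<open>x \<otimes> h = x\<close>.\<close>
    obtain y where y: "y \<in> carrier R" "x \<otimes> y \<otimes> x = x"
      using reg xc by (auto simp: von_neumann_regular_def)
    define h where "h = y \<otimes> x"
    have hM: "h \<in> M" using left_ideal_mult[OF Ml y(1) x(1)] by (simp add: h_def)
    have hc: "h \<in> carrier R" using y xc by (simp add: h_def)
    have xh: "x \<otimes> h = x" using y xc by (simp add: h_def m_assoc)
    have hh: "h \<otimes> h = h" using xh y xc by (simp add: h_def m_assoc)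
    have h0: "h \<noteq> \<zero>" using xh x xc by auto
    obtain b where b: "h = b \<otimes> e" "b \<in> carrier R" using hM M(2) by (auto simp: left_principal_def)
    have he: "h \<otimes> e = h" using b ec ee by (simp add: m_assoc)
    \<comment> \<open>\<open>h \<otimes> e = h\<close> holds because \<open>h\<close> lies in the
      left ideal of \<open>e\<close>, but \<open>e \<otimes> h = h\<close> may fail. Multiplying by
      \<open>e\<close> on the left repairs this, and \<open>f\<close> becomes orthogonal to
      \<open>E\<close> from both sides.\<close>
    define f where "f = e \<otimes> h"
    have fc: "f \<in> carrier R" using ec hc by (simp add: f_def)
    have ff: "f \<otimes> f = f"
    proof -
      have "f \<otimes> f = e \<otimes> (h \<otimes> e) \<otimes> h" using ec hc by (simp add: f_def m_assoc)
      then show ?thesis using he hh ec hc by (simp add: f_def m_assoc)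
    qed
    have ef: "e \<otimes> f = f" using ec hc ee by (simp add: f_def m_assoc[symmetric])
    have fe': "f \<otimes> e = f" using ec hc he by (simp add: f_def m_assoc)
    have "h \<otimes> f = h" using ec hc he hh by (simp add: f_def m_assoc[symmetric])
    then have f0: "f \<noteq> \<zero>" using h0 hc by auto
    have fM: "f \<in> M" using left_ideal_mult[OF Ml ec hM] by (simp add: f_def)
    have gf: "g \<otimes> f = \<zero>" "f \<otimes> g = \<zero>" if "g \<in> E" for g
    proof -
      have g: "g \<in> carrier R" using that Ef(2) by auto
      have "g \<otimes> f = (g \<otimes> e) \<otimes> f" using g ec fc ef by (simp add: m_assoc)
      then show "g \<otimes> f = \<zero>" using fe(1)[OF that] fc by simp
      have "f \<otimes> g = f \<otimes> (e \<otimes> g)" using g ec fc fe' by (simp add: m_assoc[symmetric])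
      then show "f \<otimes> g = \<zero>" using fe(2)[OF that] fc by simp
    qed
    have fE: "f \<notin> E" using gf(1)[of f] ff f0 by auto
    have "good (insert f E)"
      using Ef ff fc gf simple_left_ideal_eq_principal[OF M(1) fM f0] M(1) by (auto simp: good_def)
    then have "left_principal R (\<one> \<ominus> (\<Oplus>g\<in>insert f E. g)) \<in> S" by (auto simp: S_def)
    moreover have res: "\<one> \<ominus> (\<Oplus>g\<in>insert f E. g) = e \<ominus> f"
    proof -
      have "(\<Oplus>g\<in>insert f E. g) = f \<oplus> s" unfolding s_def
        using Ef(1,2) fE fc by (intro finsum_insert) auto
      then show ?thesis using fc sc by (simp add: e_def minus_eq minus_add a_ac)
    qed
    moreover have "left_principal R (e \<ominus> f) \<subseteq> I"
    proof (rule principal_minimal)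
      show "left_ideal I R" using E(2) ec left_ideal_principal by (simp add: e_def s_def)
      have "e \<ominus> f = (e \<ominus> f) \<otimes> e" using ec fc ee fe' by (simp add: minus_eq l_distr l_minus)
      then show "e \<ominus> f \<in> I" using ec fc E(2) by (auto simp: left_principal_def e_def s_def)
    qed
    ultimately have "left_principal R (e \<ominus> f) = I" using I(2) by simp
    then have "e \<in> left_principal R (e \<ominus> f)" using principal_self[OF ec] E(2) by (simp add: e_def s_def)
    then obtain b where b: "b \<in> carrier R" "e = b \<otimes> (e \<ominus> f)" by (auto simp: left_principal_def)
    \<comment> \<open>By minimality \<open>e\<close> is a left multiple of
      \<open>e \<ominus> f\<close>, whose product with \<open>f\<close> on the right is zero; so
      \<open>f = e \<otimes> f\<close> vanishes.\<close>
    have "e \<otimes> f = b \<otimes> (e \<ominus> f) \<otimes> f" by (rule arg_cong[OF b(2), where f = "\<lambda>z. z \<otimes> f"])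
    then have "f = b \<otimes> (e \<ominus> f) \<otimes> f" using ef by simp
    also have "\<dots> = b \<otimes> ((e \<ominus> f) \<otimes> f)" by (rule m_assoc) (use b(1) ec fc in auto)
    also have "(e \<ominus> f) \<otimes> f = \<zero>" using ec fc ef ff by (simp add: minus_eq l_distr l_minus r_neg)
    finally show False using f0 b by simp
  qed
  then have "s = \<one>" using sc unfolding e_def by (metis minus_eq minus_equality minus_minus one_closed a_inv_closed)
  then show ?thesis using that[OF Ef(1,2,3,5,4)] by (simp add: s_def)
qed

lemma left_principal_idempotent:
  assumes "f \<in> carrier R" "f \<otimes> f = f" "x \<in> left_principal R f"
  shows "x \<otimes> f = x"
  using assms by (auto simp: left_principal_def m_assoc)

text \<open>The left ideals of the orthogonal idempotents form the decomposition: the component of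
  \<open>x\<close> at \<open>f\<close> is \<open>x \<otimes> f\<close>, and multiplying a vanishing
  sum by \<open>f\<close> on the right isolates the term at \<open>f\<close>.\<close>

lemma semisimple_of_artinian_regular:
  assumes "artinian R" "von_neumann_regular R"
  shows "semisimple R"
proof -
  obtain E where E: "finite E" "E \<subseteq> carrier R" "\<And>f. f \<in> E \<Longrightarrow> f \<otimes> f = f"
    "\<And>f. f \<in> E \<Longrightarrow> simple_left_ideal (left_principal R f) R"
    "\<And>f g. f \<in> E \<Longrightarrow> g \<in> E \<Longrightarrow> f \<noteq> g \<Longrightarrow> f \<otimes> g = \<zero>" "(\<Oplus>f\<in>E. f) = \<one>"
    by (rule artinian_regular_idempotents[OF assms]) (rule that)
  define P where "P = left_principal R"
  have xf: "x \<otimes> f = x" if "f \<in> E" "x \<in> P f" for x f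
    by (rule left_principal_idempotent[OF subsetD[OF E(2) that(1)] E(3)[OF that(1)]])
      (use that(2) in \<open>simp add: P_def\<close>)
  have inP: "f \<in> P f" if "f \<in> E" for f using that E(2) principal_self by (auto simp: P_def)
  have xg: "x \<otimes> g = \<zero>" if "f \<in> E" "g \<in> E" "f \<noteq> g" and x: "x \<in> P f" for x f g
  proof -
    obtain b where "b \<in> carrier R" "x = b \<otimes> f" using x by (auto simp: P_def left_principal_def)
    then show ?thesis using E(5)[OF that(1-3)] subsetD[OF E(2) that(1)] subsetD[OF E(2) that(2)]
      by (simp add: m_assoc)
  qed
  \<comment> \<open>\<open>internal_direct_sum\<close> ranges over a set of ideals, not over a
    family, so distinct idempotents must give distinct ideals.\<close>
  have inj: "inj_on P E"
  proof (rule inj_onI, rule ccontr)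
    fix f g assume fg: "f \<in> E" "g \<in> E" "P f = P g" "f \<noteq> g"
    then have "f = f \<otimes> g" using xf inP by metis
    then have "f = \<zero>" using E(5) fg by simp
    then have "left_principal R f = {\<zero>}" by (auto simp: left_principal_def intro!: exI[of _ \<zero>])
    then show False using E(4)[OF fg(1)] by (simp add: simple_left_ideal_def)
  qed
  have "internal_direct_sum R (P ` E)"
    unfolding internal_direct_sum_def
  proof (intro conjI ballI allI impI)
    fix x assume x: "x \<in> carrier R"
    define c where "c M = x \<otimes> inv_into E P M" for M
    have "(\<Oplus>M\<in>P ` E. c M) = (\<Oplus>f\<in>E. c (P f))"
      using x E(2) inj by (intro finsum_reindex) (auto simp: c_def)
    also have "\<dots> = (\<Oplus>f\<in>E. x \<otimes> f)"
      using x E(2) inj by (intro finsum_cong') (auto simp: c_def)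
    also have "\<dots> = x \<otimes> (\<Oplus>f\<in>E. f)"
      using x E(1,2) by (intro finsum_rdistr[symmetric]) auto
    also have "\<dots> = x" using x E(6) by simp
    finally have "x = (\<Oplus>M\<in>P ` E. c M)" by simp
    moreover have "\<forall>M\<in>P ` E. c M \<in> M"
    proof
      fix M assume "M \<in> P ` E"
      then obtain f where "f \<in> E" "M = P f" by auto
      then show "c M \<in> M" using inj x by (auto simp: c_def) (auto simp: P_def left_principal_def)
    qed
    ultimately show "\<exists>F c. finite F \<and> F \<subseteq> P ` E \<and> (\<forall>M\<in>F. c M \<in> M) \<and> x = (\<Oplus>M\<in>F. c M)"
      using E(1) by blast
  next
    fix F c M
    assume *: "finite F \<and> F \<subseteq> P ` E \<and> (\<forall>M\<in>F. c M \<in> M) \<and> (\<Oplus>M\<in>F. c M) = \<zero>" and M: "M \<in> F"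
    then obtain f where f: "f \<in> E" "M = P f" by auto
    have fc: "f \<in> carrier R" using f E(2) by auto
    have cc: "c \<in> F \<rightarrow> carrier R"
    proof
      fix N assume "N \<in> F"
      then obtain g where "g \<in> E" "N = P g" "c N \<in> P g" using * by auto
      then show "c N \<in> carrier R"
        using left_ideal_subset[OF left_ideal_principal[OF subsetD[OF E(2)]], of g] by (auto simp: P_def)
    qed
    have "\<zero> = (\<Oplus>N\<in>F. c N) \<otimes> f" using * fc by simp
    also have "\<dots> = (\<Oplus>N\<in>F. c N \<otimes> f)" using * fc cc by (intro finsum_ldistr) auto
    also have "\<dots> = (\<Oplus>N\<in>F. if M = N then c N else \<zero>)"
    proof (rule finsum_cong')
      show "(\<lambda>N. if M = N then c N else \<zero>) \<in> F \<rightarrow> carrier R" using cc by auto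
      fix N assume N: "N \<in> F"
      then obtain g where g: "g \<in> E" "N = P g" using * by auto
      show "c N \<otimes> f = (if M = N then c N else \<zero>)"
        using * N f g xf[of f "c N"] xg[of g f "c N"] inj by (auto dest: inj_onD)
    qed simp
    also have "\<dots> = c M" using * M cc by (intro finsum_singleton) auto
    finally show "c M = \<zero>" by simp
  qed
  moreover have "\<forall>M\<in>P ` E. simple_left_ideal M R" using E(4) by (auto simp: P_def)
  moreover have "\<exists>e\<in>carrier R. \<forall>x\<in>carrier R. e \<otimes> x = x \<and> x \<otimes> e = x" by (rule bexI[of _ \<one>]) auto
  ultimately show ?thesis unfolding semisimple_def by blast
qed

section \<open>Idempotents, nil left ideals and annihilators in Artinian rings\<close>

lemma artinian_power_stabilizes:
  assumes art: "artinian R" and x: "x \<in> carrier R"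
  obtains N :: nat where "\<And>n. n \<ge> N \<Longrightarrow> \<exists>c\<in>carrier R. x [^] n = c \<otimes> x [^] (n + n)"
proof -
  define I where "I n = left_principal R (x [^] n)" for n :: nat
  have sub: "left_principal R (x [^] (n + k)) \<subseteq> left_principal R (x [^] n)" for n k :: nat
    using x by (intro principal_minimal left_ideal_principal)
      (auto simp: left_principal_def nat_pow_mult[symmetric] add.commute[of n k] intro!: exI[of _ "x [^] k"])
  have "\<forall>n. left_ideal (I n) R \<and> I (Suc n) \<subseteq> I n"
    using sub[of _ 1] x by (auto simp: I_def intro!: left_ideal_principal)
  then obtain N where N: "\<And>n. n \<ge> N \<Longrightarrow> I n = I N" using art unfolding artinian_def by blast
  have *: "\<exists>c\<in>carrier R. x [^] n = c \<otimes> x [^] (n + n)" if "n \<ge> N" for n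
    using N[of n] N[of "n + n"] that principal_self[of "x [^] n"] x by (auto simp: I_def left_principal_def)
  show ?thesis by (rule that) (use * in blast)
qed

text \<open>An involution turns the descending chain condition on left ideals into the one on right ideals,
  so that every element is strongly \<open>\<pi>\<close>-regular.\<close>

lemma artinian_idempotent_in_left_ideal:
  assumes art: "artinian R"
    and star: "\<And>x. x \<in> carrier R \<Longrightarrow> \<sigma> x \<in> carrier R" "\<And>x. x \<in> carrier R \<Longrightarrow> \<sigma> (\<sigma> x) = x"
      "\<And>x y. x \<in> carrier R \<Longrightarrow> y \<in> carrier R \<Longrightarrow> \<sigma> (x \<otimes> y) = \<sigma> y \<otimes> \<sigma> x"
    and L: "left_ideal L R" and x: "x \<in> L" and nonnil: "\<And>n::nat. x [^] n \<noteq> \<zero>"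
  obtains f where "f \<in> L" "f \<otimes> f = f" "f \<noteq> \<zero>"
proof -
  have xc: "x \<in> carrier R" using x left_ideal_subset[OF L] by auto
  \<comment> \<open>Obtained by applying \<open>\<sigma>\<close> to the product of
    \<open>\<sigma> \<one>\<close> and \<open>\<one>\<close>.\<close>
  have one: "\<sigma> \<one> = \<one>" using star(3)[of "\<sigma> \<one>" \<one>] star(1,2)[of \<one>] by simp
  have pow: "\<sigma> (y [^] n) = \<sigma> y [^] n" if "y \<in> carrier R" for y and n :: nat
  proof (induction n)
    case (Suc n)
    then have "\<sigma> (y [^] Suc n) = \<sigma> y \<otimes> \<sigma> y [^] n" using that by (simp add: star)
    then show ?case using nat_pow_Suc2[OF star(1)[OF that]] by simp
  qed (simp add: one)
  obtain N1 :: nat where N1: "\<And>n. n \<ge> N1 \<Longrightarrow> \<exists>c\<in>carrier R. x [^] n = c \<otimes> x [^] (n + n)"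
    using artinian_power_stabilizes[OF art xc] by blast
  obtain N2 :: nat where N2: "\<And>n. n \<ge> N2 \<Longrightarrow> \<exists>c\<in>carrier R. \<sigma> x [^] n = c \<otimes> \<sigma> x [^] (n + n)"
    using artinian_power_stabilizes[OF art star(1)[OF xc]] by blast
  \<comment> \<open>The successor makes the exponent positive, so that \<open>y\<close> is a left
    multiple of \<open>x\<close> and stays in \<open>L\<close>. As \<open>N\<close> exceeds both
    bounds, \<open>y\<close> is a left multiple of its square and, through the involution, a right
    multiple as well.\<close>
  define N where "N = Suc (max N1 N2)"
  define y where "y = x [^] N"
  have yc: "y \<in> carrier R" using xc by (simp add: y_def)
  have yL: "y \<in> L" using left_ideal_mult[OF L _ x, of "x [^] max N1 N2"] xc by (simp add: y_def N_def)
  have y0: "y \<noteq> \<zero>" using nonnil by (simp add: y_def)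
  obtain c where c: "c \<in> carrier R" "y = c \<otimes> (y \<otimes> y)"
  proof -
    have "N \<ge> N1" by (simp add: N_def)
    then show ?thesis using that N1[of N] xc by (auto simp: y_def nat_pow_mult)
  qed
  obtain d where d: "d \<in> carrier R" "\<sigma> x [^] N = d \<otimes> (\<sigma> x [^] (N + N))"
  proof -
    have "N \<ge> N2" by (simp add: N_def)
    then show ?thesis using that N2[of N] by auto
  qed
  have "\<sigma> y = d \<otimes> \<sigma> (y \<otimes> y)"
    using d(2) xc by (simp add: y_def nat_pow_mult pow)
  then have "\<sigma> (\<sigma> y) = \<sigma> (d \<otimes> \<sigma> (y \<otimes> y))" by (rule arg_cong)
  also have "\<dots> = \<sigma> (\<sigma> (y \<otimes> y)) \<otimes> \<sigma> d" using star(1) yc d(1) by (intro star(3)) auto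
  finally have d': "y = y \<otimes> y \<otimes> \<sigma> d" "\<sigma> d \<in> carrier R"
    using star(1)[OF d(1)] star(2)[OF yc] star(2)[of "y \<otimes> y"] yc by auto
  \<comment> \<open>The two expressions of \<open>y\<close> through its square show that
    \<open>f\<close> equals both \<open>c \<otimes> y\<close> and
    \<open>y \<otimes> \<sigma> d\<close>. The first form lies in \<open>L\<close>; together with
    \<open>f \<otimes> y = y\<close> the second one makes \<open>f\<close> idempotent.\<close>
  define f where "f = c \<otimes> y"
  have fc: "f \<in> carrier R" using c yc by (simp add: f_def)
  have fy: "f \<otimes> y = y" using c yc by (simp add: f_def m_assoc)
  have "f = c \<otimes> (y \<otimes> y \<otimes> \<sigma> d)" using d' by (simp add: f_def)
  also have "\<dots> = c \<otimes> (y \<otimes> y) \<otimes> \<sigma> d" using c(1) d'(2) yc by (simp add: m_assoc)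
  finally have fd: "f = y \<otimes> \<sigma> d" using c(2) by simp
  have "f \<otimes> f = (f \<otimes> y) \<otimes> \<sigma> d" using fd fc yc d'(2) by (metis m_assoc)
  then have "f \<otimes> f = f" using fy fd by simp
  moreover have "f \<noteq> \<zero>" using fy y0 yc by auto
  moreover have "f \<in> L" using left_ideal_mult[OF L c(1) yL] by (simp add: f_def)
  ultimately show ?thesis using that by blast
qed

text \<open>If \<open>x \<otimes> m\<close> were nonzero it would generate \<open>M\<close>, so
  \<open>m\<close> would be fixed by left multiplication with an element
  \<open>a \<otimes> x\<close> of \<open>L\<close>. All powers of that element fix \<open>m\<close>
  too, and one of them is zero.\<close>

lemma nil_left_ideal_annihilates_simple:
  assumes L: "left_ideal L R" and nil: "\<And>x. x \<in> L \<Longrightarrow> \<exists>n::nat. x [^] n = \<zero>"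
    and M: "simple_left_ideal M R" and x: "x \<in> L" and m: "m \<in> M"
  shows "x \<otimes> m = \<zero>"
proof (rule ccontr)
  assume "x \<otimes> m \<noteq> \<zero>"
  have Ml: "left_ideal M R" using M by (simp add: simple_left_ideal_def)
  have xc: "x \<in> carrier R" and mc: "m \<in> carrier R"
    using x m left_ideal_subset[OF L] left_ideal_subset[OF Ml] by auto
  have "x \<otimes> m \<in> M" using left_ideal_mult[OF Ml xc m] .
  then have "m \<in> left_principal R (x \<otimes> m)"
    using simple_left_ideal_eq_principal[OF M _ \<open>x \<otimes> m \<noteq> \<zero>\<close>] m by simp
  then obtain a where a: "a \<in> carrier R" "m = a \<otimes> (x \<otimes> m)" by (auto simp: left_principal_def)
  define z where "z = a \<otimes> x"
  have zc: "z \<in> carrier R" and zm: "z \<otimes> m = m" using a xc mc by (auto simp: z_def m_assoc)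
  have pow: "z [^] n \<otimes> m = m" for n :: nat
    using zc zm mc by (induction n) (auto simp: m_assoc)
  have "z \<in> L" using left_ideal_mult[OF L a(1) x] by (simp add: z_def)
  then obtain n :: nat where "z [^] n = \<zero>" using nil by blast
  then have "m = \<zero>" using pow[of n] mc by simp
  then show False using \<open>x \<otimes> m \<noteq> \<zero>\<close> xc by simp
qed

text \<open>Choose an idempotent \<open>e \<notin> P\<close> with \<open>Re\<close> minimal. Then the left ideal \<open>Re \<inter> P\<close> contains no
  nonzero idempotent, so it is nil and annihilates every minimal left ideal \<open>M \<subseteq> Re\<close>. The trace
  form is symmetric and nondegenerate, so \<open>em \<noteq> 0\<close> for some \<open>m \<in> M\<close>, and \<open>P\<close> annihilates \<open>em\<close>.\<close>

lemma artinian_annihilator_nonzero: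
  assumes art: "artinian R"
    and star: "\<And>x. x \<in> carrier R \<Longrightarrow> \<sigma> x \<in> carrier R" "\<And>x. x \<in> carrier R \<Longrightarrow> \<sigma> (\<sigma> x) = x"
      "\<And>x y. x \<in> carrier R \<Longrightarrow> y \<in> carrier R \<Longrightarrow> \<sigma> (x \<otimes> y) = \<sigma> y \<otimes> \<sigma> x"
    and P: "left_ideal P R" "\<And>x a. x \<in> P \<Longrightarrow> a \<in> carrier R \<Longrightarrow> x \<otimes> a \<in> P" "\<one> \<notin> P"
    and trace: "\<And>x y. x \<in> carrier R \<Longrightarrow> y \<in> carrier R \<Longrightarrow> tr (x \<otimes> y) = tr (y \<otimes> x)"
    and nondeg: "\<And>M. left_ideal M R \<Longrightarrow> M \<noteq> {\<zero>} \<Longrightarrow> \<exists>m\<in>M. tr m \<noteq> tr \<zero>"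
  obtains w where "w \<in> carrier R" "w \<noteq> \<zero>" "\<And>x. x \<in> P \<Longrightarrow> x \<otimes> w = \<zero>"
proof -
  note PR = left_ideal_subset[OF P(1)]
  define S where "S = {left_principal R e | e. e \<in> carrier R \<and> e \<otimes> e = e \<and> e \<notin> P}"
  have "left_principal R \<one> \<in> S"
    unfolding S_def using P(3) by (intro CollectI exI[of _ \<one>] conjI refl) simp_all
  moreover have "left_ideal I R" if "I \<in> S" for I
    using that left_ideal_principal by (auto simp: S_def)
  ultimately obtain I where I: "I \<in> S" "\<And>J. J \<in> S \<Longrightarrow> J \<subseteq> I \<Longrightarrow> J = I"
    using artinian_minimal[OF art] by blast
  then obtain e where e: "I = left_principal R e" "e \<in> carrier R" "e \<otimes> e = e" "e \<notin> P"
    by (auto simp: S_def)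
  note ec = e(2)
  note Re = left_ideal_principal[OF ec]
  define L where "L = left_principal R e \<inter> P"
  have L: "left_ideal L R" unfolding L_def by (rule left_ideal_Int[OF Re P(1)])
  have nil: "\<exists>n::nat. x [^] n = \<zero>" if x: "x \<in> L" for x
  proof (rule ccontr)
    assume "\<nexists>n::nat. x [^] n = \<zero>"
    then have nn: "\<And>n::nat. x [^] n \<noteq> \<zero>" by blast
    obtain f where f: "f \<in> L" "f \<otimes> f = f" "f \<noteq> \<zero>"
      using artinian_idempotent_in_left_ideal[OF art star L x nn] by blast
    have fc: "f \<in> carrier R" and fP: "f \<in> P" and fe: "f \<otimes> e = f"
      using f(1) PR left_principal_idempotent[OF ec e(3)] by (auto simp: L_def)
    \<comment> \<open>A nonzero idempotent \<open>f\<close> in \<open>L\<close> would allow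
      \<open>e\<close> to be reduced. \<open>q\<close> is a form of it on which \<open>e\<close>
      acts as identity from both sides, and \<open>e' = e \<ominus> q\<close> is again an idempotent
      outside \<open>P\<close>, because \<open>q\<close> lies in \<open>P\<close> and
      \<open>e\<close> does not.\<close>
    define q where "q = e \<otimes> f"
    define e' where "e' = e \<ominus> q"
    have qc: "q \<in> carrier R" and e'c: "e' \<in> carrier R" using ec fc by (simp_all add: q_def e'_def)
    have qP: "q \<in> P" unfolding q_def by (rule left_ideal_mult[OF P(1) ec fP])
    have eq: "e \<otimes> q = q" using e fc by (simp add: q_def m_assoc[symmetric])
    have qe: "q \<otimes> e = q" using ec fc fe by (simp add: q_def m_assoc)
    have fq: "f \<otimes> q = f" using ec fc fe f(2) by (simp add: q_def m_assoc[symmetric])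
    have "q \<otimes> q = e \<otimes> (f \<otimes> q)" unfolding q_def by (rule m_assoc) (use ec fc in simp_all)
    then have qq: "q \<otimes> q = q" unfolding fq by (simp only: q_def)
    have q0: "q \<noteq> \<zero>" using fq f(3) fc by auto
    have e'q: "e' \<otimes> q = \<zero>" using ec qc eq qq by (simp add: e'_def minus_eq l_distr l_minus r_neg)
    have e'e: "e' \<otimes> e = e'" using ec qc qe e(3) by (simp add: e'_def minus_eq l_distr l_minus)
    have "e' \<otimes> e' = e' \<otimes> e \<ominus> e' \<otimes> q"
      using e'c ec qc by (subst (2) e'_def) (simp add: minus_eq r_distr r_minus)
    then have e'e': "e' \<otimes> e' = e'" using e'c by (simp add: e'q e'e minus_eq)
    have "e = e' \<oplus> q" using ec qc by (simp add: e'_def minus_eq a_assoc l_neg)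
    then have "e' \<notin> P" using e(4) left_ideal_add[OF P(1) _ qP] by auto
    then have "left_principal R e' \<in> S" unfolding S_def using e'c e'e' by auto
    moreover have "e' \<in> left_principal R e"
      unfolding left_principal_def using e'e e'c by (auto intro!: exI[of _ e'])
    then have "left_principal R e' \<subseteq> I" unfolding e(1) by (rule principal_minimal[OF Re])
    ultimately have "left_principal R e' = left_principal R e" using I(2) e(1) by simp
    moreover have "q \<in> left_principal R e"
      unfolding left_principal_def using qe qc by (auto intro!: exI[of _ q])
    \<comment> \<open>Minimality makes \<open>q\<close> a left multiple of \<open>e'\<close>. Since
      \<open>e' \<otimes> q = \<zero>\<close>, the idempotent \<open>q = q \<otimes> q\<close> would
      be zero.\<close>
    ultimately obtain z where z: "z \<in> carrier R" "q = z \<otimes> e'" by (auto simp: left_principal_def)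
    have "q \<otimes> q = z \<otimes> e' \<otimes> q" by (rule arg_cong[OF z(2), of "\<lambda>y. y \<otimes> q"])
    also have "\<dots> = z \<otimes> (e' \<otimes> q)" by (rule m_assoc[OF z(1) e'c qc])
    finally show False using q0 z(1) by (simp add: e'q qq)
  qed
  have "e \<noteq> \<zero>" using e(4) left_ideal_zero[OF P(1)] by auto
  then have "left_principal R e \<noteq> {\<zero>}" using principal_self[OF ec] by auto
  then obtain M where M: "simple_left_ideal M R" "M \<subseteq> left_principal R e"
    using exists_simple_left_ideal[OF art Re] by blast
  have Ml: "left_ideal M R" "M \<noteq> {\<zero>}" using M(1) by (simp_all add: simple_left_ideal_def)
  obtain m where m: "m \<in> M" "tr m \<noteq> tr \<zero>" using nondeg[OF Ml] by blast
  have mc: "m \<in> carrier R" using m(1) left_ideal_subset[OF Ml(1)] by auto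
  have "m \<otimes> e = m" using left_principal_idempotent[OF ec e(3)] m(1) M(2) by blast
  \<comment> \<open>The trace of \<open>e \<otimes> m\<close> equals that of
    \<open>m \<otimes> e = m\<close>, which differs from the trace of zero.\<close>
  then have em: "e \<otimes> m \<noteq> \<zero>" using trace[OF ec mc] m(2) by auto
  have "x \<otimes> (e \<otimes> m) = \<zero>" if x: "x \<in> P" for x
  proof -
    have xc: "x \<in> carrier R" using x PR by auto
    have "x \<otimes> e \<in> L" using P(2)[OF x ec] xc by (auto simp: L_def left_principal_def)
    then have "x \<otimes> e \<otimes> m = \<zero>"
      by (intro nil_left_ideal_annihilates_simple[OF L _ M(1) _ m(1)] nil)
    then show ?thesis using xc ec mc by (simp add: m_assoc)
  qed
  then show ?thesis by (intro that[of "e \<otimes> m"] em m_closed ec mc)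
qed

end

section \<open>Finitely supported functions on a groupoid\<close>

context groupoid
begin

abbreviation Arr where "Arr \<equiv> topspace (arrows G)"
abbreviation Obj where "Obj \<equiv> topspace (objects G)"
abbreviation src where "src \<equiv> dmap G"
abbreviation tgt where "tgt \<equiv> rmap G"
abbreviation unt where "unt \<equiv> gunit G"
abbreviation ivt where "ivt \<equiv> ginv G"
abbreviation gcomp (infixl \<open>\<diamondop>\<close> 75) where "g \<diamondop> h \<equiv> gmult G g h"

lemma comp_closed [simp]:
  assumes "g \<in> Arr" "h \<in> Arr" "src g = tgt h"
  shows "g \<diamondop> h \<in> Arr" "src (g \<diamondop> h) = src h" "tgt (g \<diamondop> h) = tgt g"
  using assms mult_closed[of g h] mult_dmap[of g h] mult_rmap[of g h] by (auto simp: composable_def)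

lemma comp_assoc:
  assumes "g \<in> Arr" "h \<in> Arr" "k \<in> Arr" "src g = tgt h" "src h = tgt k"
  shows "g \<diamondop> h \<diamondop> k = g \<diamondop> (h \<diamondop> k)"
  using assms mult_assoc[of g h k] by (auto simp: composable_def)

declare dmap_closed [simp] rmap_closed [simp] unit_closed [simp] unit_dmap [simp] unit_rmap [simp]
  inv_closed [simp] inv_dmap [simp] inv_rmap [simp] inv_left [simp] inv_right [simp]
  unit_left [simp] unit_right [simp]

lemma unit_left' [simp]: "g \<in> Arr \<Longrightarrow> x = tgt g \<Longrightarrow> unt x \<diamondop> g = g" by simp
lemma unit_right' [simp]: "g \<in> Arr \<Longrightarrow> x = src g \<Longrightarrow> g \<diamondop> unt x = g" by simp

lemma cancel [simp]:
  assumes "g \<in> Arr" "h \<in> Arr"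
  shows "src g = tgt h \<Longrightarrow> ivt g \<diamondop> (g \<diamondop> h) = h"
    and "tgt g = tgt h \<Longrightarrow> g \<diamondop> (ivt g \<diamondop> h) = h"
    and "src g = tgt h \<Longrightarrow> g \<diamondop> h \<diamondop> ivt h = g"
    and "src g = src h \<Longrightarrow> g \<diamondop> ivt h \<diamondop> h = g"
proof -
  show "ivt g \<diamondop> (g \<diamondop> h) = h" if "src g = tgt h"
    using assms that comp_assoc[of "ivt g" g h] by simp
  show "g \<diamondop> (ivt g \<diamondop> h) = h" if "tgt g = tgt h"
    using assms that comp_assoc[of g "ivt g" h] by simp
  show "g \<diamondop> h \<diamondop> ivt h = g" if "src g = tgt h"
    using assms that comp_assoc[of g h "ivt h"] by (simp add: that[symmetric])
  show "g \<diamondop> ivt h \<diamondop> h = g" if "src g = src h"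
    using assms that comp_assoc[of g "ivt h" h] by (simp add: that[symmetric])
qed

lemma inv_unique:
  assumes "g \<in> Arr" "h \<in> Arr" "src g = tgt h" "g \<diamondop> h = unt (tgt g)"
  shows "h = ivt g"
proof -
  have "h = ivt g \<diamondop> (g \<diamondop> h)" using assms(1-3) by simp
  also have "\<dots> = ivt g" unfolding assms(4) using assms(1) by simp
  finally show ?thesis .
qed

lemma inv_inv [simp]: "g \<in> Arr \<Longrightarrow> ivt (ivt g) = g"
  by (rule inv_unique[symmetric]) auto

lemma inv_unit [simp]: "x \<in> Obj \<Longrightarrow> ivt (unt x) = unt x"
  by (rule inv_unique[symmetric]) auto

lemma inv_comp:
  assumes "g \<in> Arr" "h \<in> Arr" "src g = tgt h"
  shows "ivt (g \<diamondop> h) = ivt h \<diamondop> ivt g"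
proof (rule inv_unique[symmetric])
  have "g \<diamondop> h \<diamondop> (ivt h \<diamondop> ivt g) = g \<diamondop> (h \<diamondop> (ivt h \<diamondop> ivt g))" using assms by (subst comp_assoc) auto
  then show "g \<diamondop> h \<diamondop> (ivt h \<diamondop> ivt g) = unt (tgt (g \<diamondop> h))" using assms by simp
qed (use assms in auto)

lemma comp_eq_iff:
  assumes "g \<in> Arr" "h \<in> Arr" "a \<in> Arr" "src g = src h"
  shows "g \<diamondop> ivt h = a \<longleftrightarrow> tgt g = tgt a \<and> h = ivt a \<diamondop> g"
proof
  assume a: "g \<diamondop> ivt h = a"
  then have "ivt a = h \<diamondop> ivt g" "tgt g = tgt a" using inv_comp[of g "ivt h"] assms by auto
  then show "tgt g = tgt a \<and> h = ivt a \<diamondop> g" using assms by simp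
next
  assume "tgt g = tgt a \<and> h = ivt a \<diamondop> g"
  then show "g \<diamondop> ivt h = a" using assms by (simp add: inv_comp)
qed

end

text \<open>Serves both the finitely supported functions and the groupoid algebra, which are
  different sets of functions with the same pointwise addition. The second conclusion makes the
  additive inverse computable.\<close>

lemma (in abelian_group) function_abelian_group:
  fixes A :: "('x \<Rightarrow> 'a, 'z) ring_scheme"
  assumes zero: "\<zero>\<^bsub>A\<^esub> = (\<lambda>x\<in>X. \<zero>)" and add: "\<And>f g. f \<oplus>\<^bsub>A\<^esub> g = (\<lambda>x\<in>X. f x \<oplus> g x)"
    and sub: "carrier A \<subseteq> X \<rightarrow>\<^sub>E carrier G" and zc: "\<zero>\<^bsub>A\<^esub> \<in> carrier A"
    and ac: "\<And>f g. f \<in> carrier A \<Longrightarrow> g \<in> carrier A \<Longrightarrow> f \<oplus>\<^bsub>A\<^esub> g \<in> carrier A"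
    and nc: "\<And>f. f \<in> carrier A \<Longrightarrow> (\<lambda>x\<in>X. \<ominus> f x) \<in> carrier A"
  shows "abelian_group A" and "\<And>f. f \<in> carrier A \<Longrightarrow> \<ominus>\<^bsub>A\<^esub> f = (\<lambda>x\<in>X. \<ominus> f x)"
proof -
  have val: "f x \<in> carrier G" if "f \<in> carrier A" "x \<in> X" for f x using sub that by auto
  have ext: "f = g" if "f \<in> carrier A" "g \<in> carrier A" "\<And>x. x \<in> X \<Longrightarrow> f x = g x" for f g
    using sub that by (intro PiE_ext[of f X "\<lambda>_. carrier G"]) auto
  have neg: "(\<lambda>x\<in>X. \<ominus> f x) \<oplus>\<^bsub>A\<^esub> f = \<zero>\<^bsub>A\<^esub>" if "f \<in> carrier A" for f
  proof (rule ext)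
    show "(\<lambda>x\<in>X. \<ominus> f x) \<oplus>\<^bsub>A\<^esub> f \<in> carrier A" using that nc by (auto intro: ac)
  qed (use that zc in \<open>simp_all add: add zero val l_neg\<close>)
  show ab: "abelian_group A"
  proof (rule abelian_groupI)
    fix x y z assume xyz: "x \<in> carrier A" "y \<in> carrier A" "z \<in> carrier A"
    show "x \<oplus>\<^bsub>A\<^esub> y \<oplus>\<^bsub>A\<^esub> z = x \<oplus>\<^bsub>A\<^esub> (y \<oplus>\<^bsub>A\<^esub> z)"
    proof (rule ext)
      show "x \<oplus>\<^bsub>A\<^esub> y \<oplus>\<^bsub>A\<^esub> z \<in> carrier A" "x \<oplus>\<^bsub>A\<^esub> (y \<oplus>\<^bsub>A\<^esub> z) \<in> carrier A" using xyz by (auto intro: ac)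
    qed (use xyz in \<open>simp add: add val a_assoc\<close>)
  next
    fix x y assume xyz: "x \<in> carrier A" "y \<in> carrier A"
    show "x \<oplus>\<^bsub>A\<^esub> y = y \<oplus>\<^bsub>A\<^esub> x"
    proof (rule ext)
      show "x \<oplus>\<^bsub>A\<^esub> y \<in> carrier A" "y \<oplus>\<^bsub>A\<^esub> x \<in> carrier A" using xyz by (auto intro: ac)
    qed (use xyz in \<open>simp add: add val a_comm\<close>)
  next
    fix x assume x: "x \<in> carrier A"
    show "\<zero>\<^bsub>A\<^esub> \<oplus>\<^bsub>A\<^esub> x = x"
    proof (rule ext)
      show "\<zero>\<^bsub>A\<^esub> \<oplus>\<^bsub>A\<^esub> x \<in> carrier A" using x zc by (auto intro: ac)
    qed (use x in \<open>simp_all add: add zero val\<close>)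
    show "\<exists>y\<in>carrier A. y \<oplus>\<^bsub>A\<^esub> x = \<zero>\<^bsub>A\<^esub>" using neg[OF x] nc[OF x] by blast
  qed (use ac zc in auto)
  fix f assume f: "f \<in> carrier A"
  show "\<ominus>\<^bsub>A\<^esub> f = (\<lambda>x\<in>X. \<ominus> f x)"
    using abelian_group.minus_equality[OF ab neg[OF f] f nc[OF f]] .
qed

section \<open>Convolution of functions on the arrows\<close>

locale groupoid_coefficients = R?: cring R + groupoid G
  for R :: "('r, 'm) ring_scheme" (structure) and G :: "('o, 'a, 'z) groupoid_scheme"
begin

text \<open>The value of a convolution at \<open>g\<close> involves the right factor only on the
  fibre over \<open>src g\<close>. Finiteness on each fibre makes the sums finite, and it holds for
  characteristic functions of bisections, whose supports may be infinite.\<close>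

definition fiber_finite :: "('a \<Rightarrow> 'r) \<Rightarrow> bool" where
  "fiber_finite f \<longleftrightarrow> (\<forall>y. finite {h \<in> Arr. src h = y \<and> f h \<noteq> \<zero>})"

definition conv :: "('a \<Rightarrow> 'r) \<Rightarrow> ('a \<Rightarrow> 'r) \<Rightarrow> 'a \<Rightarrow> 'r" where
  "conv f1 f2 = (\<lambda>g\<in>Arr. supp_sum R (\<lambda>h. f1 (g \<diamondop> ivt h) \<otimes> f2 h) {h \<in> Arr. src h = src g})"

lemma supp_sum_eq:
  assumes "finite B" "B \<subseteq> A" "\<And>x. x \<in> A \<Longrightarrow> x \<notin> B \<Longrightarrow> f x = \<zero>" "f \<in> A \<rightarrow> carrier R"
  shows "supp_sum R f A = (\<Oplus>x\<in>B. f x)"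
  unfolding supp_sum_def
  by (rule add.finprod_mono_neutral_cong_left) (use assms in auto)

text \<open>\<open>supp_sum\<close> runs over the indices with nonzero product, a set that changes
  with both factors. Replacing it by a larger finite \<open>B\<close> lets sums for different
  functions be combined over one index set.\<close>

lemma conv_eq:
  assumes f: "f1 \<in> Arr \<rightarrow> carrier R" "f2 \<in> Arr \<rightarrow> carrier R" and g: "g \<in> Arr"
    and B: "finite B" "B \<subseteq> {h \<in> Arr. src h = src g}"
    and 0: "\<And>h. h \<in> Arr \<Longrightarrow> src h = src g \<Longrightarrow> h \<notin> B \<Longrightarrow> f1 (g \<diamondop> ivt h) \<otimes> f2 h = \<zero>"
  shows "conv f1 f2 g = (\<Oplus>h\<in>B. f1 (g \<diamondop> ivt h) \<otimes> f2 h)"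
  unfolding conv_def using g
  by (simp, intro supp_sum_eq B) (use f g 0 in \<open>auto intro!: m_closed\<close>)

lemma conv_closed:
  assumes "f1 \<in> Arr \<rightarrow> carrier R" "f2 \<in> Arr \<rightarrow> carrier R"
  shows "conv f1 f2 \<in> Arr \<rightarrow>\<^sub>E carrier R"
  unfolding conv_def supp_sum_def
  by (auto intro!: finsum_closed m_closed funcset_mem[OF assms(1)] funcset_mem[OF assms(2)])

lemma conv_fiber:
  assumes f: "f1 \<in> Arr \<rightarrow> carrier R" "f2 \<in> Arr \<rightarrow> carrier R" and g: "g \<in> Arr"
    and B: "finite B" "{h \<in> Arr. src h = src g \<and> f2 h \<noteq> \<zero>} \<subseteq> B" "B \<subseteq> {h \<in> Arr. src h = src g}"
  shows "conv f1 f2 g = (\<Oplus>h\<in>B. f1 (g \<diamondop> ivt h) \<otimes> f2 h)"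
proof (rule conv_eq[OF f g B(1,3)])
  fix h assume h: "h \<in> Arr" "src h = src g" "h \<notin> B"
  then have "f2 h = \<zero>" using B by auto
  then show "f1 (g \<diamondop> ivt h) \<otimes> f2 h = \<zero>" using h g funcset_mem[OF f(1), of "g \<diamondop> ivt h"] by simp
qed

definition fzero :: "'a \<Rightarrow> 'r" where "fzero = (\<lambda>g\<in>Arr. \<zero>)"

definition fplus :: "('a \<Rightarrow> 'r) \<Rightarrow> ('a \<Rightarrow> 'r) \<Rightarrow> 'a \<Rightarrow> 'r" where
  "fplus f1 f2 = (\<lambda>g\<in>Arr. f1 g \<oplus> f2 g)"

definition fneg :: "('a \<Rightarrow> 'r) \<Rightarrow> 'a \<Rightarrow> 'r" where "fneg f = (\<lambda>g\<in>Arr. \<ominus> f g)"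

definition fscale :: "'r \<Rightarrow> ('a \<Rightarrow> 'r) \<Rightarrow> 'a \<Rightarrow> 'r" where "fscale c f = (\<lambda>g\<in>Arr. c \<otimes> f g)"

lemma pointwise_simps [simp]:
  assumes "g \<in> Arr"
  shows "fzero g = \<zero>" "fplus f1 f2 g = f1 g \<oplus> f2 g" "fneg f g = \<ominus> f g" "fscale c f g = c \<otimes> f g"
  using assms by (simp_all add: fzero_def fplus_def fneg_def fscale_def)

lemma pointwise_extensional [simp]:
  "fzero \<in> extensional Arr" "fplus f1 f2 \<in> extensional Arr" "fneg f \<in> extensional Arr"
  "fscale c f \<in> extensional Arr" "conv f1 f2 \<in> extensional Arr"
  by (simp_all add: fzero_def fplus_def fneg_def fscale_def conv_def)

lemma pointwise_undefined [simp]: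
  assumes "g \<notin> Arr"
  shows "fzero g = undefined" "fplus f1 f2 g = undefined" "fneg f g = undefined"
    "fscale c f g = undefined" "conv f1 f2 g = undefined"
  using assms by (simp_all add: fzero_def fplus_def fneg_def fscale_def conv_def)

lemma conv_add_left:
  assumes f: "f1 \<in> Arr \<rightarrow> carrier R" "f2 \<in> Arr \<rightarrow> carrier R" "f3 \<in> Arr \<rightarrow> carrier R" "fiber_finite f3"
  shows "conv (fplus f1 f2) f3 = fplus (conv f1 f3) (conv f2 f3)"
proof (rule extensionalityI[of _ Arr])
  fix g assume g: "g \<in> Arr"
  define B where "B = {h \<in> Arr. src h = src g \<and> f3 h \<noteq> \<zero>}"
  have B: "finite B" "{h \<in> Arr. src h = src g \<and> f3 h \<noteq> \<zero>} \<subseteq> B" "B \<subseteq> {h \<in> Arr. src h = src g}"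
    using f(4) by (auto simp: B_def fiber_finite_def)
  have c: "fplus f1 f2 \<in> Arr \<rightarrow> carrier R"
    by (auto intro!: a_closed funcset_mem[OF f(1)] funcset_mem[OF f(2)])
  have v: "f1 (g \<diamondop> ivt h) \<in> carrier R" "f2 (g \<diamondop> ivt h) \<in> carrier R" "f3 h \<in> carrier R" if "h \<in> B" for h
    using that g B(3) by (auto intro!: funcset_mem[OF f(1)] funcset_mem[OF f(2)] funcset_mem[OF f(3)])
  have "conv (fplus f1 f2) f3 g = (\<Oplus>h\<in>B. fplus f1 f2 (g \<diamondop> ivt h) \<otimes> f3 h)"
    by (rule conv_fiber[OF c f(3) g B])
  also have "\<dots> = (\<Oplus>h\<in>B. f1 (g \<diamondop> ivt h) \<otimes> f3 h \<oplus> f2 (g \<diamondop> ivt h) \<otimes> f3 h)"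
    by (rule finsum_cong') (use v g B(3) in \<open>auto simp: l_distr\<close>)
  also have "\<dots> = (\<Oplus>h\<in>B. f1 (g \<diamondop> ivt h) \<otimes> f3 h) \<oplus> (\<Oplus>h\<in>B. f2 (g \<diamondop> ivt h) \<otimes> f3 h)"
    by (rule finsum_addf) (use v in auto)
  finally show "conv (fplus f1 f2) f3 g = fplus (conv f1 f3) (conv f2 f3) g"
    using g by (simp add: conv_fiber[OF f(1,3) g B] conv_fiber[OF f(2,3) g B])
qed auto

lemma conv_add_right:
  assumes f: "f1 \<in> Arr \<rightarrow> carrier R" "f2 \<in> Arr \<rightarrow> carrier R" "f3 \<in> Arr \<rightarrow> carrier R"
    "fiber_finite f2" "fiber_finite f3"
  shows "conv f1 (fplus f2 f3) = fplus (conv f1 f2) (conv f1 f3)"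
proof (rule extensionalityI[of _ Arr])
  fix g assume g: "g \<in> Arr"
  define B where "B = {h \<in> Arr. src h = src g \<and> f2 h \<noteq> \<zero>} \<union> {h \<in> Arr. src h = src g \<and> f3 h \<noteq> \<zero>}"
  have B: "finite B" "B \<subseteq> {h \<in> Arr. src h = src g}"
    and B1: "{h \<in> Arr. src h = src g \<and> f2 h \<noteq> \<zero>} \<subseteq> B" and B2: "{h \<in> Arr. src h = src g \<and> f3 h \<noteq> \<zero>} \<subseteq> B"
    and B3: "{h \<in> Arr. src h = src g \<and> fplus f2 f3 h \<noteq> \<zero>} \<subseteq> B"
    using f(4,5) by (auto simp: B_def fiber_finite_def)
  have c: "fplus f2 f3 \<in> Arr \<rightarrow> carrier R"
    by (auto intro!: a_closed funcset_mem[OF f(2)] funcset_mem[OF f(3)])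
  have v: "f1 (g \<diamondop> ivt h) \<in> carrier R" "f2 h \<in> carrier R" "f3 h \<in> carrier R" if "h \<in> B" for h
    using that g B(2) by (auto intro!: funcset_mem[OF f(1)] funcset_mem[OF f(2)] funcset_mem[OF f(3)])
  have "conv f1 (fplus f2 f3) g = (\<Oplus>h\<in>B. f1 (g \<diamondop> ivt h) \<otimes> fplus f2 f3 h)"
    by (rule conv_fiber[OF f(1) c g B(1) B3 B(2)])
  also have "\<dots> = (\<Oplus>h\<in>B. f1 (g \<diamondop> ivt h) \<otimes> f2 h \<oplus> f1 (g \<diamondop> ivt h) \<otimes> f3 h)"
    by (rule finsum_cong') (use v g B(2) in \<open>auto simp: r_distr\<close>)
  also have "\<dots> = (\<Oplus>h\<in>B. f1 (g \<diamondop> ivt h) \<otimes> f2 h) \<oplus> (\<Oplus>h\<in>B. f1 (g \<diamondop> ivt h) \<otimes> f3 h)"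
    by (rule finsum_addf) (use v in auto)
  finally show "conv f1 (fplus f2 f3) g = fplus (conv f1 f2) (conv f1 f3) g"
    using g by (simp add: conv_fiber[OF f(1,2) g B(1) B1 B(2)] conv_fiber[OF f(1,3) g B(1) B2 B(2)])
qed auto

text \<open>Point masses. They span the finitely supported functions, and convolving with one is a
  scaled translation, so multiplicative identities are reduced to them.\<close>

definition mono :: "'r \<Rightarrow> 'a \<Rightarrow> 'a \<Rightarrow> 'r" where
  "mono c a = (\<lambda>g\<in>Arr. if g = a then c else \<zero>)"

lemma mono_closed [simp]: "c \<in> carrier R \<Longrightarrow> mono c a \<in> Arr \<rightarrow> carrier R"
  by (auto simp: mono_def)

lemma conv_mono_left:
  assumes c: "c \<in> carrier R" "a \<in> Arr" "f \<in> Arr \<rightarrow> carrier R" and g: "g \<in> Arr"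
  shows "conv (mono c a) f g = (if tgt g = tgt a then c \<otimes> f (ivt a \<diamondop> g) else \<zero>)"
proof (cases "tgt g = tgt a")
  case True
  have fc: "f (ivt a \<diamondop> g) \<in> carrier R" using c(2) g True by (intro funcset_mem[OF c(3)]) simp
  \<comment> \<open>The only factorization of \<open>g\<close> with left factor \<open>a\<close> has
    the right factor \<open>ivt a \<diamondop> g\<close>.\<close>
  have "conv (mono c a) f g = (\<Oplus>h\<in>{ivt a \<diamondop> g}. mono c a (g \<diamondop> ivt h) \<otimes> f h)"
    by (rule conv_eq) (use c g True comp_eq_iff in \<open>auto simp: mono_def intro!: l_null funcset_mem[OF c(3)]\<close>)
  also have "\<dots> = c \<otimes> f (ivt a \<diamondop> g)"
    using c g True fc by (simp add: mono_def inv_comp)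
  finally show ?thesis using True by simp
next
  case False
  have "conv (mono c a) f g = (\<Oplus>h\<in>{}. mono c a (g \<diamondop> ivt h) \<otimes> f h)"
    by (rule conv_eq) (use c g False comp_eq_iff in \<open>auto simp: mono_def intro!: l_null funcset_mem[OF c(3)]\<close>)
  then show ?thesis using False by simp
qed

lemma conv_mono_right:
  assumes c: "c \<in> carrier R" "a \<in> Arr" "f \<in> Arr \<rightarrow> carrier R" and g: "g \<in> Arr"
  shows "conv f (mono c a) g = (if src g = src a then f (g \<diamondop> ivt a) \<otimes> c else \<zero>)"
proof (cases "src g = src a")
  case True
  have fc: "f (g \<diamondop> ivt a) \<in> carrier R" using c(2) g True by (intro funcset_mem[OF c(3)]) simp
  have "conv f (mono c a) g = (\<Oplus>h\<in>{a}. f (g \<diamondop> ivt h) \<otimes> mono c a h)"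
    by (rule conv_eq) (use c g True in \<open>auto simp: mono_def intro!: r_null funcset_mem[OF c(3)]\<close>)
  also have "\<dots> = f (g \<diamondop> ivt a) \<otimes> c"
    using c g True fc by (simp add: mono_def)
  finally show ?thesis using True by simp
next
  case False
  have "conv f (mono c a) g = (\<Oplus>h\<in>{}. f (g \<diamondop> ivt h) \<otimes> mono c a h)"
    by (rule conv_eq) (use c g False in \<open>auto simp: mono_def intro!: r_null funcset_mem[OF c(3)]\<close>)
  then show ?thesis using False by simp
qed

lemma conv_mono_mono:
  assumes "c \<in> carrier R" "c' \<in> carrier R" "a \<in> Arr" "b \<in> Arr"
  shows "conv (mono c a) (mono c' b) = (if src a = tgt b then mono (c \<otimes> c') (a \<diamondop> b) else fzero)"
proof (rule extensionalityI[of _ Arr])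
  fix g assume g: "g \<in> Arr"
  have "tgt g = tgt a \<Longrightarrow> ivt a \<diamondop> g = b \<longleftrightarrow> src a = tgt b \<and> g = a \<diamondop> b" using assms g by auto
  moreover have "conv (mono c a) (mono c' b) g = (if tgt g = tgt a then c \<otimes> mono c' b (ivt a \<diamondop> g) else \<zero>)"
    using assms g by (intro conv_mono_left) auto
  ultimately show "conv (mono c a) (mono c' b) g =
      (if src a = tgt b then mono (c \<otimes> c') (a \<diamondop> b) else fzero) g"
    using assms g by (cases "tgt g = tgt a") (auto simp: mono_def)
qed (auto simp: conv_def mono_def)

text \<open>With a point mass in front, both sides are translates of one convolution sum and no
  double sum appears. The general law follows by linearity in the first factor.\<close>

lemma conv_assoc_mono:
  assumes c: "c \<in> carrier R" "a \<in> Arr" and f: "f1 \<in> Arr \<rightarrow> carrier R" "f2 \<in> Arr \<rightarrow> carrier R" "fiber_finite f2"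
  shows "conv (mono c a) (conv f1 f2) = conv (conv (mono c a) f1) f2"
proof (rule extensionalityI[of _ Arr])
  fix g assume g: "g \<in> Arr"
  define B where "B = {h \<in> Arr. src h = src g \<and> f2 h \<noteq> \<zero>}"
  have B: "finite B" "{h \<in> Arr. src h = src g \<and> f2 h \<noteq> \<zero>} \<subseteq> B" "B \<subseteq> {h \<in> Arr. src h = src g}"
    using f(3) by (auto simp: B_def fiber_finite_def)
  have f12: "conv f1 f2 \<in> Arr \<rightarrow> carrier R" "conv (mono c a) f1 \<in> Arr \<rightarrow> carrier R"
    using conv_closed[OF f(1,2)] conv_closed[OF mono_closed f(1)] c by (auto simp: PiE_def)
  have "conv (conv (mono c a) f1) f2 g = (\<Oplus>h\<in>B. conv (mono c a) f1 (g \<diamondop> ivt h) \<otimes> f2 h)"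
    by (rule conv_fiber[OF f12(2) f(2) g B])
  also have "\<dots> = (if tgt g = tgt a then c \<otimes> conv f1 f2 (ivt a \<diamondop> g) else \<zero>)"
  proof (cases "tgt g = tgt a")
    case True
    have v: "f1 (ivt a \<diamondop> (g \<diamondop> ivt h)) \<in> carrier R" "f2 h \<in> carrier R" if "h \<in> B" for h
      using that g B(3) c True by (auto intro!: funcset_mem[OF f(1)] funcset_mem[OF f(2)])
    have "(\<Oplus>h\<in>B. conv (mono c a) f1 (g \<diamondop> ivt h) \<otimes> f2 h)
        = (\<Oplus>h\<in>B. c \<otimes> (f1 (ivt a \<diamondop> (g \<diamondop> ivt h)) \<otimes> f2 h))"
      by (rule finsum_cong') (use v c g B(3) True f(1) in \<open>auto simp: conv_mono_left m_assoc\<close>)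
    also have "\<dots> = c \<otimes> (\<Oplus>h\<in>B. f1 (ivt a \<diamondop> (g \<diamondop> ivt h)) \<otimes> f2 h)"
      by (rule finsum_rdistr[symmetric]) (use v c B in auto)
    also have "(\<Oplus>h\<in>B. f1 (ivt a \<diamondop> (g \<diamondop> ivt h)) \<otimes> f2 h) = (\<Oplus>h\<in>B. f1 (ivt a \<diamondop> g \<diamondop> ivt h) \<otimes> f2 h)"
    proof (rule finsum_cong')
      fix h assume h: "h \<in> B"
      then show "f1 (ivt a \<diamondop> (g \<diamondop> ivt h)) \<otimes> f2 h = f1 (ivt a \<diamondop> g \<diamondop> ivt h) \<otimes> f2 h"
        using g B(3) c True comp_assoc[of "ivt a" g "ivt h"] by auto
    qed (use g B(3) c True in \<open>auto intro!: m_closed funcset_mem[OF f(1)] funcset_mem[OF f(2)]\<close>)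
    also have "\<dots> = conv f1 f2 (ivt a \<diamondop> g)"
      using B g c True by (intro conv_fiber[OF f(1,2), symmetric]) auto
    finally show ?thesis using True by simp
  next
    case False
    have "(\<Oplus>h\<in>B. conv (mono c a) f1 (g \<diamondop> ivt h) \<otimes> f2 h) = (\<Oplus>h\<in>B. \<zero>)"
      by (rule finsum_cong')
        (use c g B(3) False f in \<open>auto simp: conv_mono_left intro!: l_null funcset_mem[OF f(2)]\<close>)
    then show ?thesis using False by simp
  qed
  also have "\<dots> = conv (mono c a) (conv f1 f2) g"
    using conv_mono_left[OF c f12(1) g] by simp
  finally show "conv (mono c a) (conv f1 f2) g = conv (conv (mono c a) f1) f2 g" by simp
qed auto

text \<open>The multiple of the unit element by a scalar. It is supported on the identity arrows,
  hence finitely supported once there are finitely many objects.\<close>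

definition scal :: "'r \<Rightarrow> 'a \<Rightarrow> 'r" where
  "scal c = (\<lambda>g\<in>Arr. if g \<in> unt ` Obj then c else \<zero>)"

lemma conv_scal_left:
  assumes c: "c \<in> carrier R" and f: "f \<in> Arr \<rightarrow> carrier R" and g: "g \<in> Arr"
  shows "conv (scal c) f g = c \<otimes> f g"
proof -
  have "conv (scal c) f g = (\<Oplus>h\<in>{g}. scal c (g \<diamondop> ivt h) \<otimes> f h)"
  proof (rule conv_eq)
    fix h assume h: "h \<in> Arr" "src h = src g" "h \<notin> {g}"
    have "g \<diamondop> ivt h \<notin> unt ` Obj"
    proof
      assume "g \<diamondop> ivt h \<in> unt ` Obj"
      then obtain y where y: "y \<in> Obj" "g \<diamondop> ivt h = unt y" by auto
      then have "y = tgt h" using h g comp_closed(2)[of g "ivt h"] by simp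
      moreover have "g = unt y \<diamondop> h" using y h g cancel(4)[of g h] by simp
      ultimately show False using h by simp
    qed
    then show "scal c (g \<diamondop> ivt h) \<otimes> f h = \<zero>"
      using h g funcset_mem[OF f h(1)] by (simp add: scal_def)
  qed (use c f g in \<open>auto simp: scal_def\<close>)
  also have "\<dots> = c \<otimes> f g" using c g funcset_mem[OF f g] by (simp add: scal_def)
  finally show ?thesis .
qed

lemma conv_scal_right:
  assumes c: "c \<in> carrier R" and f: "f \<in> Arr \<rightarrow> carrier R" and g: "g \<in> Arr"
  shows "conv f (scal c) g = f g \<otimes> c"
proof -
  have "conv f (scal c) g = (\<Oplus>h\<in>{unt (src g)}. f (g \<diamondop> ivt h) \<otimes> scal c h)"
  proof (rule conv_eq)
    fix h assume h: "h \<in> Arr" "src h = src g" "h \<notin> {unt (src g)}"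
    then have "h \<notin> unt ` Obj" by auto
    then show "f (g \<diamondop> ivt h) \<otimes> scal c h = \<zero>"
      using h g funcset_mem[OF f, of "g \<diamondop> ivt h"] by (simp add: scal_def)
  qed (use c f g in \<open>auto simp: scal_def\<close>)
  also have "\<dots> = f g \<otimes> c" using c g funcset_mem[OF f g] by (simp add: scal_def)
  finally show ?thesis .
qed

end

text \<open>Only the carrier of \<open>groupoid_algebra\<close> is replaced, so that equality of the
  two algebras reduces to equality of their carriers.\<close>

definition fs_algebra ::
    "('r, 'm) ring_scheme \<Rightarrow> ('o, 'a, 'z) groupoid_scheme \<Rightarrow> ('r, 'a \<Rightarrow> 'r) module" where
  "fs_algebra R G = (groupoid_algebra R G)
     \<lparr>carrier := {f \<in> topspace (arrows G) \<rightarrow>\<^sub>E carrier R. finite {g \<in> topspace (arrows G). f g \<noteq> \<zero>\<^bsub>R\<^esub>}}\<rparr>"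

section \<open>The unital ring of finitely supported functions\<close>

locale finite_groupoid_ring = groupoid_coefficients R G
  for R :: "('r, 'm) ring_scheme" (structure) and G :: "('o, 'a, 'z) groupoid_scheme" +
  assumes finite_objects: "finite Obj"
begin

abbreviation A where "A \<equiv> fs_algebra R G"

lemma A_simps [simp]:
  "f1 \<otimes>\<^bsub>A\<^esub> f2 = conv f1 f2" "f1 \<oplus>\<^bsub>A\<^esub> f2 = fplus f1 f2" "\<zero>\<^bsub>A\<^esub> = fzero"
  "\<one>\<^bsub>A\<^esub> = scal \<one>" "c \<odot>\<^bsub>A\<^esub> f = fscale c f"
  by (simp_all add: fs_algebra_def groupoid_algebra_def conv_def scal_def char_fun_def
      fzero_def fplus_def fscale_def)

lemma A_carrier: "f \<in> carrier A \<longleftrightarrow> f \<in> Arr \<rightarrow>\<^sub>E carrier R \<and> finite {g \<in> Arr. f g \<noteq> \<zero>}"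
  by (simp add: fs_algebra_def)

lemma A_funcset: "f \<in> carrier A \<Longrightarrow> f \<in> Arr \<rightarrow> carrier R"
  by (auto simp: A_carrier)

lemma A_val: "f \<in> carrier A \<Longrightarrow> g \<in> Arr \<Longrightarrow> f g \<in> carrier R"
  by (auto simp: A_carrier)

lemma A_finite: "f \<in> carrier A \<Longrightarrow> finite {g \<in> Arr. f g \<noteq> \<zero>}"
  by (auto simp: A_carrier)

lemma A_fiber_finite: "f \<in> carrier A \<Longrightarrow> fiber_finite f"
  unfolding fiber_finite_def using A_finite by (auto intro: finite_subset[of _ "{g \<in> Arr. f g \<noteq> \<zero>}"])

lemma A_eqI: "f \<in> carrier A \<Longrightarrow> f' \<in> carrier A \<Longrightarrow> (\<And>g. g \<in> Arr \<Longrightarrow> f g = f' g) \<Longrightarrow> f = f'"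
  unfolding A_carrier by (blast intro: PiE_ext)

lemma A_carrierI:
  assumes "finite S" "\<And>g. g \<in> Arr \<Longrightarrow> g \<notin> S \<Longrightarrow> f g = \<zero>" "\<And>g. g \<in> Arr \<Longrightarrow> f g \<in> carrier R"
    "\<And>g. g \<notin> Arr \<Longrightarrow> f g = undefined"
  shows "f \<in> carrier A"
  unfolding A_carrier using assms by (auto intro: finite_subset[of _ S])

lemma mono_in_A [simp, intro]: "c \<in> carrier R \<Longrightarrow> mono c a \<in> carrier A"
  by (rule A_carrierI[of "{a}"]) (auto simp: mono_def)

lemma scal_in_A [simp, intro]: "c \<in> carrier R \<Longrightarrow> scal c \<in> carrier A"
  by (rule A_carrierI[of "unt ` Obj"]) (auto simp: scal_def finite_objects)

lemma A_zero_in: "fzero \<in> carrier A"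
  by (rule A_carrierI[of "{}"]) auto

lemma A_add_in: "f1 \<in> carrier A \<Longrightarrow> f2 \<in> carrier A \<Longrightarrow> fplus f1 f2 \<in> carrier A"
  by (rule A_carrierI[of "{g \<in> Arr. f1 g \<noteq> \<zero>} \<union> {g \<in> Arr. f2 g \<noteq> \<zero>}"]) (auto simp: A_finite A_val)

lemma A_uminus_in: "f \<in> carrier A \<Longrightarrow> fneg f \<in> carrier A"
  by (rule A_carrierI[of "{g \<in> Arr. f g \<noteq> \<zero>}"]) (auto simp: A_finite A_val)

lemma abelian_group_A: "abelian_group A"
  and A_uminus: "f \<in> carrier A \<Longrightarrow> \<ominus>\<^bsub>A\<^esub> f = fneg f"
proof -
  have sub: "carrier A \<subseteq> Arr \<rightarrow>\<^sub>E carrier R" by (auto simp: A_carrier)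
  note * = function_abelian_group[of A Arr, OF A_simps(3)[unfolded fzero_def] A_simps(2)[unfolded fplus_def] sub, folded fneg_def]
  show "abelian_group A" by (rule *(1)) (use A_zero_in A_add_in A_uminus_in in simp_all)
  show "\<ominus>\<^bsub>A\<^esub> f = fneg f" if "f \<in> carrier A"
    by (rule *(2)) (use that A_zero_in A_add_in A_uminus_in in simp_all)
qed

lemma A_induct [consumes 1, case_names zero add]:
  assumes f: "f \<in> carrier A" and z: "P fzero"
    and a: "\<And>f c a. f \<in> carrier A \<Longrightarrow> P f \<Longrightarrow> c \<in> carrier R \<Longrightarrow> a \<in> Arr \<Longrightarrow> P (fplus f (mono c a))"
  shows "P f"
proof -
  have "\<forall>f\<in>carrier A. {g \<in> Arr. f g \<noteq> \<zero>} \<subseteq> S \<longrightarrow> P f" if "finite S" for S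
    using that
  proof (induction S)
    case empty
    show ?case
    proof (intro ballI impI)
      fix f assume f: "f \<in> carrier A" "{g \<in> Arr. f g \<noteq> \<zero>} \<subseteq> {}"
      then have "f = fzero" by (intro A_eqI A_zero_in) auto
      then show "P f" using z by simp
    qed
  next
    case (insert a S)
    show ?case
    proof (intro ballI impI)
      fix f assume f: "f \<in> carrier A" "{g \<in> Arr. f g \<noteq> \<zero>} \<subseteq> insert a S"
      show "P f"
      proof (cases "a \<in> Arr")
        case True
        define f' where "f' = (\<lambda>g\<in>Arr. if g = a then \<zero> else f g)"
        have f': "f' \<in> carrier A"
          by (rule A_carrierI[of "{g \<in> Arr. f g \<noteq> \<zero>}"]) (use f in \<open>auto simp: f'_def A_finite A_val\<close>)
        have eq: "f = fplus f' (mono (f a) a)"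
          by (rule A_eqI) (use f f' True in \<open>auto intro!: A_add_in simp: A_val\<close>, auto simp: f'_def mono_def A_val f)
        have "{g \<in> Arr. f' g \<noteq> \<zero>} \<subseteq> S" using f(2) by (auto simp: f'_def)
        then have "P f'" using insert.IH f' by blast
        then show ?thesis using a[OF f' _ A_val[OF f(1) True] True] eq by simp
      next
        case False
        then show ?thesis using insert.IH f by auto
      qed
    qed
  qed
  then show ?thesis using A_finite[OF f] f by blast
qed

lemma conv_zero_left: "f \<in> carrier A \<Longrightarrow> conv fzero f = fzero"
  by (rule extensionalityI[of _ Arr], simp add: conv_def, simp)
    (subst conv_eq[of _ _ _ "{}"], auto simp: A_val A_funcset intro!: l_null A_val)

lemma conv_mono_in:
  assumes "c \<in> carrier R" "a \<in> Arr" "f \<in> carrier A"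
  shows "conv (mono c a) f \<in> carrier A"
proof (rule A_carrierI[of "(\<lambda>h. a \<diamondop> h) ` {g \<in> Arr. f g \<noteq> \<zero>}"])
  show "finite ((\<lambda>h. a \<diamondop> h) ` {g \<in> Arr. f g \<noteq> \<zero>})" using assms A_finite by blast
  fix g assume g: "g \<in> Arr"
  show "conv (mono c a) f g \<in> carrier R"
    using assms g A_val[OF assms(3)] by (auto simp: conv_mono_left A_funcset)
  assume "g \<notin> (\<lambda>h. a \<diamondop> h) ` {g \<in> Arr. f g \<noteq> \<zero>}"
  moreover have "g = a \<diamondop> (ivt a \<diamondop> g)" if "tgt g = tgt a" using that g assms by simp
  ultimately have "tgt g = tgt a \<Longrightarrow> f (ivt a \<diamondop> g) = \<zero>" using g assms by fastforce
  then show "conv (mono c a) f g = \<zero>" using assms g by (auto simp: conv_mono_left A_funcset)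
qed (simp add: conv_def)

lemma A_distr:
  assumes "f1 \<in> carrier A" "f2 \<in> carrier A" "f3 \<in> carrier A"
  shows "conv (fplus f1 f2) f3 = fplus (conv f1 f3) (conv f2 f3)"
    and "conv f1 (fplus f2 f3) = fplus (conv f1 f2) (conv f1 f3)"
  using assms by (auto intro!: conv_add_left conv_add_right A_funcset A_fiber_finite)

lemma conv_in: "f1 \<in> carrier A \<Longrightarrow> f2 \<in> carrier A \<Longrightarrow> conv f1 f2 \<in> carrier A"
proof (induction rule: A_induct)
  case zero
  show ?case unfolding conv_zero_left[OF zero] by (rule A_zero_in)
next
  case (add f c a)
  then show ?case using A_distr(1)[of f "mono c a" f2] by (simp add: A_add_in conv_mono_in)
qed

lemma A_conv_assoc:
  assumes "f1 \<in> carrier A" "f2 \<in> carrier A" "f3 \<in> carrier A"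
  shows "conv (conv f1 f2) f3 = conv f1 (conv f2 f3)"
  using assms
proof (induction rule: A_induct)
  case zero
  show ?case unfolding conv_zero_left[OF zero(1)] conv_zero_left[OF zero(2)]
      conv_zero_left[OF conv_in[OF zero]] ..
next
  case (add f c a)
  then have "conv (conv (mono c a) f2) f3 = conv (mono c a) (conv f2 f3)"
    using conv_assoc_mono[of c a f2 f3] A_funcset A_fiber_finite by simp
  then show ?case using add A_distr(1) conv_in conv_mono_in by simp
qed

lemma ring_A: "ring A"
proof (rule ringI[OF abelian_group_A])
  show "monoid A"
  proof (rule monoidI)
    fix f assume f: "f \<in> carrier A"
    show "\<one>\<^bsub>A\<^esub> \<otimes>\<^bsub>A\<^esub> f = f"
      by (rule A_eqI) (use f in \<open>auto simp: conv_scal_left A_funcset A_val intro!: conv_in\<close>)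
    show "f \<otimes>\<^bsub>A\<^esub> \<one>\<^bsub>A\<^esub> = f"
      by (rule A_eqI) (use f in \<open>auto simp: conv_scal_right A_funcset A_val intro!: conv_in\<close>)
  qed (use conv_in A_conv_assoc in \<open>auto\<close>)
qed (use A_distr in \<open>auto\<close>)

sublocale A: ring A by (rule ring_A)

text \<open>Every element of \<open>A\<close> is a finite sum of point masses, so stability under
  left convolution with these gives stability under all of \<open>A\<close>.\<close>

lemma left_ideal_AI:
  assumes "I \<subseteq> carrier A" "fzero \<in> I" "\<And>f f'. f \<in> I \<Longrightarrow> f' \<in> I \<Longrightarrow> fplus f f' \<in> I"
    and neg: "\<And>f. f \<in> I \<Longrightarrow> fneg f \<in> I"
    and mult: "\<And>c a f. c \<in> carrier R \<Longrightarrow> a \<in> Arr \<Longrightarrow> f \<in> I \<Longrightarrow> conv (mono c a) f \<in> I"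
  shows "left_ideal I A"
proof (rule A.left_idealI)
  show "\<ominus>\<^bsub>A\<^esub> f \<in> I" if "f \<in> I" for f using that neg A_uminus assms(1) by auto
  show "x \<otimes>\<^bsub>A\<^esub> f \<in> I" if "x \<in> carrier A" "f \<in> I" for x f
    using that
  proof (induction rule: A_induct)
    case zero
    then have "f \<in> carrier A" using assms(1) by auto
    show ?case unfolding A_simps(1) conv_zero_left[OF \<open>f \<in> carrier A\<close>] by (rule assms(2))
  next
    case (add x c a)
    have "f \<in> carrier A" using add assms(1) by auto
    then show ?case using add A_distr(1)[of x "mono c a" f] assms(3) mult by simp
  qed
qed (use assms in auto)

text \<open>Scaling by \<open>c\<close> is left multiplication by \<open>scal c\<close>; the unit of
  \<open>A\<close> thus turns left ideals into \<open>R\<close>-submodules.\<close>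

lemma left_ideal_scale:
  assumes I: "left_ideal I A" and c: "c \<in> carrier R" and f: "f \<in> I"
  shows "fscale c f \<in> I"
proof -
  have fc: "f \<in> carrier A" using f A.left_ideal_subset[OF I] by auto
  have "scal c \<otimes>\<^bsub>A\<^esub> f \<in> I" using A.left_ideal_mult[OF I _ f] c by auto
  moreover have "scal c \<otimes>\<^bsub>A\<^esub> f = fscale c f"
    by (rule extensionalityI[of _ Arr]) (use c fc in \<open>simp_all add: conv_scal_left A_funcset\<close>)
  ultimately show ?thesis by simp
qed

end

section \<open>Group algebras of isotropy groups\<close>

text \<open>A group is viewed as a groupoid with one object, so that the results on finitely
  supported functions apply to group algebras. The topologies carry the underlying sets, and
  \<open>group_algebra_eq\<close> shows that the two algebra records are equal.\<close>

definition group_groupoid :: "('g, 'n) monoid_scheme \<Rightarrow> (unit, 'g) groupoid" where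
  "group_groupoid H = \<lparr>objects = discrete_topology UNIV, arrows = discrete_topology (carrier H),
     dmap = (\<lambda>_. ()), rmap = (\<lambda>_. ()), gunit = (\<lambda>_. \<one>\<^bsub>H\<^esub>), gmult = mult H, ginv = m_inv H\<rparr>"

lemma group_groupoid_simps [simp]:
  "topspace (objects (group_groupoid H)) = UNIV" "topspace (arrows (group_groupoid H)) = carrier H"
  "dmap (group_groupoid H) g = ()" "rmap (group_groupoid H) g = ()"
  "gunit (group_groupoid H) x = \<one>\<^bsub>H\<^esub>" "gmult (group_groupoid H) = mult H" "ginv (group_groupoid H) = m_inv H"
  by (simp_all add: group_groupoid_def)

lemma group_algebra_eq: "group_algebra R H = fs_algebra R (group_groupoid H)"
  by (simp add: group_algebra_def fs_algebra_def groupoid_algebra_def UNIV_unit)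

locale group_ring = R?: cring R + H?: group H
  for R :: "('r, 'm) ring_scheme" (structure) and H :: "('g, 'n) monoid_scheme" (structure)
begin

sublocale C: finite_groupoid_ring R "group_groupoid H"
  by unfold_locales (auto simp: composable_def H.m_assoc)

abbreviation "C \<equiv> group_algebra R H"

sublocale GA: ring C
  unfolding group_algebra_eq by (rule C.ring_A)

text \<open>Writes stability under point masses as a translation formula free of
  \<open>group_groupoid\<close>, so that it can be instantiated at the isotropy groups of an ambient
  groupoid.\<close>

lemma left_ideal_CI:
  assumes "I \<subseteq> carrier C" "(\<lambda>g\<in>carrier H. \<zero>) \<in> I"
    "\<And>f f'. f \<in> I \<Longrightarrow> f' \<in> I \<Longrightarrow> (\<lambda>g\<in>carrier H. f g \<oplus> f' g) \<in> I"
    "\<And>f. f \<in> I \<Longrightarrow> (\<lambda>g\<in>carrier H. \<ominus> f g) \<in> I"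
    and s: "\<And>c a f. c \<in> carrier R \<Longrightarrow> a \<in> carrier H \<Longrightarrow> f \<in> I \<Longrightarrow>
       (\<lambda>g\<in>carrier H. c \<otimes> f (inv\<^bsub>H\<^esub> a \<otimes>\<^bsub>H\<^esub> g)) \<in> I"
  shows "left_ideal I C"
  unfolding group_algebra_eq
proof (rule C.left_ideal_AI)
  fix c a f assume *: "c \<in> carrier R" "a \<in> topspace (arrows (group_groupoid H))" "f \<in> I"
  then have "f \<in> carrier C.A" using assms(1) by (auto simp: group_algebra_eq)
  then have "C.conv (C.mono c a) f = (\<lambda>g\<in>carrier H. c \<otimes> f (inv\<^bsub>H\<^esub> a \<otimes>\<^bsub>H\<^esub> g))"
    using C.conv_mono_left[OF *(1,2) C.A_funcset] C.pointwise_extensional(5)[of "C.mono c a" f]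
    by (intro extensionalityI[of _ "carrier H"]) auto
  then show "C.conv (C.mono c a) f \<in> I" using s[of c a f] * by simp
qed (use assms in \<open>auto simp: group_algebra_eq C.fzero_def C.fplus_def C.fneg_def\<close>)

lemma left_ideal_C_closed:
  assumes I: "left_ideal I C"
  shows "(\<lambda>g\<in>carrier H. \<zero>) \<in> I"
    and "f \<in> I \<Longrightarrow> f' \<in> I \<Longrightarrow> (\<lambda>g\<in>carrier H. f g \<oplus> f' g) \<in> I"
    and "f \<in> I \<Longrightarrow> (\<lambda>g\<in>carrier H. \<ominus> f g) \<in> I"
    and "c \<in> carrier R \<Longrightarrow> a \<in> carrier H \<Longrightarrow> f \<in> I \<Longrightarrow> (\<lambda>g\<in>carrier H. c \<otimes> f (inv\<^bsub>H\<^esub> a \<otimes>\<^bsub>H\<^esub> g)) \<in> I"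
    and "I \<subseteq> carrier C"
proof -
  note I' = I[unfolded group_algebra_eq]
  have sub: "I \<subseteq> carrier C.A" by (rule C.A.left_ideal_subset[OF I'])
  then show "I \<subseteq> carrier C" by (simp add: group_algebra_eq)
  show "(\<lambda>g\<in>carrier H. \<zero>) \<in> I" using C.A.left_ideal_zero[OF I'] by (simp add: C.fzero_def)
  show "(\<lambda>g\<in>carrier H. f g \<oplus> f' g) \<in> I" if "f \<in> I" "f' \<in> I"
    using C.A.left_ideal_add[OF I' that] by (simp add: C.fplus_def)
  show "(\<lambda>g\<in>carrier H. \<ominus> f g) \<in> I" if "f \<in> I"
  proof -
    have "f \<in> carrier C.A" using that sub by auto
    then show ?thesis using C.A.left_ideal_neg[OF I' that] C.A_uminus by (simp add: C.fneg_def)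
  qed
  show "(\<lambda>g\<in>carrier H. c \<otimes> f (inv\<^bsub>H\<^esub> a \<otimes>\<^bsub>H\<^esub> g)) \<in> I" if *: "c \<in> carrier R" "a \<in> carrier H" "f \<in> I"
  proof -
    have f: "f \<in> carrier C.A" using that sub by auto
    have a: "a \<in> topspace (arrows (group_groupoid H))" using * by simp
    have "C.conv (C.mono c a) f = (\<lambda>g\<in>carrier H. c \<otimes> f (inv\<^bsub>H\<^esub> a \<otimes>\<^bsub>H\<^esub> g))"
      using C.conv_mono_left[OF *(1) a C.A_funcset[OF f]] C.pointwise_extensional(5)[of "C.mono c a" f]
      by (intro extensionalityI[of _ "carrier H"]) auto
    then show ?thesis using C.A.left_ideal_mult[OF I' C.mono_in_A[OF *(1)] *(3), of a] by simp
  qed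
qed

end

context groupoid
begin

definition isot where
  "isot x = {g \<in> Arr. src g = x \<and> tgt g = x}"

lemma isotropy_group_simps [simp]:
  "carrier (isotropy_group G x) = isot x" "mult (isotropy_group G x) = gmult G"
  "one (isotropy_group G x) = unt x"
  by (simp_all add: isotropy_group_def isot_def)

lemma group_isotropy: "x \<in> Obj \<Longrightarrow> group (isotropy_group G x)"
proof (rule groupI)
  fix g assume "x \<in> Obj" "g \<in> carrier (isotropy_group G x)"
  then show "\<exists>h\<in>carrier (isotropy_group G x).
      h \<otimes>\<^bsub>isotropy_group G x\<^esub> g = \<one>\<^bsub>isotropy_group G x\<^esub>"
    by (intro bexI[of _ "ivt g"]) (auto simp: isot_def)
qed (auto simp: isot_def comp_assoc)

lemma isotropy_inv:
  assumes x: "x \<in> Obj" and h: "h \<in> isot x"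
  shows "m_inv (isotropy_group G x) h = ivt h"
proof -
  interpret group "isotropy_group G x" by (rule group_isotropy[OF x])
  show ?thesis by (rule inv_equality) (use h in \<open>auto simp: isot_def\<close>)
qed

end

section \<open>Transfer of chain conditions\<close>

lemma chain_conditionD:
  "chain_condition up A \<Longrightarrow> (\<And>n. left_ideal (I n) A) \<Longrightarrow> chain up I \<Longrightarrow> stabilizes I"
  by (simp add: chain_condition_def)

text \<open>\<open>Q\<close> recovers \<open>J n\<close> from its image under \<open>F\<close>, so a
  chain can be tested after it has been carried into another ring.\<close>

lemma stabilizes_inverse:
  assumes F: "stabilizes (\<lambda>n. F (J n))" and Q: "\<And>n. J n = Q (F (J n))"
  shows "stabilizes J"
proof -
  obtain N where N: "\<And>n. n \<ge> N \<Longrightarrow> F (J n) = F (J N)" using F unfolding stabilizes_def by blast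
  have "J n = J N" if "n \<ge> N" for n
  proof -
    have "J n = Q (F (J n))" by (rule Q)
    also have "\<dots> = Q (F (J N))" using N[OF that] by simp
    also have "\<dots> = J N" by (rule Q[symmetric])
    finally show ?thesis .
  qed
  then show ?thesis unfolding stabilizes_def by blast
qed

context finite_groupoid_ring
begin

lemma group_ring_isotropy: "x \<in> Obj \<Longrightarrow> group_ring R (isotropy_group G x)"
  unfolding group_ring_def using group_isotropy R.cring_axioms by auto

lemmas left_ideal_isot = group_ring.left_ideal_C_closed[OF group_ring_isotropy, simplified]
lemmas left_ideal_isotI = group_ring.left_ideal_CI[OF group_ring_isotropy, simplified]

lemma isot_algebra_carrier:
  "\<phi> \<in> carrier (group_algebra R (isotropy_group G x)) \<longleftrightarrow>
     \<phi> \<in> isot x \<rightarrow>\<^sub>E carrier R \<and> finite {h \<in> isot x. \<phi> h \<noteq> \<zero>}"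
  by (simp add: group_algebra_def)

lemma left_ideal_isot_shift:
  assumes x: "x \<in> Obj" and J: "left_ideal J (group_algebra R (isotropy_group G x))"
    and "c \<in> carrier R" "a \<in> isot x" "f \<in> J"
  shows "(\<lambda>h\<in>isot x. c \<otimes> f (ivt a \<diamondop> h)) \<in> J"
  using left_ideal_isot(4)[OF x J assms(3-5)] isotropy_inv[OF x assms(4)] by simp

text \<open>The restriction of \<open>f\<close> to the coset of all \<open>g \<diamondop> h\<close>
  with \<open>h\<close> in the isotropy group at \<open>x\<close>, read as a function on that group.
  Such cosets partition the arrows with source \<open>x\<close>.\<close>

definition translate where "translate x g f = (\<lambda>h\<in>isot x. f (g \<diamondop> h))"

lemma isot_iff [simp]: "h \<in> isot x \<longleftrightarrow> h \<in> Arr \<and> src h = x \<and> tgt h = x"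
  by (auto simp: isot_def)

lemma isot_unit: "x \<in> Obj \<Longrightarrow> unt x \<in> isot x" by simp

lemma isot_inv: "g \<in> isot x \<Longrightarrow> ivt g \<in> isot x" by simp

lemma translate_in:
  assumes f: "f \<in> carrier A" and g: "g \<in> Arr" "src g = x"
  shows "translate x g f \<in> carrier (group_algebra R (isotropy_group G x))"
  unfolding isot_algebra_carrier
proof
  show "translate x g f \<in> isot x \<rightarrow>\<^sub>E carrier R"
    using f g by (auto simp: translate_def A_val)
  have "{h \<in> isot x. translate x g f h \<noteq> \<zero>} \<subseteq> (\<lambda>k. ivt g \<diamondop> k) ` {k \<in> Arr. f k \<noteq> \<zero>}"
  proof
    fix h assume "h \<in> {h \<in> isot x. translate x g f h \<noteq> \<zero>}"
    then have "h = ivt g \<diamondop> (g \<diamondop> h)" "g \<diamondop> h \<in> {k \<in> Arr. f k \<noteq> \<zero>}" using g by (auto simp: translate_def)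
    then show "h \<in> (\<lambda>k. ivt g \<diamondop> k) ` {k \<in> Arr. f k \<noteq> \<zero>}" by blast
  qed
  then show "finite {h \<in> isot x. translate x g f h \<noteq> \<zero>}"
    using A_finite[OF f] by (auto intro: finite_subset)
qed

text \<open>A left ideal \<open>J\<close> of the isotropy algebra induces the left ideal of all
  functions whose restrictions to the cosets over \<open>x\<close> belong to \<open>J\<close>.
  Extension by zero from the isotropy group recovers \<open>J\<close> from it, so
  \<open>stabilizes_inverse\<close> applies.\<close>

lemma chain_condition_isotropy:
  assumes A: "chain_condition up A" and x: "x \<in> Obj"
  shows "chain_condition up (group_algebra R (isotropy_group G x))"
  unfolding chain_condition_def
proof (intro allI impI)
  let ?C = "group_algebra R (isotropy_group G x)"
  fix J assume J: "(\<forall>n. left_ideal (J n) ?C) \<and> chain up J"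
  define F where "F X = {f \<in> carrier A. \<forall>g\<in>Arr. src g = x \<longrightarrow> translate x g f \<in> X}" for X
  have FJ: "left_ideal (F (J n)) A" for n
  proof (rule left_ideal_AI)
    have Jn: "left_ideal (J n) ?C" using J by blast
    note cl = left_ideal_isot[OF x Jn]
    show "fzero \<in> F (J n)"
    proof -
      have "translate x g fzero = (\<lambda>h\<in>isot x. \<zero>)" if "g \<in> Arr" "src g = x" for g
        using that by (intro extensionalityI[of _ "isot x"]) (auto simp: translate_def)
      then show ?thesis using cl(1) A_zero_in by (simp add: F_def)
    qed
    show "fplus f f' \<in> F (J n)" if f: "f \<in> F (J n)" "f' \<in> F (J n)" for f f'
    proof -
      have "translate x g (fplus f f') = (\<lambda>h\<in>isot x. translate x g f h \<oplus> translate x g f' h)"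
        if "g \<in> Arr" "src g = x" for g
        using that by (intro extensionalityI[of _ "isot x"]) (auto simp: translate_def)
      then show ?thesis using cl(2) A_add_in f by (simp add: F_def)
    qed
    show "fneg f \<in> F (J n)" if f: "f \<in> F (J n)" for f
    proof -
      have "translate x g (fneg f) = (\<lambda>h\<in>isot x. \<ominus> translate x g f h)"
        if "g \<in> Arr" "src g = x" for g
        using that by (intro extensionalityI[of _ "isot x"]) (auto simp: translate_def)
      then show ?thesis using cl(3) A_uminus_in f by (simp add: F_def)
    qed
    show "conv (mono c a) f \<in> F (J n)" if c: "c \<in> carrier R" "a \<in> Arr" and f: "f \<in> F (J n)" for c a f
    proof -
      have fA: "f \<in> carrier A" using f by (simp add: F_def)
      have "translate x g (conv (mono c a) f) \<in> J n" if g: "g \<in> Arr" "src g = x" for g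
      proof (cases "tgt g = tgt a")
        case True
        \<comment> \<open>A point mass on the left permutes the cosets and scales by
          \<open>c\<close>: the coset of \<open>g\<close> receives the values of the coset of
          \<open>ivt a \<diamondop> g\<close>. The scaling is expressed as a shift by the identity
          in the isotropy algebra.\<close>
        have "translate x g (conv (mono c a) f)
            = (\<lambda>h\<in>isot x. c \<otimes> translate x (ivt a \<diamondop> g) f (ivt (unt x) \<diamondop> h))"
          using g True c fA x
          by (intro extensionalityI[of _ "isot x"])
            (auto simp: translate_def conv_mono_left A_funcset comp_assoc)
        moreover have "translate x (ivt a \<diamondop> g) f \<in> J n" using f g True c by (auto simp: F_def)
        ultimately show ?thesis
          using left_ideal_isot_shift[OF x Jn c(1) isot_unit[OF x]] by simp
      next
        case False
        have "translate x g (conv (mono c a) f) = (\<lambda>h\<in>isot x. \<zero>)"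
          using g False c fA x
          by (intro extensionalityI[of _ "isot x"]) (auto simp: translate_def conv_mono_left A_funcset)
        then show ?thesis using cl(1) by simp
      qed
      then show ?thesis using conv_mono_in[OF c fA] by (simp add: F_def)
    qed
  qed (auto simp: F_def)
  define ext where "ext \<phi> = (\<lambda>g\<in>Arr. if g \<in> isot x then \<phi> g else \<zero>)" for \<phi>
  have ext_in: "ext \<phi> \<in> carrier A" if "\<phi> \<in> carrier ?C" for \<phi>
    by (rule A_carrierI[of "{h \<in> isot x. \<phi> h \<noteq> \<zero>}"]) (use that in \<open>auto simp: isot_algebra_carrier ext_def\<close>)
  have J_eq: "J n = (\<lambda>X. {\<phi> \<in> carrier ?C. ext \<phi> \<in> X}) (F (J n))" for n
  proof (intro equalityI subsetI)
    have Jn: "left_ideal (J n) ?C" using J by blast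
    note cl = left_ideal_isot[OF x Jn]
    fix \<phi> assume \<phi>: "\<phi> \<in> J n"
    then have C: "\<phi> \<in> carrier ?C" using cl(5) by auto
    have "translate x g (ext \<phi>) \<in> J n" if g: "g \<in> Arr" "src g = x" for g
    proof (cases "g \<in> isot x")
      case True
      \<comment> \<open>Here the coset of \<open>g\<close> is the isotropy group itself, and reading
        it from \<open>g\<close> instead of the identity is a left translation by
        \<open>ivt g\<close>.\<close>
      have "translate x g (ext \<phi>) = (\<lambda>h\<in>isot x. \<one> \<otimes> \<phi> (ivt (ivt g) \<diamondop> h))"
      proof (rule extensionalityI[of _ "isot x"])
        fix h assume h: "h \<in> isot x"
        have "\<phi> (g \<diamondop> h) \<in> carrier R" using C True h by (auto simp: isot_algebra_carrier)
        then show "translate x g (ext \<phi>) h = (\<lambda>h\<in>isot x. \<one> \<otimes> \<phi> (ivt (ivt g) \<diamondop> h)) h"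
          using h True by (simp add: translate_def ext_def)
      qed (auto simp: translate_def)
      then show ?thesis using left_ideal_isot_shift[OF x Jn R.one_closed isot_inv[OF True] \<phi>] by simp
    next
      case False
      have "translate x g (ext \<phi>) = (\<lambda>h\<in>isot x. \<zero>)"
        using False g by (intro extensionalityI[of _ "isot x"]) (auto simp: translate_def ext_def isot_def)
      then show ?thesis using cl(1) by simp
    qed
    then show "\<phi> \<in> {\<phi> \<in> carrier ?C. ext \<phi> \<in> F (J n)}" using C ext_in by (auto simp: F_def)
  next
    fix \<phi> assume "\<phi> \<in> {\<phi> \<in> carrier ?C. ext \<phi> \<in> F (J n)}"
    then have \<phi>: "\<phi> \<in> carrier ?C" "translate x (unt x) (ext \<phi>) \<in> J n" using x by (auto simp: F_def)
    have "translate x (unt x) (ext \<phi>) = \<phi>"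
      using \<phi>(1) x by (intro extensionalityI[of _ "isot x"]) (auto simp: translate_def ext_def isot_algebra_carrier PiE_def)
    then show "\<phi> \<in> J n" using \<phi> by simp
  qed
  have "chain up (\<lambda>n. F (J n))"
    by (rule chain_image[where I = J and F = F]) (use J in \<open>auto simp: F_def\<close>)
  then have "stabilizes (\<lambda>n. F (J n))" by (intro chain_conditionD[OF A] FJ)
  then show "stabilizes J" by (rule stabilizes_inverse[where F = F]) (rule J_eq)
qed

text \<open>Arrows are sorted by a label \<open>\<kappa>\<close>, and functions are filtered by the
  labels that their supports use. Equality of the invariant \<open>D\<close> must ensure that the
  part of \<open>f\<close> with the new label \<open>s\<close> is matched by an element of
  \<open>I m\<close> at the same stage of the filtration. It is applied with the arrow itself as
  label, and with the pair of range and source.\<close>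

lemma supported_stabilizes:
  assumes I: "\<And>n. left_ideal (I n) A" and c: "chain up I" and S: "finite S"
    and step: "\<And>s S. s \<notin> S \<Longrightarrow> \<exists>D :: nat \<Rightarrow> 'd. stabilizes D \<and> (\<forall>m n f. D m = D n \<longrightarrow> f \<in> I n \<longrightarrow>
       (\<forall>g\<in>Arr. f g \<noteq> \<zero> \<longrightarrow> \<kappa> g \<in> insert s S) \<longrightarrow>
       (\<exists>h\<in>I m. (\<forall>g\<in>Arr. h g \<noteq> \<zero> \<longrightarrow> \<kappa> g \<in> insert s S) \<and> (\<forall>g\<in>Arr. \<kappa> g = s \<longrightarrow> f g = h g)))"
  shows "stabilizes (\<lambda>n. I n \<inter> {f \<in> carrier A. \<forall>g\<in>Arr. f g \<noteq> \<zero> \<longrightarrow> \<kappa> g \<in> S})"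
  using S
proof (induction S)
  case empty
  have "I n \<inter> {f \<in> carrier A. \<forall>g\<in>Arr. f g \<noteq> \<zero> \<longrightarrow> \<kappa> g \<in> {}} = {fzero}" for n
  proof -
    have 1: "f = fzero" if "f \<in> carrier A" "\<forall>g\<in>Arr. f g = \<zero>" for f
      using that by (intro A_eqI A_zero_in) auto
    have 2: "fzero \<in> I n" using A.left_ideal_zero[OF I, of n] by simp
    show ?thesis
    proof (intro equalityI subsetI)
      fix f assume "f \<in> I n \<inter> {f \<in> carrier A. \<forall>g\<in>Arr. f g \<noteq> \<zero> \<longrightarrow> \<kappa> g \<in> {}}"
      then show "f \<in> {fzero}" using 1[of f] by blast
    qed (use 2 A_zero_in in auto)
  qed
  then show ?case unfolding stabilizes_def by simp
next
  case (insert s S)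
  let ?P = "\<lambda>S. {f \<in> carrier A. \<forall>g\<in>Arr. f g \<noteq> \<zero> \<longrightarrow> \<kappa> g \<in> S}"
  obtain D :: "nat \<Rightarrow> 'd" where D: "stabilizes D" "\<forall>m n f. D m = D n \<longrightarrow> f \<in> I n \<longrightarrow>
       (\<forall>g\<in>Arr. f g \<noteq> \<zero> \<longrightarrow> \<kappa> g \<in> insert s S) \<longrightarrow>
       (\<exists>h\<in>I m. (\<forall>g\<in>Arr. h g \<noteq> \<zero> \<longrightarrow> \<kappa> g \<in> insert s S) \<and> (\<forall>g\<in>Arr. \<kappa> g = s \<longrightarrow> f g = h g))"
    using step[OF insert.hyps(2)] by blast
  show ?case
  proof (rule A.stabilizes_step[where D = D and P = "?P S"])
    show "additive_subgroup (I n) A" for n using A.left_ideal_additive[OF I] .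
    fix m n f assume DD: "D m = D n" and f: "f \<in> I n" "f \<in> ?P (insert s S)"
    then obtain h where h: "h \<in> I m" "\<forall>g\<in>Arr. h g \<noteq> \<zero> \<longrightarrow> \<kappa> g \<in> insert s S"
        "\<forall>g\<in>Arr. \<kappa> g = s \<longrightarrow> f g = h g" using D(2) by blast
    have hA: "h \<in> carrier A" using h A.left_ideal_subset[OF I] by auto
    have fh: "f \<ominus>\<^bsub>A\<^esub> h = fplus f (fneg h)" using hA by (simp add: a_minus_def A_uminus)
    have "f \<ominus>\<^bsub>A\<^esub> h \<in> ?P S"
    proof
      have "\<kappa> g \<in> S" if g: "g \<in> Arr" "fplus f (fneg h) g \<noteq> \<zero>" for g
      proof (rule ccontr)
        assume "\<kappa> g \<notin> S"
        have "f g = h g"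
        proof (cases "\<kappa> g = s")
          case False
          then have "f g = \<zero>" "h g = \<zero>" using f(2) h(2) g(1) \<open>\<kappa> g \<notin> S\<close> by auto
          then show ?thesis by simp
        qed (use h g in auto)
        then show False using g hA by (simp add: A_val r_neg)
      qed
      then show "f \<ominus>\<^bsub>A\<^esub> h \<in> carrier A \<and> (\<forall>g\<in>Arr. (f \<ominus>\<^bsub>A\<^esub> h) g \<noteq> \<zero> \<longrightarrow> \<kappa> g \<in> S)"
        using f hA unfolding fh by (auto intro: A_add_in A_uminus_in)
    qed
    then show "\<exists>h\<in>I m \<inter> ?P (insert s S). f \<ominus>\<^bsub>A\<^esub> h \<in> ?P S" using h hA by blast
  qed (use insert c D in auto)
qed

lemma supported_chain_condition:
  assumes fin: "finite (\<kappa> ` Arr)"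
    and step: "\<And>I s S. \<lbrakk>\<And>n. left_ideal (I n) A; chain up I\<rbrakk> \<Longrightarrow>
       \<exists>D :: nat \<Rightarrow> 'd. stabilizes D \<and> (\<forall>m n f. D m = D n \<longrightarrow> f \<in> I n \<longrightarrow>
       (\<forall>g\<in>Arr. f g \<noteq> \<zero> \<longrightarrow> \<kappa> g \<in> insert s S) \<longrightarrow>
       (\<exists>h\<in>I m. (\<forall>g\<in>Arr. h g \<noteq> \<zero> \<longrightarrow> \<kappa> g \<in> insert s S) \<and> (\<forall>g\<in>Arr. \<kappa> g = s \<longrightarrow> f g = h g)))"
  shows "chain_condition up A"
  unfolding chain_condition_def
proof (intro allI impI)
  fix I assume I: "(\<forall>n. left_ideal (I n) A) \<and> chain up I"
  then have "stabilizes (\<lambda>n. I n \<inter> {f \<in> carrier A. \<forall>g\<in>Arr. f g \<noteq> \<zero> \<longrightarrow> \<kappa> g \<in> \<kappa> ` Arr})"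
  proof (intro supported_stabilizes[OF _ _ fin])
    fix s S
    show "\<exists>D :: nat \<Rightarrow> 'd. stabilizes D \<and> (\<forall>m n f. D m = D n \<longrightarrow> f \<in> I n \<longrightarrow>
       (\<forall>g\<in>Arr. f g \<noteq> \<zero> \<longrightarrow> \<kappa> g \<in> insert s S) \<longrightarrow>
       (\<exists>h\<in>I m. (\<forall>g\<in>Arr. h g \<noteq> \<zero> \<longrightarrow> \<kappa> g \<in> insert s S) \<and> (\<forall>g\<in>Arr. \<kappa> g = s \<longrightarrow> f g = h g)))"
      using I by (intro step) auto
  qed (use I in auto)
  moreover have "I n \<inter> {f \<in> carrier A. \<forall>g\<in>Arr. f g \<noteq> \<zero> \<longrightarrow> \<kappa> g \<in> \<kappa> ` Arr} = I n" for n
    using A.left_ideal_subset[of "I n"] I by auto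
  ultimately show "stabilizes I" by simp
qed

lemma chain_condition_of_coefficients:
  assumes R: "chain_condition up R" and fin: "finite Arr"
  shows "chain_condition up A"
proof (rule supported_chain_condition[where \<kappa> = id])
  fix I :: "nat \<Rightarrow> ('a \<Rightarrow> 'r) set" and s S
  assume I: "\<And>n. left_ideal (I n) A" and c: "chain up I"
  let ?P = "{f. \<forall>g\<in>Arr. f g \<noteq> \<zero> \<longrightarrow> id g \<in> insert s S}"
  show "\<exists>D :: nat \<Rightarrow> 'r set. stabilizes D \<and> (\<forall>m n f. D m = D n \<longrightarrow> f \<in> I n \<longrightarrow>
       (\<forall>g\<in>Arr. f g \<noteq> \<zero> \<longrightarrow> id g \<in> insert s S) \<longrightarrow>
       (\<exists>h\<in>I m. (\<forall>g\<in>Arr. h g \<noteq> \<zero> \<longrightarrow> id g \<in> insert s S) \<and> (\<forall>g\<in>Arr. id g = s \<longrightarrow> f g = h g)))"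
  proof (cases "s \<in> Arr")
    case True
    define D where "D X = (\<lambda>f. f s) ` (X \<inter> ?P)" for X :: "('a \<Rightarrow> 'r) set"
    have D: "left_ideal (D (I n)) R" for n
    proof (rule R.left_idealI)
      note sub = A.left_ideal_subset[OF I, of n]
      have val: "f g \<in> carrier R" if "f \<in> I n" "g \<in> Arr" for f g using that sub A_val by auto
      show "D (I n) \<subseteq> carrier R" using val True by (auto simp: D_def)
      show "\<zero> \<in> D (I n)" using A.left_ideal_zero[OF I, of n] True by (auto simp: D_def intro!: image_eqI[of _ _ fzero])
      show "a \<oplus> b \<in> D (I n)" if ab: "a \<in> D (I n)" "b \<in> D (I n)" for a b
      proof -
        obtain f f' where f: "a = f s" "b = f' s" "f \<in> I n" "f' \<in> I n" "f \<in> ?P" "f' \<in> ?P"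
          using ab unfolding D_def by blast
        then have "fplus f f' \<in> I n" using A.left_ideal_add[OF I] by simp
        moreover have "fplus f f' \<in> ?P"
        proof (intro CollectI ballI impI, rule ccontr)
          fix g assume g: "g \<in> Arr" "fplus f f' g \<noteq> \<zero>" "id g \<notin> insert s S"
          then have "f g = \<zero>" "f' g = \<zero>" using f by auto
          then show False using g by simp
        qed
        ultimately show ?thesis using True f by (auto simp: D_def intro!: image_eqI[of _ _ "fplus f f'"])
      qed
      show "\<ominus> a \<in> D (I n)" if ab: "a \<in> D (I n)" for a
      proof -
        obtain f where f: "a = f s" "f \<in> I n" "f \<in> ?P" using ab unfolding D_def by blast
        then have "fneg f \<in> I n" using A.left_ideal_neg[OF I f(2)] A_uminus[OF subsetD[OF sub f(2)]] by simp
        moreover have "fneg f \<in> ?P"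
        proof (intro CollectI ballI impI, rule ccontr)
          fix g assume g: "g \<in> Arr" "fneg f g \<noteq> \<zero>" "id g \<notin> insert s S"
          then have "f g = \<zero>" using f by auto
          then show False using g by simp
        qed
        ultimately show ?thesis using True f by (auto simp: D_def intro!: image_eqI[of _ _ "fneg f"])
      qed
      show "r \<otimes> a \<in> D (I n)" if r: "r \<in> carrier R" and ab: "a \<in> D (I n)" for r a
      proof -
        obtain f where f: "a = f s" "f \<in> I n" "f \<in> ?P" using ab unfolding D_def by blast
        then have "fscale r f \<in> I n" using left_ideal_scale[OF I r] by simp
        moreover have "fscale r f \<in> ?P"
        proof (intro CollectI ballI impI, rule ccontr)
          fix g assume g: "g \<in> Arr" "fscale r f g \<noteq> \<zero>" "id g \<notin> insert s S"
          then have "f g = \<zero>" using f by auto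
          then show False using g r by simp
        qed
        ultimately show ?thesis using True f by (auto simp: D_def intro!: image_eqI[of _ _ "fscale r f"])
      qed
    qed
    have "chain up (\<lambda>n. D (I n))" by (rule chain_image[OF c]) (auto simp: D_def)
    then have "stabilizes (\<lambda>n. D (I n))" by (intro chain_conditionD[OF R] D)
    moreover have "\<exists>h\<in>I m. h \<in> ?P \<and> (\<forall>g\<in>Arr. id g = s \<longrightarrow> f g = h g)"
      if "D (I m) = D (I n)" "f \<in> I n" "f \<in> ?P" for m n f
    proof -
      have "f s \<in> D (I m)" using that by (auto simp: D_def)
      then show ?thesis by (auto simp: D_def)
    qed
    ultimately show ?thesis by (intro exI[of _ "\<lambda>n. D (I n)"]) blast
  next
    case False
    \<comment> \<open>No arrow carries the label \<open>s\<close>; the zero function is a match and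
      a constant \<open>D\<close> will do.\<close>
    have "\<exists>h\<in>I m. (\<forall>g\<in>Arr. h g \<noteq> \<zero> \<longrightarrow> id g \<in> insert s S) \<and> (\<forall>g\<in>Arr. id g = s \<longrightarrow> f g = h g)" for m f
      using A.left_ideal_zero[OF I, of m] False by (intro bexI[of _ fzero]) auto
    then show ?thesis by (intro exI[of _ "\<lambda>_. {}"]) (simp add: stabilizes_def)
  qed
qed (simp add: fin)

text \<open>An ideal \<open>J\<close> of \<open>R\<close> gives the left ideal of functions with
  values in \<open>J\<close>. Point masses at an identity arrow recover \<open>J\<close>, which is
  where an object is used.\<close>

lemma chain_condition_coefficients:
  assumes A: "chain_condition up A" and ne: "Obj \<noteq> {}"
  shows "chain_condition up R"
  unfolding chain_condition_def
proof (intro allI impI)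
  fix J assume J: "(\<forall>n. left_ideal (J n) R) \<and> chain up J"
  obtain x where x: "x \<in> Obj" using ne by blast
  define F where "F X = {f \<in> carrier A. \<forall>g\<in>Arr. f g \<in> X}" for X
  have FJ: "left_ideal (F (J n)) A" for n
  proof -
    have Jn: "left_ideal (J n) R" using J by blast
    note [simp] = R.left_ideal_zero[OF Jn] R.left_ideal_add[OF Jn] R.left_ideal_neg[OF Jn] R.left_ideal_mult[OF Jn]
    show ?thesis
    proof (rule left_ideal_AI)
      show "conv (mono c a) f \<in> F (J n)" if "c \<in> carrier R" "a \<in> Arr" "f \<in> F (J n)" for c a f
        using that conv_mono_in[of c a f] by (auto simp: F_def conv_mono_left A_funcset)
    qed (auto simp: F_def A_zero_in A_add_in A_uminus_in)
  qed
  have J_eq: "J n = (\<lambda>X. {r \<in> carrier R. mono r (unt x) \<in> X}) (F (J n))" for n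
  proof -
    have Jn: "left_ideal (J n) R" using J by blast
    show ?thesis using R.left_ideal_zero[OF Jn] R.left_ideal_subset[OF Jn] x
      by (auto simp: F_def) (auto simp: mono_def dest: bspec[of _ _ "unt x"])
  qed
  have "chain up (\<lambda>n. F (J n))"
    by (rule chain_image[where I = J and F = F]) (use J in \<open>auto simp: F_def\<close>)
  then have "stabilizes (\<lambda>n. F (J n))" by (intro chain_conditionD[OF A] FJ)
  then show "stabilizes J" by (rule stabilizes_inverse[where F = F]) (rule J_eq)
qed

text \<open>A nonempty hom-set is a torsor under the isotropy group at its source, so a base arrow
  \<open>t\<close> turns functions on it into functions on that group. The filtration admits one
  hom-set at a time, and the invariant is the left ideal of these restrictions.\<close>

lemma chain_condition_of_isotropy:
  assumes C: "\<And>x. x \<in> Obj \<Longrightarrow> chain_condition up (group_algebra R (isotropy_group G x))"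
  shows "chain_condition up A"
proof (rule supported_chain_condition[where \<kappa> = "\<lambda>g. (tgt g, src g)"])
  have "(\<lambda>g. (tgt g, src g)) ` Arr \<subseteq> Obj \<times> Obj" by auto
  then show "finite ((\<lambda>g. (tgt g, src g)) ` Arr)" by (rule finite_subset) (simp add: finite_objects)
  fix I :: "nat \<Rightarrow> ('a \<Rightarrow> 'r) set" and s :: "'o \<times> 'o" and S
  assume I: "\<And>n. left_ideal (I n) A" and c: "chain up I"
  let ?P = "{f. \<forall>g\<in>Arr. f g \<noteq> \<zero> \<longrightarrow> (tgt g, src g) \<in> insert s S}"
  show "\<exists>D :: nat \<Rightarrow> ('a \<Rightarrow> 'r) set. stabilizes D \<and> (\<forall>m n f. D m = D n \<longrightarrow> f \<in> I n \<longrightarrow>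
       (\<forall>g\<in>Arr. f g \<noteq> \<zero> \<longrightarrow> (tgt g, src g) \<in> insert s S) \<longrightarrow>
       (\<exists>h\<in>I m. (\<forall>g\<in>Arr. h g \<noteq> \<zero> \<longrightarrow> (tgt g, src g) \<in> insert s S) \<and>
          (\<forall>g\<in>Arr. (tgt g, src g) = s \<longrightarrow> f g = h g)))"
  proof (cases "\<exists>t\<in>Arr. (tgt t, src t) = s")
    case True
    then obtain t where t: "t \<in> Arr" "s = (tgt t, src t)" by auto
    define x where "x = src t"
    have x: "x \<in> Obj" using t by (simp add: x_def)
    let ?C = "group_algebra R (isotropy_group G x)"
    define D where "D X = translate x t ` (X \<inter> ?P)" for X
    have D: "left_ideal (D (I n)) ?C" for n
    proof (rule left_ideal_isotI[OF x])
      note sub = A.left_ideal_subset[OF I, of n]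
      show "D (I n) \<subseteq> carrier ?C" using sub translate_in t by (auto simp: D_def x_def)
      have "translate x t fzero = (\<lambda>h\<in>isot x. \<zero>)"
        using t by (intro extensionalityI[of _ "isot x"]) (auto simp: translate_def x_def)
      then show "(\<lambda>h\<in>isot x. \<zero>) \<in> D (I n)"
        using A.left_ideal_zero[OF I, of n] by (auto simp: D_def intro!: image_eqI[of _ _ fzero])
      show "(\<lambda>h\<in>isot x. a h \<oplus> b h) \<in> D (I n)" if ab: "a \<in> D (I n)" "b \<in> D (I n)" for a b
      proof -
        obtain f f' where f: "a = translate x t f" "b = translate x t f'" "f \<in> I n" "f' \<in> I n" "f \<in> ?P" "f' \<in> ?P"
          using ab unfolding D_def by blast
        then have "fplus f f' \<in> I n" using A.left_ideal_add[OF I] by simp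
        moreover have "fplus f f' \<in> ?P"
        proof (intro CollectI ballI impI, rule ccontr)
          fix g assume g: "g \<in> Arr" "fplus f f' g \<noteq> \<zero>" "(tgt g, src g) \<notin> insert s S"
          then have "f g = \<zero>" "f' g = \<zero>" using f by auto
          then show False using g by simp
        qed
        moreover have "(\<lambda>h\<in>isot x. a h \<oplus> b h) = translate x t (fplus f f')"
          using t by (intro extensionalityI[of _ "isot x"]) (auto simp: translate_def x_def f)
        ultimately show ?thesis by (auto simp: D_def)
      qed
      show "(\<lambda>h\<in>isot x. \<ominus> a h) \<in> D (I n)" if ab: "a \<in> D (I n)" for a
      proof -
        obtain f where f: "a = translate x t f" "f \<in> I n" "f \<in> ?P" using ab unfolding D_def by blast
        then have "fneg f \<in> I n" using A.left_ideal_neg[OF I f(2)] A_uminus[OF subsetD[OF sub f(2)]] by simp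
        moreover have "fneg f \<in> ?P"
        proof (intro CollectI ballI impI, rule ccontr)
          fix g assume g: "g \<in> Arr" "fneg f g \<noteq> \<zero>" "(tgt g, src g) \<notin> insert s S"
          then have "f g = \<zero>" using f by auto
          then show False using g by simp
        qed
        moreover have "(\<lambda>h\<in>isot x. \<ominus> a h) = translate x t (fneg f)"
          using t by (intro extensionalityI[of _ "isot x"]) (auto simp: translate_def x_def f)
        ultimately show ?thesis by (auto simp: D_def)
      qed
      show "(\<lambda>h\<in>isot x. r \<otimes> a (inv\<^bsub>isotropy_group G x\<^esub> b \<diamondop> h)) \<in> D (I n)"
        if r: "r \<in> carrier R" "b \<in> isot x" and ab: "a \<in> D (I n)" for r b a
      proof -
        obtain f where f: "a = translate x t f" "f \<in> I n" "f \<in> ?P" using ab unfolding D_def by blast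
        have fA: "f \<in> carrier A" using f sub by auto
        \<comment> \<open>Conjugation by \<open>t\<close> turns the shift by \<open>b\<close> on the
          isotropy group into left multiplication by a loop at \<open>tgt t\<close>. Convolution
          with it annihilates all other ranges and keeps range and source where it acts, so the set
          of labels in use does not grow.\<close>
        define k where "k = t \<diamondop> b \<diamondop> ivt t"
        have k: "k \<in> Arr" "src k = tgt t" "tgt k = tgt t" "ivt k = t \<diamondop> ivt b \<diamondop> ivt t"
          using t r by (auto simp: k_def x_def inv_comp comp_assoc)
        have kg: "ivt k \<diamondop> g \<in> Arr" "src (ivt k \<diamondop> g) = src g" "tgt (ivt k \<diamondop> g) = tgt g"
          if "g \<in> Arr" "tgt g = tgt t" for g using that k(1-3) by auto
        have 1: "conv (mono r k) f \<in> I n"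
          using A.left_ideal_mult[OF I mono_in_A[OF r(1)] f(2), of k] by simp
        have "conv (mono r k) f \<in> ?P"
        proof (intro CollectI ballI impI, rule ccontr)
          fix g assume g: "g \<in> Arr" "conv (mono r k) f g \<noteq> \<zero>" "(tgt g, src g) \<notin> insert s S"
          then have T: "tgt g = tgt t" "conv (mono r k) f g = r \<otimes> f (ivt k \<diamondop> g)"
            using k r fA by (auto simp: conv_mono_left A_funcset split: if_splits)
          then have "f (ivt k \<diamondop> g) = \<zero>" using f(3) g kg[OF g(1) T(1)] by auto
          then show False using g T r by simp
        qed
        moreover have "(\<lambda>h\<in>isot x. r \<otimes> a (inv\<^bsub>isotropy_group G x\<^esub> b \<diamondop> h)) = translate x t (conv (mono r k) f)"
        proof (rule extensionalityI[of _ "isot x"])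
          fix h assume h: "h \<in> isot x"
          have "ivt k \<diamondop> (t \<diamondop> h) = t \<diamondop> (ivt b \<diamondop> h)"
            unfolding k(4) using t r h by (simp add: comp_assoc x_def)
          then show "(\<lambda>h\<in>isot x. r \<otimes> a (inv\<^bsub>isotropy_group G x\<^esub> b \<diamondop> h)) h
              = translate x t (conv (mono r k) f) h"
            using h t k(1-3) r fA
            by (simp add: translate_def f(1) x_def[symmetric] conv_mono_left A_funcset isotropy_inv[OF x])
        qed (auto simp: translate_def)
        ultimately show ?thesis using 1 by (auto simp: D_def)
      qed
    qed
    have "chain up (\<lambda>n. D (I n))" by (rule chain_image[OF c]) (auto simp: D_def)
    then have "stabilizes (\<lambda>n. D (I n))" by (intro chain_conditionD[OF C[OF x]] D)
    moreover have "\<exists>h\<in>I m. h \<in> ?P \<and> (\<forall>g\<in>Arr. (tgt g, src g) = s \<longrightarrow> f g = h g)"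
      if "D (I m) = D (I n)" "f \<in> I n" "f \<in> ?P" for m n f
    proof -
      have "translate x t f \<in> D (I m)" using that by (auto simp: D_def)
      then obtain h where h: "h \<in> I m" "h \<in> ?P" "translate x t f = translate x t h" by (auto simp: D_def)
      have "f g = h g" if g: "g \<in> Arr" "(tgt g, src g) = s" for g
      proof -
        have "ivt t \<diamondop> g \<in> isot x" using g t by (auto simp: isot_def x_def)
        then have "f (t \<diamondop> (ivt t \<diamondop> g)) = h (t \<diamondop> (ivt t \<diamondop> g))"
          using fun_cong[OF h(3), of "ivt t \<diamondop> g"] by (simp add: translate_def)
        then show ?thesis using g t by simp
      qed
      then show ?thesis using h by blast
    qed
    ultimately show ?thesis by (intro exI[of _ "\<lambda>n. D (I n)"]) blast
  next
    case False
    have "\<exists>h\<in>I m. (\<forall>g\<in>Arr. h g \<noteq> \<zero> \<longrightarrow> (tgt g, src g) \<in> insert s S) \<and>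
        (\<forall>g\<in>Arr. (tgt g, src g) = s \<longrightarrow> f g = h g)" for m f
      using A.left_ideal_zero[OF I, of m] False by (intro bexI[of _ fzero]) auto
    then show ?thesis by (intro exI[of _ "\<lambda>_. {}"]) (simp add: stabilizes_def)
  qed
qed

end

section \<open>Artinian group algebras\<close>

context group_ring
begin

abbreviation "CA \<equiv> fs_algebra R (group_groupoid H)"

text \<open>The augmentation homomorphism to \<open>R\<close>; \<open>supp_sum\<close> is used
  because the group may be infinite.\<close>

definition aug where "aug f = supp_sum R f (carrier H)"

text \<open>The canonical involution of a group algebra; commutativity of \<open>R\<close> makes it
  reverse products.\<close>

definition star where "star f = (\<lambda>g\<in>carrier H. f (inv\<^bsub>H\<^esub> g))"

lemma aug_eq:
  assumes "f \<in> carrier CA" "finite B" "B \<subseteq> carrier H" "{g \<in> carrier H. f g \<noteq> \<zero>} \<subseteq> B"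
  shows "aug f = (\<Oplus>g\<in>B. f g)"
  unfolding aug_def
  by (rule C.supp_sum_eq) (use assms C.A_val in \<open>auto\<close>)

lemma aug_closed: "f \<in> carrier CA \<Longrightarrow> aug f \<in> carrier R"
  using C.A_val by (subst aug_eq[OF _ C.A_finite[simplified]]) (auto intro!: finsum_closed)

lemma aug_add:
  assumes "f \<in> carrier CA" "f' \<in> carrier CA"
  shows "aug (C.fplus f f') = aug f \<oplus> aug f'"
proof -
  define B where "B = {g \<in> carrier H. f g \<noteq> \<zero>} \<union> {g \<in> carrier H. f' g \<noteq> \<zero>}"
  have B: "finite B" "B \<subseteq> carrier H" using C.A_finite assms by (auto simp: B_def)
  have v: "f g \<in> carrier R" "f' g \<in> carrier R" if "g \<in> B" for g
    using that B C.A_val assms by auto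
  have "aug (C.fplus f f') = (\<Oplus>g\<in>B. C.fplus f f' g)"
    by (rule aug_eq[OF C.A_add_in[OF assms] B]) (auto simp: B_def)
  also have "\<dots> = (\<Oplus>g\<in>B. f g \<oplus> f' g)" by (rule finsum_cong') (use v B in auto)
  also have "\<dots> = (\<Oplus>g\<in>B. f g) \<oplus> (\<Oplus>g\<in>B. f' g)" by (rule finsum_addf) (use v in auto)
  also have "\<dots> = aug f \<oplus> aug f'"
    using aug_eq[OF assms(1) B] aug_eq[OF assms(2) B] by (simp add: B_def)
  finally show ?thesis .
qed

lemma aug_mono:
  assumes "c \<in> carrier R" "a \<in> carrier H"
  shows "aug (C.mono c a) = c"
proof -
  have "aug (C.mono c a) = (\<Oplus>g\<in>{a}. C.mono c a g)"
    by (rule aug_eq) (use assms C.mono_in_A in \<open>auto simp: C.mono_def\<close>)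
  then show ?thesis using assms by (simp add: C.mono_def)
qed

lemma aug_zero: "aug C.fzero = \<zero>"
  using aug_mono[of \<zero> "\<one>\<^bsub>H\<^esub>"] by (simp add: C.mono_def C.fzero_def restrict_def if_distrib cong: if_cong)

lemma aug_conv_mono:
  assumes "f \<in> carrier CA" "c \<in> carrier R" "a \<in> carrier H"
  shows "aug (C.conv (C.mono c a) f) = c \<otimes> aug f"
  using assms
proof (induction rule: C.A_induct)
  case zero
  have "C.conv (C.mono c a) C.fzero = C.fzero"
    using C.A.mult_zero[of "C.mono c a"] zero C.mono_in_A by simp
  then show ?case using zero by (simp add: aug_zero)
next
  case (add f c' b)
  have m: "C.mono c a \<in> carrier CA" "C.mono c' b \<in> carrier CA" using add by (auto intro: C.mono_in_A)
  have "C.conv (C.mono c a) (C.fplus f (C.mono c' b))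
     = C.fplus (C.conv (C.mono c a) f) (C.mono (c \<otimes> c') (a \<otimes>\<^bsub>H\<^esub> b))"
    using C.A_distr(2)[OF m(1) add.hyps(1) m(2)] C.conv_mono_mono[of c c' a b] add by simp
  moreover have "C.conv (C.mono c a) f \<in> carrier CA" "C.mono (c \<otimes> c') (a \<otimes>\<^bsub>H\<^esub> b) \<in> carrier CA"
    using add m C.conv_in by auto
  ultimately show ?case using add m by (simp add: aug_add aug_mono aug_closed r_distr)
qed

lemma aug_conv:
  assumes "f \<in> carrier CA" "f' \<in> carrier CA"
  shows "aug (C.conv f f') = aug f \<otimes> aug f'"
  using assms
proof (induction rule: C.A_induct)
  case zero
  have "C.conv C.fzero f' = C.fzero" using C.conv_zero_left zero by simp
  then show ?case using zero by (simp add: aug_zero aug_closed)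
next
  case (add f c b)
  have m: "C.mono c b \<in> carrier CA" using add by (auto intro: C.mono_in_A)
  have "C.conv f f' \<in> carrier CA" "C.conv (C.mono c b) f' \<in> carrier CA" using add m C.conv_in by auto
  then show ?case using add m C.A_distr(1)[OF add.hyps(1) m add.prems] aug_conv_mono[of f' c b]
    by (simp add: aug_add aug_mono aug_closed l_distr)
qed

lemma star_in:
  assumes f: "f \<in> carrier CA"
  shows "star f \<in> carrier CA"
proof (rule C.A_carrierI[of "(\<lambda>g. inv\<^bsub>H\<^esub> g) ` {g \<in> carrier H. f g \<noteq> \<zero>}"])
  show "finite ((\<lambda>g. inv\<^bsub>H\<^esub> g) ` {g \<in> carrier H. f g \<noteq> \<zero>})" using C.A_finite[OF f] by simp
  fix g assume "g \<in> topspace (arrows (group_groupoid H))"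
  then have g: "g \<in> carrier H" by simp
  then have "g = inv\<^bsub>H\<^esub> (inv\<^bsub>H\<^esub> g)" by simp
  then show "star f g = \<zero>" if "g \<notin> (\<lambda>g. inv\<^bsub>H\<^esub> g) ` {g \<in> carrier H. f g \<noteq> \<zero>}"
  proof -
    have "inv\<^bsub>H\<^esub> g \<notin> {g \<in> carrier H. f g \<noteq> \<zero>}" using that \<open>g = _\<close> by blast
    then show ?thesis using g by (simp add: star_def)
  qed
qed (use f C.A_val in \<open>auto simp: star_def\<close>)

lemma star_star: "f \<in> carrier CA \<Longrightarrow> star (star f) = f"
proof (rule C.A_eqI)
  assume "f \<in> carrier CA"
  then show "star (star f) \<in> carrier CA" by (intro star_in)
qed (auto simp: star_def)

lemma star_conv_mono:
  assumes f: "f \<in> carrier CA" and c: "c \<in> carrier R" "a \<in> carrier H"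
  shows "star (C.conv (C.mono c a) f) = C.conv (star f) (star (C.mono c a))"
proof (rule C.A_eqI)
  have m: "C.mono c a \<in> carrier CA" using c by (auto intro: C.mono_in_A)
  show "star (C.conv (C.mono c a) f) \<in> carrier CA" "C.conv (star f) (star (C.mono c a)) \<in> carrier CA"
    using f m by (auto intro: star_in C.conv_in)
  fix g assume "g \<in> topspace (arrows (group_groupoid H))"
  then have g: "g \<in> carrier H" by simp
  have "inv\<^bsub>H\<^esub> h = a \<longleftrightarrow> h = inv\<^bsub>H\<^esub> a" if "h \<in> carrier H" for h using that c by auto
  then have sm: "star (C.mono c a) = C.mono c (inv\<^bsub>H\<^esub> a)"
    by (intro extensionalityI[of _ "carrier H"]) (auto simp: star_def C.mono_def)
  have v: "f (inv\<^bsub>H\<^esub> (g \<otimes>\<^bsub>H\<^esub> a)) \<in> carrier R" using C.A_val[OF f] g c by simp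
  have "star (C.conv (C.mono c a) f) g = c \<otimes> f (inv\<^bsub>H\<^esub> a \<otimes>\<^bsub>H\<^esub> inv\<^bsub>H\<^esub> g)"
    using g c C.conv_mono_left[of c a f "inv\<^bsub>H\<^esub> g"] C.A_funcset[OF f] by (simp add: star_def)
  also have "\<dots> = star f (g \<otimes>\<^bsub>H\<^esub> a) \<otimes> c"
    using g c v by (simp add: star_def H.inv_mult_group m_comm)
  also have "\<dots> = C.conv (star f) (star (C.mono c a)) g"
    unfolding sm using g c C.conv_mono_right[of c "inv\<^bsub>H\<^esub> a" "star f" g] C.A_funcset[OF star_in[OF f]] by simp
  finally show "star (C.conv (C.mono c a) f) g = C.conv (star f) (star (C.mono c a)) g" .
qed

lemma star_conv:
  assumes "f \<in> carrier CA" "f' \<in> carrier CA"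
  shows "star (C.conv f f') = C.conv (star f') (star f)"
  using assms
proof (induction rule: C.A_induct)
  case zero
  have z: "star C.fzero = C.fzero" by (intro extensionalityI[of _ "carrier H"]) (auto simp: star_def C.fzero_def)
  have "C.conv (star f') C.fzero = C.fzero" using C.A.mult_zero[OF star_in[OF zero]] by simp
  moreover have "C.conv C.fzero f' = C.fzero" using C.conv_zero_left zero by simp
  ultimately show ?case by (simp add: z)
next
  case (add f c b)
  have m: "C.mono c b \<in> carrier CA" using add by (auto intro: C.mono_in_A)
  have star_add: "star (C.fplus x y) = C.fplus (star x) (star y)" for x y
    by (intro extensionalityI[of _ "carrier H"]) (auto simp: star_def C.fplus_def)
  show ?case
    using add m C.A_distr(1)[OF add.hyps(1) m add.prems] star_conv_mono[of f' c b]
      C.A_distr(2)[OF star_in[OF add.prems] star_in[OF add.hyps(1)] star_in[OF m]]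
    by (simp add: star_add)
qed

text \<open>The coefficient at the identity is a trace: two group elements multiply to the identity
  in one order exactly when they do in the other, and \<open>R\<close> is commutative.\<close>

lemma trace_comm:
  assumes "f \<in> carrier CA" "f' \<in> carrier CA"
  shows "C.conv f f' \<one>\<^bsub>H\<^esub> = C.conv f' f \<one>\<^bsub>H\<^esub>"
  using assms
proof (induction rule: C.A_induct)
  case zero
  have "C.conv C.fzero f' = C.fzero" "C.conv f' C.fzero = C.fzero"
    using C.conv_zero_left zero C.A.mult_zero[OF zero] by simp_all
  then show ?case by simp
next
  case (add f c b)
  have m: "C.mono c b \<in> carrier CA" using add by (auto intro: C.mono_in_A)
  have v: "f' (inv\<^bsub>H\<^esub> b) \<in> carrier R" using C.A_val[OF add.prems] add by simp
  have "C.conv (C.mono c b) f' \<one>\<^bsub>H\<^esub> = C.conv f' (C.mono c b) \<one>\<^bsub>H\<^esub>"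
    using add v C.conv_mono_left[of c b f' "\<one>\<^bsub>H\<^esub>"] C.conv_mono_right[of c b f' "\<one>\<^bsub>H\<^esub>"] C.A_funcset[OF add.prems]
    by (simp add: m_comm)
  then show ?case
    using add m C.A_distr(1)[OF add.hyps(1) m add.prems] C.A_distr(2)[OF add.prems add.hyps(1) m] by simp
qed

lemma scal_eq_mono: "C.scal c = C.mono c \<one>\<^bsub>H\<^esub>"
  by (simp add: C.scal_def C.mono_def UNIV_unit)

text \<open>Connell's theorem: the right annihilator of the augmentation ideal consists of the functions
  invariant under the group, and an invariant function of finite support vanishes if the group is infinite.\<close>

theorem artinian_group_algebra_finite:
  assumes art: "artinian (group_algebra R H)" and nt: "\<one> \<noteq> \<zero>"
  shows "finite (carrier H)"
proof -
  let ?A = CA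
  define P where "P = {x \<in> carrier ?A. aug x = \<zero>}"
  have P: "left_ideal P ?A"
  proof (rule C.left_ideal_AI)
    show "C.fneg f \<in> P" if "f \<in> P" for f
    proof -
      have f: "f \<in> carrier ?A" "aug f = \<zero>" using that by (auto simp: P_def)
      have "C.fplus (C.fneg f) f = C.fzero" using C.A.l_neg[OF f(1)] C.A_uminus[OF f(1)] by simp
      then show ?thesis
        using f aug_add[OF C.A_uminus_in[OF f(1)] f(1)] C.A_uminus_in[OF f(1)] aug_closed
        by (simp add: P_def aug_zero)
    qed
  qed (use C.A_zero_in C.A_add_in C.conv_mono_in in
      \<open>auto simp: P_def aug_zero aug_add aug_conv_mono\<close>)
  obtain w where w: "w \<in> carrier ?A" "w \<noteq> C.fzero" "\<And>x. x \<in> P \<Longrightarrow> C.conv x w = C.fzero"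
  proof (rule C.A.artinian_annihilator_nonzero[where \<sigma> = star and tr = "\<lambda>f. f \<one>\<^bsub>H\<^esub>" and P = P])
    show "artinian ?A" using art by (simp only: group_algebra_eq)
    show "x \<otimes>\<^bsub>?A\<^esub> a \<in> P" if "x \<in> P" "a \<in> carrier ?A" for x a
      using that C.conv_in by (auto simp: P_def aug_conv aug_closed)
    show "\<one>\<^bsub>?A\<^esub> \<notin> P" using nt aug_mono[of \<one> "\<one>\<^bsub>H\<^esub>"] by (simp add: P_def scal_eq_mono)
    fix M assume M: "left_ideal M ?A" "M \<noteq> {\<zero>\<^bsub>?A\<^esub>}"
    then obtain m where m: "m \<in> M" "m \<noteq> C.fzero" using C.A.left_ideal_zero[OF M(1)] by auto
    have mc: "m \<in> carrier ?A" using m C.A.left_ideal_subset[OF M(1)] by auto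
    have "\<exists>h\<in>carrier H. m h \<noteq> \<zero>"
    proof (rule ccontr)
      assume *: "\<not> ?thesis"
      have "m = C.fzero" by (rule C.A_eqI) (use * mc C.A_zero_in in auto)
      then show False using m by simp
    qed
    then obtain h where h: "h \<in> carrier H" "m h \<noteq> \<zero>" by blast
    \<comment> \<open>Nondegeneracy of the trace: a translation inside the left ideal moves a
      nonzero coefficient from \<open>h\<close> to the identity.\<close>
    have "C.conv (C.mono \<one> (inv\<^bsub>H\<^esub> h)) m \<in> M"
      using C.A.left_ideal_mult[OF M(1) C.mono_in_A[OF R.one_closed] m(1), of "inv\<^bsub>H\<^esub> h"] by simp
    moreover have "C.conv (C.mono \<one> (inv\<^bsub>H\<^esub> h)) m \<one>\<^bsub>H\<^esub> = m h"
      using h mc C.conv_mono_left[of \<one> "inv\<^bsub>H\<^esub> h" m "\<one>\<^bsub>H\<^esub>"] C.A_funcset[OF mc] C.A_val[OF mc] by simp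
    ultimately show "\<exists>m\<in>M. m \<one>\<^bsub>H\<^esub> \<noteq> \<zero>\<^bsub>?A\<^esub> \<one>\<^bsub>H\<^esub>" using h(2) by (intro bexI) auto
  qed (use P star_in star_star star_conv trace_comm that in auto)
  have const: "w g = w \<one>\<^bsub>H\<^esub>" if g: "g \<in> carrier H" for g
  proof -
    \<comment> \<open>The sum of \<open>?u\<close> and \<open>?v\<close> is the inverse of
      \<open>g\<close> minus the identity, which has augmentation zero. Its product with
      \<open>w\<close> vanishes, and evaluation at the identity compares \<open>w\<close> at
      \<open>g\<close> with \<open>w\<close> at the identity.\<close>
    let ?u = "C.mono \<one> (inv\<^bsub>H\<^esub> g)" and ?v = "C.mono (\<ominus> \<one>) \<one>\<^bsub>H\<^esub>"
    have uv: "?u \<in> carrier ?A" "?v \<in> carrier ?A" by (auto intro: C.mono_in_A)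
    have uvP: "C.fplus ?u ?v \<in> P"
      using uv C.A_add_in g by (simp add: P_def aug_add aug_mono R.r_neg)
    have "C.fplus (C.conv ?u w) (C.conv ?v w) = C.fzero"
      using w(3)[OF uvP] C.A_distr(1)[OF uv w(1)] by simp
    then have "C.fplus (C.conv ?u w) (C.conv ?v w) \<one>\<^bsub>H\<^esub> = \<zero>"
      by (rule fun_cong[THEN trans]) simp
    then have "w g \<oplus> \<ominus> (w \<one>\<^bsub>H\<^esub>) = \<zero>"
      using g C.conv_mono_left[of \<one> "inv\<^bsub>H\<^esub> g" w "\<one>\<^bsub>H\<^esub>"] C.conv_mono_left[of "\<ominus> \<one>" "\<one>\<^bsub>H\<^esub>" w "\<one>\<^bsub>H\<^esub>"]
        C.A_funcset[OF w(1)] C.A_val[OF w(1)] by (simp add: R.l_minus)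
    then show ?thesis using R.minus_equality[of "w g" "\<ominus> (w \<one>\<^bsub>H\<^esub>)"] C.A_val[OF w(1)] g by simp
  qed
  have "w \<one>\<^bsub>H\<^esub> \<noteq> \<zero>"
  proof
    assume 0: "w \<one>\<^bsub>H\<^esub> = \<zero>"
    have "w = C.fzero"
    proof (rule C.A_eqI[OF w(1) C.A_zero_in])
      show "w g = C.fzero g" if "g \<in> topspace (arrows (group_groupoid H))" for g
        using const[of g] 0 that by simp
    qed
    then show False using w(2) by simp
  qed
  then have "carrier H \<subseteq> {g \<in> carrier H. w g \<noteq> \<zero>}" by (auto dest: const)
  then show ?thesis by (rule finite_subset) (use C.A_finite[OF w(1)] in simp)
qed

end

context finite_groupoid_ring
begin

lemma finite_hom:
  assumes "finite (isot x)"
  shows "finite {g \<in> Arr. src g = x \<and> tgt g = y}"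
proof (cases "\<exists>t\<in>Arr. src t = x \<and> tgt t = y")
  case True
  then obtain t where t: "t \<in> Arr" "src t = x" "tgt t = y" by blast
  have "{g \<in> Arr. src g = x \<and> tgt g = y} \<subseteq> (\<lambda>h. t \<diamondop> h) ` isot x"
  proof
    fix g assume "g \<in> {g \<in> Arr. src g = x \<and> tgt g = y}"
    then have "g = t \<diamondop> (ivt t \<diamondop> g)" "ivt t \<diamondop> g \<in> isot x" using t by auto
    then show "g \<in> (\<lambda>h. t \<diamondop> h) ` isot x" by blast
  qed
  then show ?thesis using assms by (auto intro: finite_subset)
next
  case False
  then have "{g \<in> Arr. src g = x \<and> tgt g = y} = {}" by auto
  then show ?thesis by (metis finite.emptyI)
qed

lemma finite_arrows:
  assumes "\<And>x. x \<in> Obj \<Longrightarrow> finite (isot x)"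
  shows "finite Arr"
proof -
  have "Arr \<subseteq> (\<Union>x\<in>Obj. \<Union>y\<in>Obj. {g \<in> Arr. src g = x \<and> tgt g = y})" by auto
  moreover have "finite (\<Union>x\<in>Obj. \<Union>y\<in>Obj. {g \<in> Arr. src g = x \<and> tgt g = y})"
    using finite_objects finite_hom assms by blast
  ultimately show ?thesis by (rule finite_subset)
qed

lemma artinian_imp_finite:
  assumes art: "artinian A" and nt: "\<one> \<noteq> \<zero>"
  shows "finite Arr"
proof (rule finite_arrows)
  fix x assume x: "x \<in> Obj"
  have "artinian (group_algebra R (isotropy_group G x))"
    using chain_condition_isotropy[of False x] art x by (simp add: artinian_iff)
  then have "finite (carrier (isotropy_group G x))"
    by (rule group_ring.artinian_group_algebra_finite[OF group_ring_isotropy[OF x] _ nt])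
  then show "finite (isot x)" by simp
qed

end

section \<open>Von Neumann regularity\<close>

context finite_groupoid_ring
begin

text \<open>Evaluating at an identity arrow, with scalars on both sides, turns a quasi-inverse of
  \<open>scal r\<close> into one of \<open>r\<close>.\<close>

lemma regular_coefficients:
  assumes reg: "von_neumann_regular A" and ne: "Obj \<noteq> {}"
  shows "von_neumann_regular R"
  unfolding von_neumann_regular_def
proof
  fix r assume r: "r \<in> carrier R"
  obtain x where x: "x \<in> Obj" using ne by blast
  obtain b where b: "b \<in> carrier A" "scal r \<otimes>\<^bsub>A\<^esub> b \<otimes>\<^bsub>A\<^esub> scal r = scal r"
    using reg r unfolding von_neumann_regular_def by blast
  have c: "conv (scal r) b \<in> carrier A" using r b by (auto intro: conv_in)
  have "r \<otimes> b (unt x) \<otimes> r = conv (conv (scal r) b) (scal r) (unt x)"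
    using x r b(1) c by (simp add: conv_scal_right conv_scal_left A_funcset)
  also have "\<dots> = r" using b x by (simp add: scal_def)
  finally show "\<exists>b\<in>carrier R. r \<otimes> b \<otimes> r = r" using A_val[OF b(1)] x by auto
qed

text \<open>Let \<open>s\<close> be the sum of the isotropy group at \<open>x\<close>. For every
  \<open>b\<close> the product of \<open>s\<close>, \<open>b\<close> and \<open>s\<close> is a
  scalar multiple of the square of \<open>s\<close>, whose value at the identity is the group order.
  Regularity gives a \<open>b\<close> for which this product is \<open>s\<close>, and comparing the
  values at the identity inverts the order.\<close>

lemma regular_order_unit:
  assumes reg: "von_neumann_regular A" and x: "x \<in> Obj" and fin: "finite (isot x)"
  obtains \<beta> where "\<beta> \<in> carrier R" "\<beta> \<otimes> add_pow R (card (isot x)) \<one> = \<one>"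
proof -
  define s where "s = (\<lambda>g\<in>Arr. if g \<in> isot x then \<one> else \<zero>)"
  have s: "s \<in> carrier A" by (rule A_carrierI[OF fin]) (auto simp: s_def)
  have ss_in: "conv s s \<in> carrier A" using s conv_in by auto
  have key: "\<exists>\<beta>\<in>carrier R. conv (conv s b) s = fscale \<beta> (conv s s)" if b: "b \<in> carrier A" for b
    using b
  proof (induction rule: A_induct)
    case zero
    have "conv s fzero = fzero" using A.mult_zero[OF s] by simp
    then have "conv (conv s fzero) s = fzero" using conv_zero_left[OF s] by simp
    also have "\<dots> = fscale \<zero> (conv s s)"
      by (rule extensionalityI[of _ Arr]) (use A_val[OF ss_in] in auto)
    finally show ?case by blast
  next
    case (add b c a)
    then obtain \<beta> where \<beta>: "\<beta> \<in> carrier R" "conv (conv s b) s = fscale \<beta> (conv s s)" by blast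
    have m: "mono c a \<in> carrier A" using add by auto
    have sm: "conv s (mono c a) \<in> carrier A" using s m conv_in by auto
    have "\<exists>\<gamma>\<in>carrier R. conv (conv s (mono c a)) s = fscale \<gamma> (conv s s)"
    proof (cases "a \<in> isot x")
      case True
      \<comment> \<open>\<open>s\<close> absorbs the elements of its own group, leaving the scalar
        \<open>c\<close>.\<close>
      have "conv s (mono c a) = scal c \<otimes>\<^bsub>A\<^esub> s"
      proof (rule A_eqI[OF sm])
        show "scal c \<otimes>\<^bsub>A\<^esub> s \<in> carrier A" using s add conv_in by auto
        fix g assume g: "g \<in> Arr"
        have "src g = x \<Longrightarrow> g \<diamondop> ivt a \<in> isot x \<longleftrightarrow> g \<in> isot x" using g True by auto
        then show "conv s (mono c a) g = (scal c \<otimes>\<^bsub>A\<^esub> s) g"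
          using g True add s by (auto simp: conv_mono_right conv_scal_left A_funcset) (auto simp: s_def)
      qed
      then have "conv (conv s (mono c a)) s = conv (scal c) (conv s s)"
        using A_conv_assoc[of "scal c" s s] s add by auto
      also have "\<dots> = fscale c (conv s s)"
        by (rule extensionalityI[of _ Arr]) (use add ss_in in \<open>auto simp: conv_scal_left A_funcset\<close>)
      finally show ?thesis using add by blast
    next
      case False
      \<comment> \<open>An arrow that is not a loop at \<open>x\<close> cannot be composed with
        loops at \<open>x\<close> on both sides, so the product vanishes.\<close>
      have "conv (conv s (mono c a)) s = fscale \<zero> (conv s s)"
      proof (rule extensionalityI[of _ Arr])
        fix g assume g: "g \<in> Arr"
        have "conv (conv s (mono c a)) s g = (\<Oplus>h\<in>{}. conv s (mono c a) (g \<diamondop> ivt h) \<otimes> s h)"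
        proof (rule conv_eq[OF A_funcset[OF sm] A_funcset[OF s] g])
          fix h assume h: "h \<in> Arr" "src h = src g"
          show "conv s (mono c a) (g \<diamondop> ivt h) \<otimes> s h = \<zero>"
          proof (cases "h \<in> isot x")
            case True
            have "conv s (mono c a) (g \<diamondop> ivt h) = \<zero>"
              using False True g h add s
              by (auto simp: conv_mono_right A_funcset) (auto simp: s_def)
            then show ?thesis using A_val[OF s h(1)] by simp
          next
            case False
            have "g \<diamondop> ivt h \<in> Arr" using g h by simp
            then have v: "conv s (mono c a) (g \<diamondop> ivt h) \<in> carrier R" by (rule A_val[OF sm])
            have "s h = \<zero>" using False h by (auto simp: s_def)
            then show ?thesis using v by simp
          qed
        qed auto
        then show "conv (conv s (mono c a)) s g = fscale \<zero> (conv s s) g"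
          using g A_val[OF ss_in g] by simp
      qed auto
      then show ?thesis by blast
    qed
    then obtain \<gamma> where \<gamma>: "\<gamma> \<in> carrier R" "conv (conv s (mono c a)) s = fscale \<gamma> (conv s s)" by blast
    have "conv (conv s (fplus b (mono c a))) s = fplus (conv (conv s b) s) (conv (conv s (mono c a)) s)"
      using A_distr(2)[OF s add.hyps(1) m] A_distr(1)[OF conv_in[OF s add.hyps(1)] sm s] by simp
    also have "\<dots> = fscale (\<beta> \<oplus> \<gamma>) (conv s s)"
      unfolding \<beta>(2) \<gamma>(2)
      by (rule extensionalityI[of _ Arr]) (use \<beta> \<gamma> A_val[OF ss_in] in \<open>auto simp: l_distr\<close>)
    finally show ?case using \<beta> \<gamma> by blast
  qed
  obtain b where b: "b \<in> carrier A" "s \<otimes>\<^bsub>A\<^esub> b \<otimes>\<^bsub>A\<^esub> s = s"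
    using reg s unfolding von_neumann_regular_def by blast
  obtain \<beta> where \<beta>: "\<beta> \<in> carrier R" "s = fscale \<beta> (conv s s)" using key[OF b(1)] b(2) by auto
  have "conv s s (unt x) = (\<Oplus>h\<in>isot x. s (unt x \<diamondop> ivt h) \<otimes> s h)"
  proof (rule conv_fiber[OF A_funcset[OF s] A_funcset[OF s] _ fin])
    show "{h \<in> Arr. src h = src (unt x) \<and> s h \<noteq> \<zero>} \<subseteq> isot x" by (auto simp: s_def)
    show "isot x \<subseteq> {h \<in> Arr. src h = src (unt x)}" using x by auto
  qed (use x in simp)
  also have "\<dots> = (\<Oplus>h\<in>isot x. \<one>)"
    by (rule finsum_cong') (use x in \<open>auto simp: s_def\<close>)
  also have "\<dots> = add_pow R (card (isot x)) \<one>" by (rule R.add.finprod_const) simp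
  finally have "conv s s (unt x) = add_pow R (card (isot x)) \<one>" .
  moreover have "s (unt x) = \<beta> \<otimes> conv s s (unt x)" using fun_cong[OF \<beta>(2), of "unt x"] x by simp
  moreover have "s (unt x) = \<one>" using x by (simp add: s_def)
  ultimately show ?thesis using that \<beta>(1) by simp
qed

section \<open>Projections and averaging over a finite groupoid\<close>

lemma A_finsum_apply:
  assumes "finite K" "\<And>k. k \<in> K \<Longrightarrow> F k \<in> carrier A" "g \<in> Arr"
  shows "(\<Oplus>\<^bsub>A\<^esub>k\<in>K. F k) g = (\<Oplus>k\<in>K. F k g)"
  using assms
proof (induction K)
  case empty
  then show ?case by simp
next
  case (insert k K)
  have "(\<Oplus>\<^bsub>A\<^esub>k\<in>insert k K. F k) = F k \<oplus>\<^bsub>A\<^esub> (\<Oplus>\<^bsub>A\<^esub>k\<in>K. F k)"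
    using insert by (intro A.finsum_insert) auto
  moreover have "(\<Oplus>k\<in>insert k K. F k g) = F k g \<oplus> (\<Oplus>k\<in>K. F k g)"
    using insert A_val by (intro R.finsum_insert) auto
  ultimately show ?case using insert by simp
qed

lemma left_ideal_finsum:
  assumes I: "left_ideal I A" and "finite K" "\<And>k. k \<in> K \<Longrightarrow> F k \<in> I"
  shows "(\<Oplus>\<^bsub>A\<^esub>k\<in>K. F k) \<in> I"
  using assms(2,3)
proof (induction K)
  case empty
  then show ?case using A.left_ideal_zero[OF I] by simp
next
  case (insert k K)
  have "(\<Oplus>\<^bsub>A\<^esub>k\<in>insert k K. F k) = F k \<oplus>\<^bsub>A\<^esub> (\<Oplus>\<^bsub>A\<^esub>k\<in>K. F k)"
    using insert A.left_ideal_subset[OF I] by (intro A.finsum_insert) auto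
  then show ?case using insert A.left_ideal_add[OF I] by simp
qed

text \<open>If every ideal of \<open>R\<close> contains an element acting on it as identity, every
  \<open>R\<close>-submodule of functions on a finite set is a direct summand. The induction splits
  off one point \<open>x\<close>: the values at \<open>x\<close> form an ideal whose identity
  \<open>\<epsilon>\<close> is the value of some \<open>f0\<close> in \<open>I\<close>, and a
  multiple of \<open>f0\<close> is subtracted.\<close>

lemma exists_linear_projection:
  assumes idem: "\<And>J. left_ideal J R \<Longrightarrow> \<exists>\<epsilon>\<in>J. \<forall>r\<in>J. r \<otimes> \<epsilon> = r"
    and S: "finite S"
    and I: "I \<subseteq> carrier A" "fzero \<in> I" "\<And>f f'. f \<in> I \<Longrightarrow> f' \<in> I \<Longrightarrow> fplus f f' \<in> I"
      "\<And>c f. c \<in> carrier R \<Longrightarrow> f \<in> I \<Longrightarrow> fscale c f \<in> I"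
    and sup: "\<forall>f\<in>I. \<forall>g\<in>Arr. g \<notin> S \<longrightarrow> f g = \<zero>"
  shows "\<exists>p. (\<forall>f\<in>carrier A. p f \<in> I) \<and> (\<forall>f\<in>I. p f = f) \<and>
     (\<forall>f\<in>carrier A. \<forall>f'\<in>carrier A. p (fplus f f') = fplus (p f) (p f')) \<and>
     (\<forall>c\<in>carrier R. \<forall>f\<in>carrier A. p (fscale c f) = fscale c (p f))"
  using S I sup
proof (induction S arbitrary: I)
  case (empty I)
  have 1: "f = fzero" if "f \<in> I" for f
  proof (rule A_eqI)
    show "f \<in> carrier A" "fzero \<in> carrier A" using empty(1) that A_zero_in by auto
  qed (use empty(5) that in simp)
  have 2: "fzero = fplus fzero fzero" "\<And>c. c \<in> carrier R \<Longrightarrow> fzero = fscale c fzero"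
    by (rule extensionalityI[of _ Arr]; simp)+
  have 3: "\<forall>f\<in>I. fzero = f" using 1[symmetric] by (rule ballI)
  show ?case
    by (intro exI[of _ "\<lambda>_. fzero"] conjI 3) (use empty(2) 2 in blast)+
next
  case (insert x S I)
  note I = insert.prems
  have fscale_in: "fscale c f \<in> carrier A" if "c \<in> carrier R" "f \<in> carrier A" for c f
    by (rule A_carrierI[OF A_finite[OF that(2)]]) (use that A_val in auto)
  show ?case
  proof (cases "x \<in> Arr")
    case False
    then have *: "\<forall>f\<in>I. \<forall>g\<in>Arr. g \<notin> S \<longrightarrow> f g = \<zero>" using I(5) by (metis insert_iff)
    show ?thesis by (rule insert.IH) (use I(1-4) * in blast)+
  next
    case x: True
    have val: "f g \<in> carrier R" if "f \<in> I" "g \<in> Arr" for f g using that I(1) A_val by auto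
    define J where "J = (\<lambda>f. f x) ` I"
    have J: "left_ideal J R"
    proof (rule R.left_idealI)
      show "J \<subseteq> carrier R" using val x by (auto simp: J_def)
      show "\<zero> \<in> J" using I(2) x by (auto simp: J_def intro!: image_eqI[of _ _ fzero])
      show "a \<oplus> b \<in> J" if ab: "a \<in> J" "b \<in> J" for a b
      proof -
        obtain f f' where "f \<in> I" "f' \<in> I" "a = f x" "b = f' x" using ab by (auto simp: J_def)
        then show ?thesis using I(3) x by (auto simp: J_def intro!: image_eqI[of _ _ "fplus f f'"])
      qed
      show r: "r \<otimes> a \<in> J" if ra: "r \<in> carrier R" "a \<in> J" for r a
      proof -
        obtain f where "f \<in> I" "a = f x" using ra by (auto simp: J_def)
        then show ?thesis using I(4) x ra by (auto simp: J_def intro!: image_eqI[of _ _ "fscale r f"])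
      qed
      show "\<ominus> a \<in> J" if a: "a \<in> J" for a
        using r[of "\<ominus> \<one>" a] a val x by (auto simp: J_def R.l_minus)
    qed
    obtain \<epsilon> where \<epsilon>: "\<epsilon> \<in> J" "\<And>r. r \<in> J \<Longrightarrow> r \<otimes> \<epsilon> = r" using idem[OF J] by blast
    obtain f0 where f0: "f0 \<in> I" "f0 x = \<epsilon>" using \<epsilon>(1) by (auto simp: J_def)
    define I' where "I' = {f \<in> I. f x = \<zero>}"
    have I': "I' \<subseteq> carrier A" "fzero \<in> I'" "\<And>f f'. f \<in> I' \<Longrightarrow> f' \<in> I' \<Longrightarrow> fplus f f' \<in> I'"
      "\<And>c f. c \<in> carrier R \<Longrightarrow> f \<in> I' \<Longrightarrow> fscale c f \<in> I'"
      using I(1-4) x by (auto simp: I'_def)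
    have I'0: "\<forall>f\<in>I'. \<forall>g\<in>Arr. g \<notin> S \<longrightarrow> f g = \<zero>"
      using I(5) unfolding I'_def by (metis (mono_tags, lifting) insert_iff mem_Collect_eq)
    obtain p where p: "\<forall>f\<in>carrier A. p f \<in> I'" "\<forall>f\<in>I'. p f = f"
       "\<forall>f\<in>carrier A. \<forall>f'\<in>carrier A. p (fplus f f') = fplus (p f) (p f')"
       "\<forall>c\<in>carrier R. \<forall>f\<in>carrier A. p (fscale c f) = fscale c (p f)"
      using insert.IH[of I', OF I' I'0] by blast
    \<comment> \<open>For \<open>f\<close> in \<open>I\<close> the value \<open>f x\<close> is fixed
      by \<open>\<epsilon>\<close>, so \<open>d f\<close> vanishes at \<open>x\<close>. For other
      \<open>f\<close> it may not, which is harmless because \<open>p\<close> is defined on all of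
      \<open>A\<close>.\<close>
    define d where "d f = fplus f (fscale (\<ominus> (f x)) f0)" for f
    define q where "q f = fplus (p (d f)) (fscale (f x) f0)" for f
    have f0A: "f0 \<in> carrier A" using f0 I(1) by auto
    have dA: "d f \<in> carrier A" if "f \<in> carrier A" for f
      using that f0A x A_val by (auto simp: d_def intro!: A_add_in fscale_in)
    have pI: "p f \<in> I" "p f \<in> carrier A" if "f \<in> carrier A" for f using p(1) that I'(1) by (auto simp: I'_def)
    have "q f \<in> I" if "f \<in> carrier A" for f
      using that pI[OF dA[OF that]] f0 A_val[OF that x] by (auto simp: q_def intro!: I(3,4))
    moreover have "q f = f" if f: "f \<in> I" for f
    proof -
      have fA: "f \<in> carrier A" using f I(1) by auto
      have fx: "f x \<in> J" "f x \<in> carrier R" using f x A_val[OF fA] by (auto simp: J_def)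
      have "d f \<in> I" using f f0 fx unfolding d_def by (intro I(3,4)) auto
      moreover have "d f x = \<zero>" using x f0 fx \<epsilon>(2)[OF fx(1)] A_val[OF f0A x]
        by (simp add: d_def R.l_minus R.r_neg)
      ultimately have "p (d f) = d f" using p(2) by (simp add: I'_def)
      then have "q f = fplus (d f) (fscale (f x) f0)" by (simp add: q_def)
      also have "\<dots> = f"
      proof (rule A_eqI)
        show "fplus (d f) (fscale (f x) f0) \<in> carrier A" using dA fA f0A fx by (intro A_add_in fscale_in) auto
        fix g assume "g \<in> Arr"
        then show "fplus (d f) (fscale (f x) f0) g = f g"
          using fx A_val[OF fA] A_val[OF f0A] by (simp add: d_def R.a_assoc R.l_minus R.l_neg)
      qed (rule fA)
      finally show ?thesis .
    qed
    moreover have "q (fplus f f') = fplus (q f) (q f')" if f: "f \<in> carrier A" "f' \<in> carrier A" for f f'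
    proof -
      have v: "f g \<in> carrier R" "f' g \<in> carrier R" "f0 g \<in> carrier R" "p (d f) g \<in> carrier R" "p (d f') g \<in> carrier R"
        if "g \<in> Arr" for g using that f f0A pI dA A_val by auto
      have "d (fplus f f') = fplus (d f) (d f')"
        by (rule extensionalityI[of _ Arr])
          (use v x in \<open>auto simp: d_def R.minus_add R.l_distr R.l_minus R.a_ac\<close>)
      then have "p (d (fplus f f')) = fplus (p (d f)) (p (d f'))" using p(3) dA f by auto
      then show ?thesis
        by (intro extensionalityI[of _ Arr]) (use v x in \<open>auto simp: q_def R.l_distr R.a_ac\<close>)
    qed
    moreover have "q (fscale c f) = fscale c (q f)" if c: "c \<in> carrier R" "f \<in> carrier A" for c f
    proof -
      have v: "f g \<in> carrier R" "f0 g \<in> carrier R" "p (d f) g \<in> carrier R"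
        if "g \<in> Arr" for g using that c f0A pI dA A_val by auto
      have "d (fscale c f) = fscale c (d f)"
        by (rule extensionalityI[of _ Arr])
          (use v x c in \<open>auto simp: d_def R.r_distr R.r_minus R.l_minus R.m_assoc\<close>)
      then have "p (d (fscale c f)) = fscale c (p (d f))" using p(4) dA c by auto
      then show ?thesis
        by (intro extensionalityI[of _ Arr]) (use v x c in \<open>auto simp: q_def R.r_distr R.m_assoc\<close>)
    qed
    ultimately show ?thesis by (intro exI[of _ q]) auto
  qed
qed

definition orbit_of where "orbit_of y = {src g | g. g \<in> Arr \<and> tgt g = y}"

text \<open>The choice is made from the orbit as a set, so objects of the same orbit receive the
  same representative.\<close>

definition rep where "rep y = (SOME z. z \<in> orbit_of y)"

lemma orbit_of_eq:
  assumes "g \<in> Arr"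
  shows "orbit_of (src g) = orbit_of (tgt g)"
proof (intro equalityI subsetI)
  fix z assume "z \<in> orbit_of (src g)"
  then obtain h where "h \<in> Arr" "tgt h = src g" "z = src h" by (auto simp: orbit_of_def)
  then show "z \<in> orbit_of (tgt g)" using assms by (auto simp: orbit_of_def intro!: exI[of _ "g \<diamondop> h"])
next
  fix z assume "z \<in> orbit_of (tgt g)"
  then obtain h where "h \<in> Arr" "tgt h = tgt g" "z = src h" by (auto simp: orbit_of_def)
  then show "z \<in> orbit_of (src g)" using assms by (auto simp: orbit_of_def intro!: exI[of _ "ivt g \<diamondop> h"])
qed

lemma rep_eq: "g \<in> Arr \<Longrightarrow> rep (src g) = rep (tgt g)"
  by (simp add: rep_def orbit_of_eq)

lemma rep_arrow:
  assumes "y \<in> Obj"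
  obtains t where "t \<in> Arr" "src t = rep y" "tgt t = y"
proof -
  have "y \<in> orbit_of y" unfolding orbit_of_def using assms by (auto intro!: exI[of _ "unt y"])
  then have "rep y \<in> orbit_of y" unfolding rep_def by (rule someI)
  then show ?thesis using that by (auto simp: orbit_of_def)
qed

text \<open>The weight is the inverse of the isotropy order at the representative of an orbit and
  zero at its other objects. The arrows into \<open>y\<close> from its representative form a torsor
  under the isotropy group there, so the weights add up to the unit.\<close>

lemma exists_orbit_weight:
  assumes fin: "finite Arr"
    and unit: "\<And>x. x \<in> Obj \<Longrightarrow> \<exists>\<beta>\<in>carrier R. \<beta> \<otimes> add_pow R (card (isot x)) \<one> = \<one>"
  obtains w where "\<And>x. x \<in> Obj \<Longrightarrow> w x \<in> carrier R"
    "\<And>y. y \<in> Obj \<Longrightarrow> (\<Oplus>g\<in>{g \<in> Arr. tgt g = y}. w (src g)) = \<one>"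
proof -
  define \<beta> where "\<beta> x = (SOME \<beta>. \<beta> \<in> carrier R \<and> \<beta> \<otimes> add_pow R (card (isot x)) \<one> = \<one>)" for x
  have \<beta>: "\<beta> x \<in> carrier R" "\<beta> x \<otimes> add_pow R (card (isot x)) \<one> = \<one>" if "x \<in> Obj" for x
    unfolding \<beta>_def using someI_ex[of "\<lambda>\<beta>. \<beta> \<in> carrier R \<and> \<beta> \<otimes> add_pow R (card (isot x)) \<one> = \<one>"]
      unit[OF that] by blast+
  define w where "w x = (if x = rep x then \<beta> x else \<zero>)" for x
  have w: "w x \<in> carrier R" if "x \<in> Obj" for x using \<beta> that by (simp add: w_def)
  have "(\<Oplus>g\<in>{g \<in> Arr. tgt g = y}. w (src g)) = \<one>" if y: "y \<in> Obj" for y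
  proof -
    obtain t where t: "t \<in> Arr" "src t = rep y" "tgt t = y" using rep_arrow[OF y] .
    have r: "rep y \<in> Obj" using t by (metis dmap_closed)
    have w_src: "w (src g) = (if src g = rep y then \<beta> (rep y) else \<zero>)" if "g \<in> Arr" "tgt g = y" for g
      using rep_eq[OF that(1)] that by (simp add: w_def)
    have "(\<Oplus>g\<in>{g \<in> Arr. tgt g = y}. w (src g)) = (\<Oplus>g\<in>(\<lambda>h. t \<diamondop> h) ` isot (rep y). \<beta> (rep y))"
    proof (rule R.add.finprod_mono_neutral_cong_right)
      show "(\<lambda>h. t \<diamondop> h) ` isot (rep y) \<subseteq> {g \<in> Arr. tgt g = y}" using t by auto
      fix g assume g: "g \<in> {g \<in> Arr. tgt g = y} - (\<lambda>h. t \<diamondop> h) ` isot (rep y)"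
      have "src g \<noteq> rep y"
      proof
        assume "src g = rep y"
        then have "ivt t \<diamondop> g \<in> isot (rep y)" "g = t \<diamondop> (ivt t \<diamondop> g)" using g t by auto
        then show False using g by blast
      qed
      then show "w (src g) = \<zero>" using g w_src by simp
    next
      fix g assume "g \<in> (\<lambda>h. t \<diamondop> h) ` isot (rep y)"
      then have "g \<in> Arr" "tgt g = y" "src g = rep y" using t by auto
      then show "w (src g) = \<beta> (rep y)" using w_src[of g] by simp
    qed (use fin w in auto)
    also have "\<dots> = add_pow R (card ((\<lambda>h. t \<diamondop> h) ` isot (rep y))) (\<beta> (rep y))"
      by (rule R.add.finprod_const) (rule \<beta>(1)[OF r])
    also have "card ((\<lambda>h. t \<diamondop> h) ` isot (rep y)) = card (isot (rep y))"
    proof (rule card_image, rule inj_onI)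
      fix h k assume hk: "h \<in> isot (rep y)" "k \<in> isot (rep y)" "t \<diamondop> h = t \<diamondop> k"
      have "h = ivt t \<diamondop> (t \<diamondop> h)" using hk(1) t by auto
      also have "\<dots> = k" unfolding hk(3) using hk(2) t by auto
      finally show "h = k" .
    qed
    also have "add_pow R (card (isot (rep y))) (\<beta> (rep y)) = \<one>"
      using \<beta>[OF r] R.add_pow_rdistr[of "\<beta> (rep y)" \<one> "card (isot (rep y))"] by simp
    finally show ?thesis .
  qed
  then show ?thesis using that w by blast
qed

text \<open>Maschke averaging. The weights are concentrated on one object of each orbit, because the size of
  an orbit need not be invertible in \<open>R\<close>.\<close>

lemma regular_of_coefficients:
  assumes idem: "\<And>J. left_ideal J R \<Longrightarrow> \<exists>\<epsilon>\<in>J. \<forall>r\<in>J. r \<otimes> \<epsilon> = r"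
    and fin: "finite Arr"
    and unit: "\<And>x. x \<in> Obj \<Longrightarrow> \<exists>\<beta>\<in>carrier R. \<beta> \<otimes> add_pow R (card (isot x)) \<one> = \<one>"
  shows "von_neumann_regular A"
  unfolding von_neumann_regular_def
proof
  fix a assume a: "a \<in> carrier A"
  \<comment> \<open>An element \<open>e = b \<otimes> a\<close> of this left ideal with
    \<open>a \<otimes> e = a\<close> exhibits the desired \<open>b\<close>. It is obtained from an
    \<open>A\<close>-linear projection onto \<open>I\<close>.\<close>
  define I where "I = left_principal A a"
  have I: "left_ideal I A" unfolding I_def by (rule A.left_ideal_principal[OF a])
  note IA = A.left_ideal_subset[OF I]
  obtain w where w: "\<And>x. x \<in> Obj \<Longrightarrow> w x \<in> carrier R"
    "\<And>y. y \<in> Obj \<Longrightarrow> (\<Oplus>g\<in>{g \<in> Arr. tgt g = y}. w (src g)) = \<one>"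
    using exists_orbit_weight[OF fin unit] by blast
  have "\<exists>p. (\<forall>f\<in>carrier A. p f \<in> I) \<and> (\<forall>f\<in>I. p f = f) \<and>
     (\<forall>f\<in>carrier A. \<forall>f'\<in>carrier A. p (fplus f f') = fplus (p f) (p f')) \<and>
     (\<forall>c\<in>carrier R. \<forall>f\<in>carrier A. p (fscale c f) = fscale c (p f))"
  proof (rule exists_linear_projection[OF idem fin])
    show "fzero \<in> I" using A.left_ideal_zero[OF I] by simp
    show "fplus f f' \<in> I" if "f \<in> I" "f' \<in> I" for f f' using A.left_ideal_add[OF I that] by simp
  qed (use IA left_ideal_scale[OF I] in auto)
  then obtain p where p: "\<And>f. f \<in> carrier A \<Longrightarrow> p f \<in> I" "\<And>f. f \<in> I \<Longrightarrow> p f = f"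
     "\<And>f f'. f \<in> carrier A \<Longrightarrow> f' \<in> carrier A \<Longrightarrow> p (fplus f f') = fplus (p f) (p f')"
     "\<And>c f. c \<in> carrier R \<Longrightarrow> f \<in> carrier A \<Longrightarrow> p (fscale c f) = fscale c (p f)" by blast
  \<comment> \<open>One summand of the average: undo \<open>k\<close>, project, and apply
    \<open>k\<close> again with the weight of its source.\<close>
  define tm where "tm f k = conv (mono (w (src k)) k) (p (conv (mono \<one> (ivt k)) f))" for f k
  have inner: "conv (mono \<one> (ivt k)) f \<in> carrier A" if "f \<in> carrier A" "k \<in> Arr" for f k
    using that by (intro conv_in mono_in_A) auto
  have tmI: "tm f k \<in> I" if "f \<in> carrier A" "k \<in> Arr" for f k
    using A.left_ideal_mult[OF I mono_in_A[OF w(1)] p(1)[OF inner[OF that]], of "src k" k] that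
    by (simp add: tm_def)
  have tmA: "tm f k \<in> carrier A" if "f \<in> carrier A" "k \<in> Arr" for f k
    using tmI[OF that] IA by auto
  define T where "T f = (\<Oplus>\<^bsub>A\<^esub>k\<in>Arr. tm f k)" for f
  have TI: "T f \<in> I" if "f \<in> carrier A" for f
    unfolding T_def by (rule left_ideal_finsum[OF I fin tmI[OF that]])
  have TA: "T f \<in> carrier A" if "f \<in> carrier A" for f using TI[OF that] IA by auto
  \<comment> \<open>An endomorphism of the left module \<open>A\<close> is right multiplication by
    its value at the unit, so linearity of \<open>T\<close> amounts to
    \<open>T f = conv f e\<close>.\<close>
  define e where "e = T (scal \<one>)"
  have eI: "e \<in> I" unfolding e_def by (rule TI) auto
  have eA: "e \<in> carrier A" using eI IA by auto
  have pm: "p (mono c g) = fscale c (p (mono \<one> g))" if "c \<in> carrier R" for c g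
  proof -
    have "mono c g = fscale c (mono \<one> g)"
      by (rule extensionalityI[of _ Arr]) (use that in \<open>auto simp: mono_def\<close>)
    then show ?thesis using p(4)[OF that mono_in_A[OF R.one_closed]] by simp
  qed
  \<comment> \<open>Substituting \<open>k = h \<diamondop> g\<close> in the average brings the
    factor \<open>h\<close> to the front. The weight is unaffected, because
    \<open>h \<diamondop> g\<close> and \<open>g\<close> have the same source.\<close>
  have T_mono: "T (mono c h) = conv (mono c h) e" if c: "c \<in> carrier R" "h \<in> Arr" for c h
  proof -
    have m: "mono c h \<in> carrier A" using c by auto
    have p0: "p fzero = fzero" using p(2) A.left_ideal_zero[OF I] by simp
    have q: "p (mono \<one> (ivt g)) \<in> carrier A" for g using p(1)[OF mono_in_A[OF R.one_closed]] IA by auto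
    have lhs: "tm (mono c h) k = (if tgt k = tgt h
        then conv (mono (w (src k)) k) (fscale c (p (mono \<one> (ivt k \<diamondop> h)))) else fzero)" if k: "k \<in> Arr" for k
    proof (cases "tgt k = tgt h")
      case True
      then have "conv (mono \<one> (ivt k)) (mono c h) = mono c (ivt k \<diamondop> h)"
        using k c by (simp add: conv_mono_mono)
      then show ?thesis using True pm[OF c(1)] by (simp add: tm_def)
    next
      case False
      then have "conv (mono \<one> (ivt k)) (mono c h) = fzero" using k c by (simp add: conv_mono_mono)
      then have "tm (mono c h) k = conv (mono (w (src k)) k) fzero" by (simp add: tm_def p0)
      also have "\<dots> = fzero" using A.mult_zero[OF mono_in_A[OF w(1)], of "src k" k] k by simp
      finally show ?thesis using False by simp
    qed
    have rhs: "conv (mono c h) (tm (scal \<one>) g) = (if tgt g = src h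
        then tm (mono c h) (h \<diamondop> g) else fzero)" if g: "g \<in> Arr" for g
    proof -
      have ws: "w (src g) \<in> carrier R" using g w(1) by simp
      have "conv (mono \<one> (ivt g)) (scal \<one>) = mono \<one> (ivt g)"
        using A.r_one[OF mono_in_A[OF R.one_closed]] by simp
      then have "conv (mono c h) (tm (scal \<one>) g)
          = conv (conv (mono c h) (mono (w (src g)) g)) (p (mono \<one> (ivt g)))"
        using A_conv_assoc[OF m mono_in_A[OF ws] q] by (simp add: tm_def)
      also have "\<dots> = (if tgt g = src h then conv (mono (c \<otimes> w (src g)) (h \<diamondop> g)) (p (mono \<one> (ivt g))) else fzero)"
        using conv_mono_mono[OF c(1) ws c(2) g] conv_zero_left[OF q] by auto
      also have "\<dots> = (if tgt g = src h then tm (mono c h) (h \<diamondop> g) else fzero)"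
      proof (cases "tgt g = src h")
        case True
        then have hg: "h \<diamondop> g \<in> Arr" "src (h \<diamondop> g) = src g" "tgt (h \<diamondop> g) = tgt h" using g c by auto
        have inv: "ivt (h \<diamondop> g) \<diamondop> h = ivt g" using True g c by (simp add: inv_comp)
        have qs: "fscale c (p (mono \<one> (ivt g))) \<in> Arr \<rightarrow> carrier R" using c A_val[OF q] by auto
        have "conv (mono (c \<otimes> w (src g)) (h \<diamondop> g)) (p (mono \<one> (ivt g)))
            = conv (mono (w (src g)) (h \<diamondop> g)) (fscale c (p (mono \<one> (ivt g))))"
        proof (rule extensionalityI[of _ Arr])
          fix k assume k: "k \<in> Arr"
          show "conv (mono (c \<otimes> w (src g)) (h \<diamondop> g)) (p (mono \<one> (ivt g))) k
            = conv (mono (w (src g)) (h \<diamondop> g)) (fscale c (p (mono \<one> (ivt g)))) k"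
          proof (cases "tgt k = tgt h")
            case True
            then have "ivt (h \<diamondop> g) \<diamondop> k \<in> Arr" using hg k by simp
            then show ?thesis using True k hg c ws A_val[OF q] qs A_funcset[OF q]
              by (simp add: conv_mono_left R.m_ac)
          next
            case False
            then show ?thesis using k hg c ws qs A_funcset[OF q] by (simp add: conv_mono_left)
          qed
        qed auto
        then show ?thesis using True lhs[OF hg(1)] hg inv by simp
      qed simp
      finally show ?thesis .
    qed
    have "T (mono c h) = (\<Oplus>\<^bsub>A\<^esub>k\<in>(\<lambda>g. h \<diamondop> g) ` {g \<in> Arr. tgt g = src h}. tm (mono c h) k)"
      unfolding T_def
    proof (rule A.add.finprod_mono_neutral_cong_right[OF fin])
      show "(\<lambda>g. h \<diamondop> g) ` {g \<in> Arr. tgt g = src h} \<subseteq> Arr" using c by auto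
      show "tm (mono c h) \<in> Arr \<rightarrow> carrier A" using tmA[OF m] by auto
      fix k assume k: "k \<in> Arr - (\<lambda>g. h \<diamondop> g) ` {g \<in> Arr. tgt g = src h}"
      have "tgt k \<noteq> tgt h"
      proof
        assume "tgt k = tgt h"
        then have "k = h \<diamondop> (ivt h \<diamondop> k)" "ivt h \<diamondop> k \<in> {g \<in> Arr. tgt g = src h}" using k c by auto
        then show False using k by blast
      qed
      then show "tm (mono c h) k = \<zero>\<^bsub>A\<^esub>" using lhs k by simp
    qed simp
    also have "\<dots> = (\<Oplus>\<^bsub>A\<^esub>g\<in>{g \<in> Arr. tgt g = src h}. tm (mono c h) (h \<diamondop> g))"
    proof (rule A.finsum_reindex)
      show "inj_on (\<lambda>g. h \<diamondop> g) {g \<in> Arr. tgt g = src h}"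
      proof (rule inj_onI)
        fix g k assume gk: "g \<in> {g \<in> Arr. tgt g = src h}" "k \<in> {g \<in> Arr. tgt g = src h}" "h \<diamondop> g = h \<diamondop> k"
        have "g = ivt h \<diamondop> (h \<diamondop> g)" using gk(1) c by auto
        also have "\<dots> = k" unfolding gk(3) using gk(2) c by auto
        finally show "g = k" .
      qed
    qed (use tmA[OF m] c in auto)
    also have "\<dots> = (\<Oplus>\<^bsub>A\<^esub>g\<in>Arr. conv (mono c h) (tm (scal \<one>) g))"
    proof (rule A.add.finprod_mono_neutral_cong_left[OF fin])
      show "(\<lambda>g. conv (mono c h) (tm (scal \<one>) g)) \<in> Arr \<rightarrow> carrier A"
        using m tmA[OF scal_in_A[OF R.one_closed]] conv_in by auto
    qed (use rhs in auto)
    also have "\<dots> = conv (mono c h) e"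
      using A.finsum_rdistr[OF fin m, of "tm (scal \<one>)"] tmA[OF scal_in_A[OF R.one_closed]]
      by (simp add: e_def T_def Pi_def)
    finally show ?thesis .
  qed
  have p0: "p fzero = fzero" using p(2) A.left_ideal_zero[OF I] by simp
  have T_add: "T (fplus f f') = fplus (T f) (T f')" if f: "f \<in> carrier A" "f' \<in> carrier A" for f f'
  proof -
    have "tm (fplus f f') k = tm f k \<oplus>\<^bsub>A\<^esub> tm f' k" if k: "k \<in> Arr" for k
    proof -
      have m: "mono \<one> (ivt k) \<in> carrier A" "mono (w (src k)) k \<in> carrier A" using k w by auto
      have q: "p (conv (mono \<one> (ivt k)) f) \<in> carrier A" "p (conv (mono \<one> (ivt k)) f') \<in> carrier A"
        using p(1)[OF inner[OF f(1) k]] p(1)[OF inner[OF f(2) k]] IA by auto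
      show ?thesis
        using A_distr(2)[OF m(1) f] p(3)[OF inner[OF f(1) k] inner[OF f(2) k]] A_distr(2)[OF m(2) q]
        by (simp add: tm_def)
    qed
    then have "T (fplus f f') = (\<Oplus>\<^bsub>A\<^esub>k\<in>Arr. tm f k \<oplus>\<^bsub>A\<^esub> tm f' k)" unfolding T_def
      by (intro A.finsum_cong') (use tmA[OF f(1)] tmA[OF f(2)] A_add_in in auto)
    also have "\<dots> = T f \<oplus>\<^bsub>A\<^esub> T f'" unfolding T_def
      by (rule A.finsum_addf) (use tmA[OF f(1)] tmA[OF f(2)] in auto)
    finally show ?thesis by simp
  qed
  have T_conv: "T f = conv f e" if "f \<in> carrier A" for f
    using that
  proof (induction rule: A_induct)
    case zero
    have "tm fzero k = \<zero>\<^bsub>A\<^esub>" if k: "k \<in> Arr" for k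
    proof -
      have m: "mono \<one> (ivt k) \<in> carrier A" "mono (w (src k)) k \<in> carrier A" using k w by auto
      show ?thesis using A.mult_zero[OF m(1)] A.mult_zero[OF m(2)] p0 by (simp add: tm_def)
    qed
    then have "T fzero = (\<Oplus>\<^bsub>A\<^esub>k\<in>Arr. \<zero>\<^bsub>A\<^esub>)" unfolding T_def
      by (intro A.finsum_cong') (use A_zero_in in auto)
    also have "\<dots> = \<zero>\<^bsub>A\<^esub>" by (rule A.finsum_zero)
    finally show ?case using conv_zero_left[OF eA] by simp
  next
    case (add f c h)
    then show ?case
      using T_add[OF add.hyps(1) mono_in_A[OF add.hyps(2)]] T_mono A_distr(1)[OF add.hyps(1) mono_in_A[OF add.hyps(2)] eA]
      by simp
  qed
  \<comment> \<open>Every translate of \<open>a\<close> lies in \<open>I\<close> and is fixed by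
    \<open>p\<close>. Each summand whose range is that of \<open>g\<close> therefore returns
    \<open>a g\<close> times its weight, and these weights sum to the unit.\<close>
  have "T a = a"
  proof (rule A_eqI[OF TA[OF a] a])
    fix g assume g: "g \<in> Arr"
    have val: "tm a k g = (if tgt k = tgt g then w (src k) \<otimes> a g else \<zero>)" if k: "k \<in> Arr" for k
    proof -
      have m: "mono \<one> (ivt k) \<in> carrier A" using k by auto
      have "conv (mono \<one> (ivt k)) a \<in> I"
        using A.left_ideal_mult[OF I m, of a] A.principal_self[OF a] by (simp add: I_def)
      then have "p (conv (mono \<one> (ivt k)) a) = conv (mono \<one> (ivt k)) a" by (rule p(2))
      then have "tm a k = conv (mono (w (src k)) k) (conv (mono \<one> (ivt k)) a)" by (simp add: tm_def)
      then show ?thesis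
        using g k w(1)[of "src k"] a A_val[OF a g] inner[OF a k] by (auto simp: conv_mono_left A_funcset)
    qed
    have "T a g = (\<Oplus>k\<in>Arr. tm a k g)"
      unfolding T_def by (rule A_finsum_apply[OF fin tmA[OF a] g])
    also have "\<dots> = (\<Oplus>k\<in>{k \<in> Arr. tgt k = tgt g}. w (src k) \<otimes> a g)"
      by (rule R.add.finprod_mono_neutral_cong_right[OF fin]) (use val g w(1) A_val[OF a g] in auto)
    also have "\<dots> = (\<Oplus>k\<in>{k \<in> Arr. tgt k = tgt g}. w (src k)) \<otimes> a g"
      by (rule R.finsum_ldistr[symmetric]) (use fin w(1) A_val[OF a g] in auto)
    also have "\<dots> = a g" using w(2)[of "tgt g"] g A_val[OF a g] by simp
    finally show "T a g = a g" .
  qed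
  then have "conv a e = a" using T_conv[OF a] by simp
  moreover obtain b where "b \<in> carrier A" "e = b \<otimes>\<^bsub>A\<^esub> a" using eI by (auto simp: I_def left_principal_def)
  ultimately show "\<exists>b\<in>carrier A. a \<otimes>\<^bsub>A\<^esub> b \<otimes>\<^bsub>A\<^esub> a = a"
    using A.m_assoc[OF a _ a] by (auto simp del: A_simps simp: A_simps(1)[symmetric])
qed

end

section \<open>Finite products of fields\<close>

text \<open>In characteristic zero both sides say \<open>n = 0\<close>, since zero divides only
  itself; otherwise \<open>n\<close> is reduced modulo the least positive period.\<close>

lemma (in ring) characteristic_dvd_iff: "characteristic R dvd n \<longleftrightarrow> add_pow R n \<one> = \<zero>"
proof (cases "\<exists>m>0. add_pow R (m::nat) \<one> = \<zero>")
  case True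
  define c where "c = (LEAST m. 0 < m \<and> add_pow R (m::nat) \<one> = \<zero>)"
  have c: "0 < c" "add_pow R c \<one> = \<zero>"
    using LeastI_ex[of "\<lambda>m. 0 < m \<and> add_pow R (m::nat) \<one> = \<zero>"] True by (auto simp: c_def)
  have least: "\<not> (0 < m \<and> add_pow R m \<one> = \<zero>)" if "m < c" for m :: nat
    using not_less_Least[of m] that by (auto simp: c_def)
  have ch: "characteristic R = c" using True by (simp add: characteristic_def c_def)
  have mult: "add_pow R (c * k) \<one> = \<zero>" for k
    using add.nat_pow_pow[OF one_closed, of k c] c(2) by simp
  have "add_pow R n \<one> = add_pow R (n mod c) \<one>"
  proof -
    have "add_pow R n \<one> = add_pow R (c * (n div c)) \<one> \<oplus> add_pow R (n mod c) \<one>"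
      using add.nat_pow_mult[OF one_closed, of "c * (n div c)" "n mod c"] by simp
    then show ?thesis using mult by simp
  qed
  moreover have "n mod c < c" using c(1) by simp
  ultimately have "add_pow R n \<one> = \<zero> \<longleftrightarrow> n mod c = 0"
    using least[of "n mod c"] by (auto simp: add.nat_pow_0)
  then show ?thesis using ch by (simp add: dvd_eq_mod_eq_0)
next
  case False
  then have "characteristic R = 0" unfolding characteristic_def by (rule if_not_P)
  moreover have "add_pow R n \<one> = \<zero> \<longleftrightarrow> n = 0"
  proof (cases "n = 0")
    case nz: False
    then show ?thesis using False by blast
  qed simp
  ultimately show ?thesis by simp
qed

lemma RDirProd_list_Cons_ops:
  assumes "x \<in> carrier R" "y \<in> carrier R" "xs \<in> carrier (RDirProd_list Rs)" "ys \<in> carrier (RDirProd_list Rs)"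
  shows "(x # xs) \<otimes>\<^bsub>RDirProd_list (R # Rs)\<^esub> (y # ys) = (x \<otimes>\<^bsub>R\<^esub> y) # (xs \<otimes>\<^bsub>RDirProd_list Rs\<^esub> ys)"
    and "(x # xs) \<oplus>\<^bsub>RDirProd_list (R # Rs)\<^esub> (y # ys) = (x \<oplus>\<^bsub>R\<^esub> y) # (xs \<oplus>\<^bsub>RDirProd_list Rs\<^esub> ys)"
  using ring_hom_mult[OF RDirProd_list_hom1, of "(x, xs)" R Rs "(y, ys)"]
    ring_hom_add[OF RDirProd_list_hom1, of "(x, xs)" R Rs "(y, ys)"] assms
  by (auto simp: RDirProd_carrier) (auto simp: RDirProd_def DirProd_def monoid.defs)

lemma RDirProd_list_nth:
  assumes "as \<in> carrier (RDirProd_list Rs)" "bs \<in> carrier (RDirProd_list Rs)" "i < length Rs"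
  shows "(as \<otimes>\<^bsub>RDirProd_list Rs\<^esub> bs) ! i = as ! i \<otimes>\<^bsub>Rs ! i\<^esub> bs ! i"
    and "(as \<oplus>\<^bsub>RDirProd_list Rs\<^esub> bs) ! i = as ! i \<oplus>\<^bsub>Rs ! i\<^esub> bs ! i"
  using assms
proof (induction Rs arbitrary: as bs i)
  case (Cons R Rs)
  {
    case 1
    then obtain x xs y ys where *: "as = x # xs" "bs = y # ys" "x \<in> carrier R" "y \<in> carrier R"
        "xs \<in> carrier (RDirProd_list Rs)" "ys \<in> carrier (RDirProd_list Rs)"
      by (auto simp: RDirProd_list_carrier)
    then show ?case using 1 Cons.IH(1)[of xs ys "i - 1"] RDirProd_list_Cons_ops(1)[OF *(3-6)]
      by (cases i) auto
  next
    case 2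
    then obtain x xs y ys where *: "as = x # xs" "bs = y # ys" "x \<in> carrier R" "y \<in> carrier R"
        "xs \<in> carrier (RDirProd_list Rs)" "ys \<in> carrier (RDirProd_list Rs)"
      by (auto simp: RDirProd_list_carrier)
    then show ?case using 2 Cons.IH(2)[of xs ys "i - 1"] RDirProd_list_Cons_ops(2)[OF *(3-6)]
      by (cases i) auto
  }
qed auto

lemma RDirProd_list_one_nth: "\<one>\<^bsub>RDirProd_list Rs\<^esub> = map one Rs"
  unfolding RDirProd_list_one by (induction Rs) auto

lemma stabilizes_finite:
  assumes c: "chain up I" and S: "finite S" "\<And>n. I n \<subseteq> S"
  shows "stabilizes I"
proof -
  have "stabilizes (\<lambda>n. I n \<inter> S)"
    using S(1)
  proof (induction S)
    case empty
    then show ?case by (simp add: stabilizes_def)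
  next
    case (insert x S)
    have "chain up (\<lambda>n. I n \<inter> {x})" by (rule chain_image[OF c]) auto
    then have "stabilizes (\<lambda>n. I n \<inter> {x})" by (rule stabilizes_two_values[of _ _ "{}" "{x}"]) auto
    then obtain N1 where N1: "\<And>n. n \<ge> N1 \<Longrightarrow> I n \<inter> {x} = I N1 \<inter> {x}" unfolding stabilizes_def by blast
    obtain N2 where N2: "\<And>n. n \<ge> N2 \<Longrightarrow> I n \<inter> S = I N2 \<inter> S" using insert.IH unfolding stabilizes_def by blast
    have "I n \<inter> insert x S = I (max N1 N2) \<inter> insert x S" if "n \<ge> max N1 N2" for n
      using N1[of n] N1[of "max N1 N2"] N2[of n] N2[of "max N1 N2"] that by auto
    then show ?case unfolding stabilizes_def by blast
  qed
  moreover have "I n \<inter> S = I n" for n using S(2) by blast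
  ultimately show ?thesis by simp
qed

text \<open>An isomorphism with a finite product, described by its coordinate maps:
  \<open>separate\<close> is injectivity and \<open>lift\<close> is surjectivity. The nested
  structure of \<open>RDirProd_list\<close> is thereby kept out of the arguments about
  ideals.\<close>

locale product_of_fields = cring R for R :: "('r, 'm) ring_scheme" (structure) +
  fixes n :: nat and F :: "nat \<Rightarrow> ('b, 'n) ring_scheme" and \<pi> :: "nat \<Rightarrow> 'r \<Rightarrow> 'b"
  assumes field: "i < n \<Longrightarrow> field (F i)"
    and hom: "i < n \<Longrightarrow> \<pi> i \<in> ring_hom R (F i)"
    and separate: "\<lbrakk>r \<in> carrier R; s \<in> carrier R; \<And>i. i < n \<Longrightarrow> \<pi> i r = \<pi> i s\<rbrakk> \<Longrightarrow> r = s"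
    and lift: "(\<And>i. i < n \<Longrightarrow> a i \<in> carrier (F i)) \<Longrightarrow> \<exists>r\<in>carrier R. \<forall>i<n. \<pi> i r = a i"
begin

lemma \<pi>_simps:
  assumes "i < n"
  shows "r \<in> carrier R \<Longrightarrow> \<pi> i r \<in> carrier (F i)"
    "r \<in> carrier R \<Longrightarrow> s \<in> carrier R \<Longrightarrow> \<pi> i (r \<otimes> s) = \<pi> i r \<otimes>\<^bsub>F i\<^esub> \<pi> i s"
    "r \<in> carrier R \<Longrightarrow> s \<in> carrier R \<Longrightarrow> \<pi> i (r \<oplus> s) = \<pi> i r \<oplus>\<^bsub>F i\<^esub> \<pi> i s"
    "\<pi> i \<one> = \<one>\<^bsub>F i\<^esub>" "\<pi> i \<zero> = \<zero>\<^bsub>F i\<^esub>"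
proof -
  have "ring (F i)" using field[OF assms] by (simp add: field.is_ring)
  then show "\<pi> i \<zero> = \<zero>\<^bsub>F i\<^esub>" using ring_hom_zero[OF hom[OF assms] ring_axioms] by simp
qed (use ring_hom_closed[OF hom[OF assms]] ring_hom_mult[OF hom[OF assms]] ring_hom_add[OF hom[OF assms]]
    ring_hom_one[OF hom[OF assms]] in auto)

text \<open>An ideal of a product of fields contains the indicator of the set of coordinates in
  which it is nonzero. The indicator is assembled one coordinate at a time.\<close>

lemma ideal_idempotent:
  assumes J: "left_ideal J R"
  obtains \<epsilon> where "\<epsilon> \<in> J" "\<And>i. i < n \<Longrightarrow> \<pi> i \<epsilon> = (if \<exists>r\<in>J. \<pi> i r \<noteq> \<zero>\<^bsub>F i\<^esub> then \<one>\<^bsub>F i\<^esub> else \<zero>\<^bsub>F i\<^esub>)"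
proof -
  define v where "v i = (if \<exists>r\<in>J. \<pi> i r \<noteq> \<zero>\<^bsub>F i\<^esub> then \<one>\<^bsub>F i\<^esub> else \<zero>\<^bsub>F i\<^esub>)" for i
  note JR = left_ideal_subset[OF J]
  have "\<exists>\<epsilon>\<in>J. \<forall>i<n. \<pi> i \<epsilon> = (if i < m then v i else \<zero>\<^bsub>F i\<^esub>)" if "m \<le> n" for m
    using that
  proof (induction m)
    case 0
    show ?case using left_ideal_zero[OF J] \<pi>_simps(5) by (intro bexI[of _ \<zero>]) auto
  next
    case (Suc m)
    then obtain \<epsilon> where \<epsilon>: "\<epsilon> \<in> J" "\<And>i. i < n \<Longrightarrow> \<pi> i \<epsilon> = (if i < m then v i else \<zero>\<^bsub>F i\<^esub>)" by auto
    have m: "m < n" using Suc by simp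
    interpret Fm: field "F m" by (rule field[OF m])
    show ?case
    proof (cases "\<exists>r\<in>J. \<pi> m r \<noteq> \<zero>\<^bsub>F m\<^esub>")
      case True
      then obtain r where r: "r \<in> J" "\<pi> m r \<noteq> \<zero>\<^bsub>F m\<^esub>" by blast
      have rR: "r \<in> carrier R" using r JR by auto
      have u: "\<pi> m r \<in> Units (F m)" using r \<pi>_simps(1)[OF m rR] by (simp add: Fm.field_Units)
      \<comment> \<open>The multiplier inverts \<open>r\<close> in coordinate \<open>m\<close> and
        kills every other coordinate, so adding \<open>s \<otimes> r\<close> changes
        \<open>\<epsilon>\<close> at \<open>m\<close> only.\<close>
      have "\<exists>s\<in>carrier R. \<forall>i<n. \<pi> i s = (if i = m then inv\<^bsub>F m\<^esub> (\<pi> m r) else \<zero>\<^bsub>F i\<^esub>)"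
      proof (rule lift)
        fix i assume i: "i < n"
        interpret Fi: field "F i" by (rule field[OF i])
        show "(if i = m then inv\<^bsub>F m\<^esub> (\<pi> m r) else \<zero>\<^bsub>F i\<^esub>) \<in> carrier (F i)" using u by auto
      qed
      then obtain s where s: "s \<in> carrier R" "\<And>i. i < n \<Longrightarrow> \<pi> i s = (if i = m then inv\<^bsub>F m\<^esub> (\<pi> m r) else \<zero>\<^bsub>F i\<^esub>)"
        by blast
      have "\<epsilon> \<oplus> s \<otimes> r \<in> J" using left_ideal_add[OF J \<epsilon>(1) left_ideal_mult[OF J s(1) r(1)]] .
      moreover have "\<pi> i (\<epsilon> \<oplus> s \<otimes> r) = (if i < Suc m then v i else \<zero>\<^bsub>F i\<^esub>)" if i: "i < n" for i
      proof -
        interpret Fi: field "F i" by (rule field[OF i])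
        have vi: "v i \<in> carrier (F i)" by (simp add: v_def)
        have "\<pi> i (\<epsilon> \<oplus> s \<otimes> r) = \<pi> i \<epsilon> \<oplus>\<^bsub>F i\<^esub> \<pi> i s \<otimes>\<^bsub>F i\<^esub> \<pi> i r"
          using i \<epsilon> s rR JR by (simp add: \<pi>_simps subset_iff)
        also have "\<dots> = (if i < Suc m then v i else \<zero>\<^bsub>F i\<^esub>)"
        proof (cases "i = m")
          case True
          have "v m = \<one>\<^bsub>F m\<^esub>" using r by (auto simp: v_def)
          then show ?thesis using \<epsilon>(2)[OF i] s(2)[OF i] u True Fm.Units_l_inv[OF u] by simp
        next
          case False
          then show ?thesis using \<epsilon>(2)[OF i] s(2)[OF i] vi \<pi>_simps(1)[OF i rR] by (simp add: less_Suc_eq)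
        qed
        finally show ?thesis .
      qed
      ultimately show ?thesis by blast
    next
      case False
      then have "v m = \<zero>\<^bsub>F m\<^esub>" by (simp add: v_def)
      then show ?thesis using \<epsilon> by (intro bexI[of _ \<epsilon>]) (auto simp: less_Suc_eq)
    qed
  qed
  from this[of n] show ?thesis using that by (auto simp: v_def)
qed

lemma ideal_right_unit:
  assumes J: "left_ideal J R"
  shows "\<exists>\<epsilon>\<in>J. \<forall>r\<in>J. r \<otimes> \<epsilon> = r"
proof -
  obtain \<epsilon> where \<epsilon>: "\<epsilon> \<in> J" "\<And>i. i < n \<Longrightarrow> \<pi> i \<epsilon> = (if \<exists>r\<in>J. \<pi> i r \<noteq> \<zero>\<^bsub>F i\<^esub> then \<one>\<^bsub>F i\<^esub> else \<zero>\<^bsub>F i\<^esub>)"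
    by (rule ideal_idempotent[OF J]) (rule that)
  note JR = left_ideal_subset[OF J]
  have "r \<otimes> \<epsilon> = r" if r: "r \<in> J" for r
  proof (rule separate)
    show rR: "r \<in> carrier R" "r \<otimes> \<epsilon> \<in> carrier R" using r \<epsilon> JR by auto
    fix i assume i: "i < n"
    interpret Fi: field "F i" by (rule field[OF i])
    have c: "\<pi> i r \<in> carrier (F i)" using \<pi>_simps(1)[OF i] r JR by auto
    have "\<pi> i (r \<otimes> \<epsilon>) = \<pi> i r \<otimes>\<^bsub>F i\<^esub> \<pi> i \<epsilon>" using i r \<epsilon>(1) JR by (simp add: \<pi>_simps subset_iff)
    then show "\<pi> i (r \<otimes> \<epsilon>) = \<pi> i r" using \<epsilon>(2)[OF i] c r by auto
  qed
  then show ?thesis using \<epsilon>(1) by blast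
qed

text \<open>An ideal is determined by the set of coordinates in which it is nonzero, so a chain of
  ideals is a chain of subsets of a finite set.\<close>

lemma artinian: "artinian R"
  unfolding artinian_iff chain_condition_def
proof (intro allI impI)
  fix I assume I: "(\<forall>k. left_ideal (I k) R) \<and> chain False I"
  define T where "T X = {i. i < n \<and> (\<exists>r\<in>X. \<pi> i r \<noteq> \<zero>\<^bsub>F i\<^esub>)}" for X
  have "chain False (\<lambda>k. T (I k))"
    by (rule chain_image[where I = I and F = T]) (use I in \<open>auto simp: T_def\<close>)
  then have "stabilizes (\<lambda>k. T (I k))" by (rule stabilizes_finite[of _ _ "{..<n}"]) (auto simp: T_def)
  then show "stabilizes I"
  proof (rule stabilizes_inverse[where F = T])
    fix k
    have J: "left_ideal (I k) R" using I by blast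
    note JR = left_ideal_subset[OF J]
    obtain \<epsilon> where \<epsilon>: "\<epsilon> \<in> I k" "\<And>i. i < n \<Longrightarrow> \<pi> i \<epsilon> = (if \<exists>r\<in>I k. \<pi> i r \<noteq> \<zero>\<^bsub>F i\<^esub> then \<one>\<^bsub>F i\<^esub> else \<zero>\<^bsub>F i\<^esub>)"
      by (rule ideal_idempotent[OF J]) (rule that)
    have "r \<in> I k" if r: "r \<in> carrier R" "\<forall>i<n. i \<notin> T (I k) \<longrightarrow> \<pi> i r = \<zero>\<^bsub>F i\<^esub>" for r
    proof -
      have "r \<otimes> \<epsilon> = r"
      proof (rule separate)
        show "r \<in> carrier R" "r \<otimes> \<epsilon> \<in> carrier R" using r \<epsilon> JR by auto
        fix i assume i: "i < n"
        interpret Fi: field "F i" by (rule field[OF i])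
        have c: "\<pi> i r \<in> carrier (F i)" using \<pi>_simps(1)[OF i] r by auto
        have "\<pi> i (r \<otimes> \<epsilon>) = \<pi> i r \<otimes>\<^bsub>F i\<^esub> \<pi> i \<epsilon>" using i r \<epsilon>(1) JR by (simp add: \<pi>_simps subset_iff)
        then show "\<pi> i (r \<otimes> \<epsilon>) = \<pi> i r" using \<epsilon>(2)[OF i] c r i by (auto simp: T_def)
      qed
      then show ?thesis using left_ideal_mult[OF J r(1) \<epsilon>(1)] by simp
    qed
    then show "I k = (\<lambda>T. {r \<in> carrier R. \<forall>i<n. i \<notin> T \<longrightarrow> \<pi> i r = \<zero>\<^bsub>F i\<^esub>}) (T (I k))"
      using JR by (auto simp: T_def)
  qed
qed

text \<open>The integer is nonzero, hence invertible, in every coordinate, and \<open>lift\<close>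
  collects the inverses.\<close>

lemma nat_unit:
  assumes "\<And>i. i < n \<Longrightarrow> \<not> characteristic (F i) dvd m"
  shows "\<exists>\<beta>\<in>carrier R. \<beta> \<otimes> add_pow R m \<one> = \<one>"
proof -
  have pm: "\<pi> i (add_pow R k \<one>) = add_pow (F i) k \<one>\<^bsub>F i\<^esub>" if i: "i < n" for i and k :: nat
  proof -
    interpret Fi: field "F i" by (rule field[OF i])
    show ?thesis by (induction k) (simp_all add: \<pi>_simps[OF i])
  qed
  have u: "\<pi> i (add_pow R m \<one>) \<in> Units (F i)" if i: "i < n" for i
  proof -
    interpret Fi: field "F i" by (rule field[OF i])
    show ?thesis using assms[OF i] Fi.characteristic_dvd_iff pm[OF i] by (simp add: Fi.field_Units)
  qed
  have "\<exists>\<beta>\<in>carrier R. \<forall>i<n. \<pi> i \<beta> = inv\<^bsub>F i\<^esub> (\<pi> i (add_pow R m \<one>))"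
  proof (rule lift)
    fix i assume i: "i < n"
    interpret Fi: field "F i" by (rule field[OF i])
    show "inv\<^bsub>F i\<^esub> (\<pi> i (add_pow R m \<one>)) \<in> carrier (F i)" using u[OF i] by simp
  qed
  then obtain \<beta> where \<beta>: "\<beta> \<in> carrier R" "\<And>i. i < n \<Longrightarrow> \<pi> i \<beta> = inv\<^bsub>F i\<^esub> (\<pi> i (add_pow R m \<one>))" by blast
  have "\<beta> \<otimes> add_pow R m \<one> = \<one>"
  proof (rule separate)
    fix i assume i: "i < n"
    interpret Fi: field "F i" by (rule field[OF i])
    show "\<pi> i (\<beta> \<otimes> add_pow R m \<one>) = \<pi> i \<one>"
      using \<beta>(1) \<beta>(2)[OF i] u[OF i] by (simp add: \<pi>_simps[OF i])
  qed (use \<beta> in auto)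
  then show ?thesis using \<beta>(1) by blast
qed

end

section \<open>Lists of fields, coordinate maps and idempotents\<close>

lemma product_of_fields_RDirProd_list:
  fixes R :: "('r, 'm) ring_scheme" (structure) and Fs :: "'b ring list"
  assumes R: "cring R" and iso: "R \<simeq> RDirProd_list Fs" and F: "\<forall>F\<in>set Fs. field F"
  obtains \<pi> where "product_of_fields R (length Fs) ((!) Fs) \<pi>"
proof -
  interpret cring R by (rule R)
  obtain \<phi> where \<phi>: "\<phi> \<in> ring_hom R (RDirProd_list Fs)" "bij_betw \<phi> (carrier R) (carrier (RDirProd_list Fs))"
    using iso by (auto simp: is_ring_iso_def ring_iso_def)
  have mem: "\<phi> r \<in> carrier (RDirProd_list Fs)" if "r \<in> carrier R" for r
    using ring_hom_closed[OF \<phi>(1) that] .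
  have "product_of_fields R (length Fs) ((!) Fs) (\<lambda>i r. \<phi> r ! i)"
  proof (intro product_of_fields.intro product_of_fields_axioms.intro R)
    fix i assume i: "i < length Fs"
    show "field (Fs ! i)" using F i by simp
    show "(\<lambda>r. \<phi> r ! i) \<in> ring_hom R (Fs ! i)"
    proof (rule ring_hom_memI)
      show "\<phi> \<one> ! i = \<one>\<^bsub>Fs ! i\<^esub>" using ring_hom_one[OF \<phi>(1)] i by (simp add: RDirProd_list_one_nth)
    qed (use mem i RDirProd_list_carrier_mem(2)[OF mem] RDirProd_list_nth[OF mem mem i]
        ring_hom_mult[OF \<phi>(1)] ring_hom_add[OF \<phi>(1)] in auto)
  next
    fix r s assume rs: "r \<in> carrier R" "s \<in> carrier R" "\<And>i. i < length Fs \<Longrightarrow> \<phi> r ! i = \<phi> s ! i"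
    have "\<phi> r = \<phi> s"
      using RDirProd_list_carrier_mem(1)[OF mem] rs by (intro nth_equalityI) auto
    then show "r = s" using \<phi>(2) rs by (auto simp: bij_betw_def dest: inj_onD)
  next
    fix a assume a: "\<And>i. i < length Fs \<Longrightarrow> a i \<in> carrier (Fs ! i)"
    have "map a [0..<length Fs] \<in> carrier (RDirProd_list Fs)"
      by (rule RDirProd_list_carrier_memI) (use a in auto)
    then obtain r where "r \<in> carrier R" "\<phi> r = map a [0..<length Fs]" using \<phi>(2) by (metis bij_betw_iff_bijections)
    then show "\<exists>r\<in>carrier R. \<forall>i<length Fs. \<phi> r ! i = a i" by (intro bexI[of _ r]) auto
  qed
  then show ?thesis by (rule that)
qed

text \<open>The factor of \<open>R\<close> cut out by an idempotent, with the idempotent as its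
  unit. Its elements are elements of \<open>R\<close>, so all factors share one type and fit into a
  list.\<close>

definition corner_ring :: "('r, 'm) ring_scheme \<Rightarrow> 'r \<Rightarrow> 'r ring" where
  "corner_ring R e = \<lparr>carrier = left_principal R e, mult = mult R, one = e, zero = zero R, add = add R\<rparr>"

lemma corner_ring_simps [simp]:
  "carrier (corner_ring R e) = left_principal R e" "mult (corner_ring R e) = mult R"
  "one (corner_ring R e) = e" "zero (corner_ring R e) = zero R" "add (corner_ring R e) = add R"
  by (simp_all add: corner_ring_def)

text \<open>By simplicity a nonzero \<open>a\<close> generates the whole ideal, so
  \<open>e = b \<otimes> a\<close> for some \<open>b\<close>. As \<open>b\<close> may lie outside
  the corner, the inverse is \<open>b \<otimes> e\<close>.\<close>

lemma (in cring) field_corner_ring: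
  assumes e: "e \<in> carrier R" "e \<otimes> e = e" and simple: "simple_left_ideal (left_principal R e) R"
  shows "field (corner_ring R e)"
proof -
  note P = left_ideal_principal[OF e(1)]
  have PR: "x \<in> left_principal R e \<Longrightarrow> x \<in> carrier R" for x using left_ideal_subset[OF P] by auto
  have xe: "x \<in> left_principal R e \<Longrightarrow> x \<otimes> e = x" for x by (rule left_principal_idempotent[OF e])
  have "cring (corner_ring R e)"
  proof (rule cringI)
    show "abelian_group (corner_ring R e)"
    proof (rule abelian_groupI; simp)
      show "\<And>x y. x \<in> left_principal R e \<Longrightarrow> y \<in> left_principal R e \<Longrightarrow> x \<oplus> y \<in> left_principal R e"
        by (rule left_ideal_add[OF P])
      show "\<zero> \<in> left_principal R e" by (rule left_ideal_zero[OF P])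
      show "\<exists>y\<in>left_principal R e. y \<oplus> x = \<zero>" if "x \<in> left_principal R e" for x
        using left_ideal_neg[OF P that] PR[OF that] by (intro bexI[of _ "\<ominus> x"]) (auto simp: l_neg)
    qed (use PR in \<open>auto simp: a_ac\<close>)
    show "comm_monoid (corner_ring R e)"
    proof (rule comm_monoidI; simp)
      show "\<And>x y. x \<in> left_principal R e \<Longrightarrow> y \<in> left_principal R e \<Longrightarrow> x \<otimes> y \<in> left_principal R e"
        using left_ideal_mult[OF P] PR by blast
      show "e \<in> left_principal R e" by (rule principal_self[OF e(1)])
      show "e \<otimes> x = x" if "x \<in> left_principal R e" for x using xe[OF that] PR[OF that] e(1) by (simp add: m_comm)
    qed (use PR in \<open>auto simp: m_ac\<close>)
  qed (use PR in \<open>auto simp: l_distr\<close>)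
  then interpret K: cring "corner_ring R e" .
  have e0: "e \<noteq> \<zero>"
  proof
    assume "e = \<zero>"
    then have "left_principal R e = {\<zero>}" by (auto simp: left_principal_def intro!: exI[of _ \<zero>])
    then show False using simple by (simp add: simple_left_ideal_def)
  qed
  show ?thesis
  proof (rule K.cring_fieldI2)
    show "\<zero>\<^bsub>corner_ring R e\<^esub> \<noteq> \<one>\<^bsub>corner_ring R e\<^esub>" using e0 by simp
    fix a assume a: "a \<in> carrier (corner_ring R e)" "a \<noteq> \<zero>\<^bsub>corner_ring R e\<^esub>"
    then have "left_principal R a = left_principal R e"
      using simple_left_ideal_eq_principal[OF simple] by simp
    then have "e \<in> left_principal R a" using principal_self[OF e(1)] by simp
    then obtain b where b: "b \<in> carrier R" "e = b \<otimes> a" by (auto simp: left_principal_def)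
    have aR: "a \<in> carrier R" using a PR by simp
    have "a \<otimes> (b \<otimes> e) = (b \<otimes> a) \<otimes> e" using aR b(1) e(1) by (simp add: m_ac)
    then have "a \<otimes> (b \<otimes> e) = e" using b(2)[symmetric] e by simp
    moreover have "b \<otimes> e \<in> left_principal R e" using b(1) by (auto simp: left_principal_def)
    ultimately show "\<exists>b\<in>carrier (corner_ring R e). a \<otimes>\<^bsub>corner_ring R e\<^esub> b = \<one>\<^bsub>corner_ring R e\<^esub>" by auto
  qed
qed

text \<open>In a commutative ring, multiplication by each idempotent of an orthogonal decomposition
  of the unit gives the Peirce decomposition into corners, and simplicity of their ideals makes the
  corners fields. Integers invertible in \<open>R\<close> stay invertible in each of them.\<close>

lemma (in cring) artinian_regular_product_of_fields:
  assumes art: "artinian R" and reg: "von_neumann_regular R"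
    and unit: "\<And>m. m \<in> N \<Longrightarrow> \<exists>\<beta>\<in>carrier R. \<beta> \<otimes> add_pow R (m::nat) \<one> = \<one>"
  shows "\<exists>Fs :: 'a ring list. R \<simeq> RDirProd_list Fs \<and>
     (\<forall>F\<in>set Fs. field F \<and> (\<forall>m\<in>N. \<not> characteristic F dvd m))"
proof -
  obtain E where E: "finite E" "E \<subseteq> carrier R" "\<And>f. f \<in> E \<Longrightarrow> f \<otimes> f = f"
    "\<And>f. f \<in> E \<Longrightarrow> simple_left_ideal (left_principal R f) R"
    "\<And>f g. f \<in> E \<Longrightarrow> g \<in> E \<Longrightarrow> f \<noteq> g \<Longrightarrow> f \<otimes> g = \<zero>" "(\<Oplus>f\<in>E. f) = \<one>"
    by (rule artinian_regular_idempotents[OF art reg]) (rule that)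
  obtain es where es: "set es = E" "distinct es" using finite_distinct_list[OF E(1)] by blast
  define Fs where "Fs = map (corner_ring R) es"
  have len: "length Fs = length es" by (simp add: Fs_def)
  have esE: "es ! i \<in> E" "es ! i \<in> carrier R" if "i < length es" for i using that es(1) E(2) by auto
  have orth: "es ! i \<otimes> es ! j = \<zero>" if "i < length es" "j < length es" "i \<noteq> j" for i j
    using E(5)[OF esE(1)[OF that(1)] esE(1)[OF that(2)]] es(2) that by (simp add: nth_eq_iff_index_eq)
  define \<phi> where "\<phi> r = map (\<lambda>e. r \<otimes> e) es" for r
  have mem: "\<phi> r \<in> carrier (RDirProd_list Fs)" if "r \<in> carrier R" for r
    by (rule RDirProd_list_carrier_memI) (use that in \<open>auto simp: \<phi>_def Fs_def left_principal_def\<close>)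
  have ring: "ring (RDirProd_list Fs)"
    by (rule RDirProd_list_is_ring)
      (use field_corner_ring[OF esE(2) E(3)[OF esE(1)] E(4)[OF esE(1)]] in \<open>auto simp: Fs_def intro: field.is_ring\<close>)
  interpret P: ring "RDirProd_list Fs" by (rule ring)
  have lenP: "length as = length es" if "as \<in> carrier (RDirProd_list Fs)" for as
    using RDirProd_list_carrier_mem(1)[OF that] len by simp
  have eq: "as = bs" if "as \<in> carrier (RDirProd_list Fs)" "bs \<in> carrier (RDirProd_list Fs)"
    "\<And>i. i < length es \<Longrightarrow> as ! i = bs ! i" for as bs
    using that lenP by (intro nth_equalityI) auto
  have "\<phi> \<in> ring_iso R (RDirProd_list Fs)"
    unfolding ring_iso_def
  proof (intro CollectI conjI)
    show "\<phi> \<in> ring_hom R (RDirProd_list Fs)"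
    proof (rule ring_hom_memI)
      fix r s assume rs: "r \<in> carrier R" "s \<in> carrier R"
      show "\<phi> (r \<otimes> s) = \<phi> r \<otimes>\<^bsub>RDirProd_list Fs\<^esub> \<phi> s"
      proof (rule eq)
        fix i assume i: "i < length es"
        have "(r \<otimes> es ! i) \<otimes> (s \<otimes> es ! i) = (r \<otimes> s) \<otimes> (es ! i \<otimes> es ! i)"
          using rs esE[OF i] by (simp add: m_ac)
        then show "\<phi> (r \<otimes> s) ! i = (\<phi> r \<otimes>\<^bsub>RDirProd_list Fs\<^esub> \<phi> s) ! i"
          using i rs mem RDirProd_list_nth(1)[of "\<phi> r" Fs "\<phi> s" i] E(3)[OF esE(1)[OF i]]
          by (simp add: \<phi>_def Fs_def)
      qed (use rs mem in auto)
      show "\<phi> (r \<oplus> s) = \<phi> r \<oplus>\<^bsub>RDirProd_list Fs\<^esub> \<phi> s"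
      proof (rule eq)
        fix i assume i: "i < length es"
        then show "\<phi> (r \<oplus> s) ! i = (\<phi> r \<oplus>\<^bsub>RDirProd_list Fs\<^esub> \<phi> s) ! i"
          using rs mem RDirProd_list_nth(2)[of "\<phi> r" Fs "\<phi> s" i] esE[OF i]
          by (simp add: \<phi>_def Fs_def l_distr)
      qed (use rs mem in auto)
    next
      show "\<phi> \<one> = \<one>\<^bsub>RDirProd_list Fs\<^esub>"
        using E(2) es(1) by (auto simp: \<phi>_def Fs_def RDirProd_list_one_nth intro!: nth_equalityI)
    qed (rule mem)
    show "bij_betw \<phi> (carrier R) (carrier (RDirProd_list Fs))"
    proof (rule bij_betwI')
      fix r s assume rs: "r \<in> carrier R" "s \<in> carrier R"
      show "\<phi> r = \<phi> s \<longleftrightarrow> r = s"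
      proof
        assume "\<phi> r = \<phi> s"
        then have "\<forall>e\<in>E. r \<otimes> e = s \<otimes> e" using es(1) by (auto simp: \<phi>_def)
        then have "(\<Oplus>e\<in>E. r \<otimes> e) = (\<Oplus>e\<in>E. s \<otimes> e)"
          by (intro finsum_cong') (use rs E(2) in auto)
        then have "r \<otimes> (\<Oplus>e\<in>E. e) = s \<otimes> (\<Oplus>e\<in>E. e)"
          using rs E(1,2) by (subst (1 2) finsum_rdistr) auto
        then show "r = s" using E(6) rs by simp
      qed simp
    next
      fix as assume as: "as \<in> carrier (RDirProd_list Fs)"
      have c: "as ! i \<in> left_principal R (es ! i)" if "i < length es" for i
        using RDirProd_list_carrier_mem(2)[OF as, of i] that by (simp add: Fs_def)
      have cR: "as ! i \<in> carrier R" if "i < length es" for i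
        using c[OF that] left_ideal_subset[OF left_ideal_principal[OF esE(2)[OF that]]] by auto
      \<comment> \<open>The preimage of a list is the sum of its entries: by orthogonality,
        multiplying by \<open>es ! j\<close> selects the entry at \<open>j\<close>.\<close>
      define r where "r = (\<Oplus>i\<in>{..<length es}. as ! i)"
      have r: "r \<in> carrier R" unfolding r_def using cR by (intro finsum_closed) auto
      have "as = \<phi> r"
      proof (rule eq[OF as mem[OF r]])
        fix j assume j: "j < length es"
        have "r \<otimes> es ! j = (\<Oplus>i\<in>{..<length es}. as ! i \<otimes> es ! j)"
          unfolding r_def by (rule finsum_ldistr) (use cR esE(2)[OF j] in auto)
        also have "\<dots> = (\<Oplus>i\<in>{..<length es}. if j = i then as ! i else \<zero>)"
        proof (rule finsum_cong')
          fix i assume "i \<in> {..<length es}"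
          then have i: "i < length es" by simp
          obtain b where b: "b \<in> carrier R" "as ! i = b \<otimes> es ! i" using c[OF i] by (auto simp: left_principal_def)
          have "as ! i \<otimes> es ! j = b \<otimes> (es ! i \<otimes> es ! j)" using b esE(2)[OF i] esE(2)[OF j] by (simp add: m_assoc)
          then show "as ! i \<otimes> es ! j = (if j = i then as ! i else \<zero>)"
            using orth[OF i j] b E(3)[OF esE(1)[OF j]] by auto
        qed (use cR in auto)
        also have "\<dots> = as ! j" by (rule finsum_singleton) (use j cR in auto)
        finally show "as ! j = \<phi> r ! j" using j by (simp add: \<phi>_def)
      qed
      then show "\<exists>r\<in>carrier R. as = \<phi> r" using r by blast
    qed (use mem in auto)
  qed
  then have "R \<simeq> RDirProd_list Fs" unfolding is_ring_iso_def by blast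
  moreover have "field F \<and> (\<forall>m\<in>N. \<not> characteristic F dvd m)" if "F \<in> set Fs" for F
  proof -
    obtain e where e: "e \<in> E" "F = corner_ring R e" using \<open>F \<in> set Fs\<close> es(1) by (auto simp: Fs_def)
    have eR: "e \<in> carrier R" using e E(2) by auto
    have fF: "field F" unfolding e(2) by (rule field_corner_ring[OF eR E(3)[OF e(1)] E(4)[OF e(1)]])
    interpret F: field F by (rule fF)
    have e0: "e \<noteq> \<zero>" using F.one_not_zero by (simp add: e(2))
    have "\<not> characteristic F dvd m" if m: "m \<in> N" for m
    proof
      assume "characteristic F dvd m"
      then have "add_pow F m e = \<zero>" using F.characteristic_dvd_iff[of m] by (simp add: e(2))
      moreover have "add_pow F k e = add_pow R k e" for k :: nat
        by (induction k) (simp_all add: e(2) add_pow_def nat_pow_def)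
      ultimately have z: "add_pow R m e = \<zero>" by simp
      obtain \<beta> where \<beta>: "\<beta> \<in> carrier R" "\<beta> \<otimes> add_pow R m \<one> = \<one>" using unit[OF m] by blast
      \<comment> \<open>With an inverse of \<open>m\<close> in \<open>R\<close> at hand, the
        vanishing of \<open>m\<close> times \<open>e\<close> would force
        \<open>e = \<zero>\<close>.\<close>
      have "e = e \<otimes> (\<beta> \<otimes> add_pow R m \<one>)" using \<beta>(2) eR by simp
      also have "\<dots> = \<beta> \<otimes> (e \<otimes> add_pow R m \<one>)" using \<beta>(1) eR by (simp add: m_lcomm)
      also have "e \<otimes> add_pow R m \<one> = add_pow R m e" using add_pow_rdistr[OF eR one_closed, of m] eR by simp
      finally show False using z \<beta>(1) e0 by simp
    qed
    then show ?thesis using fF by blast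
  qed
  ultimately show ?thesis by blast
qed

section \<open>Compact open bisections\<close>

context ample_groupoid
begin

text \<open>Injectivity of \<open>src\<close> leaves at most one term in a convolution with the
  characteristic function of \<open>B\<close>; injectivity of \<open>tgt\<close> makes right
  multiplication by \<open>B\<close> cancellable, which preserves the Hausdorff property.\<close>

definition bisection where
  "bisection B \<longleftrightarrow> compact_open (arrows G) B \<and> inj_on src B \<and> inj_on tgt B"

lemma compact_open_subset: "compact_open X U \<Longrightarrow> U \<subseteq> topspace X"
  by (simp add: compact_open_def openin_subset)

lemma bisection_subset: "bisection B \<Longrightarrow> B \<subseteq> Arr"
  by (auto simp: bisection_def dest: compact_open_subset)

lemma src_open_map:
  assumes U: "openin (arrows G) U"
  shows "openin (objects G) (src ` U)"
proof (subst openin_subopen, intro ballI)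
  fix y assume "y \<in> src ` U"
  then obtain g where g: "g \<in> U" "y = src g" by auto
  then have gA: "g \<in> Arr" using U openin_subset by blast
  obtain V where V: "openin (arrows G) V" "g \<in> V" "openin (objects G) (src ` V)"
    "homeomorphic_map (subtopology (arrows G) V) (subtopology (objects G) (src ` V)) src"
    using local_homeomorphism_dmap gA unfolding local_homeomorphism_def by blast
  have "openin (subtopology (arrows G) V) (U \<inter> V)" using U V(1) by (simp add: openin_subtopology_Int)
  then have "openin (subtopology (objects G) (src ` V)) (src ` (U \<inter> V))"
    using homeomorphic_imp_open_map[OF V(4)] by (simp add: open_map_def)
  then have "openin (objects G) (src ` (U \<inter> V))" using V(3) openin_trans_full by blast
  then show "\<exists>T. openin (objects G) T \<and> y \<in> T \<and> T \<subseteq> src ` U" using g V(2) by (intro exI[of _ "src ` (U \<inter> V)"]) auto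
qed

lemma locally_injective:
  assumes g: "g \<in> Arr"
  obtains V where "openin (arrows G) V" "g \<in> V" "inj_on src V"
proof -
  obtain V where V: "openin (arrows G) V" "g \<in> V"
    "homeomorphic_map (subtopology (arrows G) V) (subtopology (objects G) (src ` V)) src"
    using local_homeomorphism_dmap g unfolding local_homeomorphism_def by blast
  have "topspace (subtopology (arrows G) V) = V" using openin_subset[OF V(1)] by auto
  then show ?thesis using that V homeomorphic_imp_injective_map[OF V(3)] by simp
qed

lemma src_homeomorphic:
  assumes V: "openin (arrows G) V" "inj_on src V"
  shows "homeomorphic_map (subtopology (arrows G) V) (subtopology (objects G) (src ` V)) src"
proof (rule bijective_open_imp_homeomorphic_map)
  have VA: "V \<subseteq> Arr" using V openin_subset by blast
  have top: "topspace (subtopology (arrows G) V) = V" using VA by auto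
  show "continuous_map (subtopology (arrows G) V) (subtopology (objects G) (src ` V)) src"
    by (rule continuous_map_into_subtopology[OF continuous_map_from_subtopology[OF continuous_dmap]]) auto
  show "open_map (subtopology (arrows G) V) (subtopology (objects G) (src ` V)) src"
    unfolding open_map_def
  proof (intro allI impI)
    fix W assume "openin (subtopology (arrows G) V) W"
    then have W: "openin (arrows G) W" "W \<subseteq> V"
      using V(1) openin_trans_full openin_imp_subset by blast+
    then show "openin (subtopology (objects G) (src ` V)) (src ` W)"
      using src_open_map[OF W(1)] by (auto simp: openin_subtopology intro!: exI[of _ "src ` W"])
  qed
  show "src ` topspace (subtopology (arrows G) V) = topspace (subtopology (objects G) (src ` V))"
    using VA top by auto
  show "inj_on src (topspace (subtopology (arrows G) V))" using V(2) top by simp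
qed

text \<open>Compact open bisections form a base of the arrow space even if it is not Hausdorff:
  shrink to an open set on which both endpoint maps are injective, then pull back a compact open set
  of objects along \<open>src\<close>.\<close>

lemma exists_bisection:
  assumes U: "openin (arrows G) U" and g: "g \<in> U"
  obtains B where "bisection B" "g \<in> B" "B \<subseteq> U"
proof -
  have gA: "g \<in> Arr" using U g openin_subset by blast
  obtain V1 where V1: "openin (arrows G) V1" "g \<in> V1" "inj_on src V1" using locally_injective[OF gA] .
  \<comment> \<open>Inversion exchanges the endpoint maps, so local injectivity of
    \<open>src\<close> at the inverse of \<open>g\<close> yields local injectivity of
    \<open>tgt\<close> at \<open>g\<close>.\<close>
  obtain V2 where V2: "openin (arrows G) V2" "ivt g \<in> V2" "inj_on src V2"
    using locally_injective[OF inv_closed[OF gA]] .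
  define V where "V = U \<inter> V1 \<inter> {h \<in> Arr. ivt h \<in> V2}"
  have VA: "V \<subseteq> Arr" by (auto simp: V_def)
  have Vo: "openin (arrows G) V"
    unfolding V_def using U V1(1) openin_continuous_map_preimage[OF continuous_inv V2(1)]
    by (intro openin_Int) auto
  have gV: "g \<in> V" using g gA V1(2) V2(2) by (simp add: V_def)
  have inj: "inj_on src V" using V1(3) by (rule inj_on_subset) (auto simp: V_def)
  have injt: "inj_on tgt V"
  proof (rule inj_onI)
    fix h k assume hk: "h \<in> V" "k \<in> V" "tgt h = tgt k"
    then have "src (ivt h) = src (ivt k)" "ivt h \<in> V2" "ivt k \<in> V2" "h \<in> Arr" "k \<in> Arr" by (auto simp: V_def)
    then have "ivt h = ivt k" by (intro inj_onD[OF V2(3)])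
    then have "ivt (ivt h) = ivt (ivt k)" by simp
    then show "h = k" using \<open>h \<in> Arr\<close> \<open>k \<in> Arr\<close> by simp
  qed
  obtain \<B> where \<B>: "\<forall>K\<in>\<B>. compact_open (objects G) K"
     "\<forall>U. openin (objects G) U \<longrightarrow> (\<exists>\<C>. \<C> \<subseteq> \<B> \<and> U = \<Union>\<C>)"
    using compact_open_basis by (elim exE conjE) (rule that)
  obtain \<C> where \<C>: "\<C> \<subseteq> \<B>" "src ` V = \<Union>\<C>" using \<B>(2)[rule_format, OF src_open_map[OF Vo]] by (elim exE conjE) (rule that)
  then obtain K where K: "K \<in> \<C>" "src g \<in> K" using gV by blast
  have Kc: "compact_open (objects G) K" and KV: "K \<subseteq> src ` V" using \<B>(1) \<C> K by auto
  define B where "B = V \<inter> {h \<in> Arr. src h \<in> K}"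
  have BV: "B \<subseteq> V" by (auto simp: B_def)
  have Bo: "openin (arrows G) B"
    unfolding B_def using Vo openin_continuous_map_preimage[OF continuous_dmap, of K] Kc
    by (intro openin_Int) (auto simp: compact_open_def)
  have im: "src ` B = K" using KV VA by (auto simp: B_def)
  have "compactin (subtopology (objects G) (src ` V)) (src ` B)"
    using Kc KV im by (simp add: compactin_subtopology compact_open_def)
  then have "compactin (subtopology (arrows G) V) B"
    using homeomorphic_map_compactness[OF src_homeomorphic[OF Vo inj], of B] BV VA by auto
  then have Bc: "compactin (arrows G) B" by (simp add: compactin_subtopology)
  have injB: "inj_on src B" "inj_on tgt B" using inj injt BV inj_on_subset by blast+
  have "Hausdorff_space (subtopology (arrows G) B)"
  proof (rule Hausdorff_space_injective_preimage[OF Hausdorff_objects])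
    show "continuous_map (subtopology (arrows G) B) (objects G) src"
      by (rule continuous_map_from_subtopology[OF continuous_dmap])
    show "inj_on src (topspace (subtopology (arrows G) B))" using injB(1) by (rule inj_on_subset) auto
  qed
  then have "bisection B" using Bo Bc injB by (simp add: bisection_def compact_open_def)
  moreover have "g \<in> B" using gV gA K by (simp add: B_def)
  moreover have "B \<subseteq> U" by (auto simp: B_def V_def)
  ultimately show ?thesis by (rule that)
qed

text \<open>In a space that is not Hausdorff the compact set \<open>W\<close> need not be closed. It
  is closed relative to the Hausdorff open set \<open>U\<close> containing everything, and this
  makes the difference open.\<close>

lemma compact_open_Diff:
  assumes U: "compact_open X U" and B: "compact_open X B" "B \<subseteq> U" and W: "compactin X W" "openin X W" "W \<subseteq> U"
  shows "compact_open X (B - W)"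
proof -
  have "compactin (subtopology X U) W" using W by (simp add: compactin_subtopology)
  then have "closedin (subtopology X U) W"
    using U compactin_imp_closedin unfolding compact_open_def by blast
  then have "openin (subtopology X U) (topspace (subtopology X U) - W)" by blast
  then have "openin X (U - W)"
    using U compact_open_subset[OF U] openin_trans_full[of X U] unfolding compact_open_def
    by (simp add: Int_absorb1)
  moreover have "B - W = B \<inter> (U - W)" using B by auto
  ultimately have 1: "openin X (B - W)" using B(1) by (auto simp: compact_open_def)
  have "B - W = B \<inter> (topspace X - W)" using compact_open_subset[OF B(1)] by auto
  moreover have "closedin X (topspace X - W)" using W(2) by blast
  ultimately have 2: "compactin X (B - W)"
    using B(1) compact_Int_closedin[of X B "topspace X - W"] by (simp add: compact_open_def)
  have "Hausdorff_space (subtopology (subtopology X B) (B - W))"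
    using B(1) by (simp add: compact_open_def Hausdorff_space_subtopology del: subtopology_subtopology)
  moreover have "B \<inter> (B - W) = B - W" by auto
  ultimately have 3: "Hausdorff_space (subtopology X (B - W))" by (simp add: subtopology_subtopology)
  show ?thesis using 1 2 3 by (simp add: compact_open_def)
qed

text \<open>For sets of arrows this is the set of products of composable pairs from \<open>U\<close>
  and \<open>B\<close>, with membership decided by dividing by an element of
  \<open>B\<close>.\<close>

definition set_mult where
  "set_mult U B = {g \<in> Arr. \<exists>b\<in>B. src b = src g \<and> g \<diamondop> ivt b \<in> U}"

text \<open>Compactness comes from the image of the composable pairs, which are closed in the
  product because the objects are Hausdorff. Openness and the Hausdorff property come from the map
  \<open>\<psi>\<close>, which divides \<open>g\<close> by the unique element of \<open>B\<close>
  with the same source.\<close>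

lemma compact_open_set_mult:
  assumes U: "compact_open (arrows G) U" and B: "bisection B"
  shows "compact_open (arrows G) (set_mult U B)"
proof -
  let ?X = "arrows G" and ?UB = "set_mult U B"
  let ?P = "prod_topology ?X ?X"
  have UA: "U \<subseteq> Arr" by (rule compact_open_subset[OF U])
  have BA: "B \<subseteq> Arr" by (rule bisection_subset[OF B])
  have Bo: "openin ?X B" and Bc: "compactin ?X B" and inj: "inj_on src B" and injt: "inj_on tgt B"
    using B by (auto simp: bisection_def compact_open_def)
  have Uo: "openin ?X U" and Uc: "compactin ?X U" and UH: "Hausdorff_space (subtopology ?X U)"
    using U by (auto simp: compact_open_def)
  have comp: "composable G = {z \<in> topspace ?P. (src \<circ> fst) z = (tgt \<circ> snd) z}"
    by (auto simp: composable_def)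
  have "closedin ?P (composable G)"
    unfolding comp
    by (rule closedin_continuous_maps_eq[OF Hausdorff_objects
          continuous_map_compose[OF continuous_map_fst continuous_dmap]
          continuous_map_compose[OF continuous_map_snd continuous_rmap]])
  moreover have "compactin ?P (U \<times> B)" using Uc Bc by (simp add: compactin_Times)
  ultimately have "compactin ?P (composable G \<inter> (U \<times> B))" by (rule closed_Int_compactin)
  then have "compactin (subtopology ?P (composable G)) (composable G \<inter> (U \<times> B))"
    by (simp add: compactin_subtopology)
  then have "compactin ?X ((\<lambda>(g, h). g \<diamondop> h) ` (composable G \<inter> (U \<times> B)))"
    by (rule image_compactin[OF _ continuous_mult])
  moreover have "(\<lambda>(g, h). g \<diamondop> h) ` (composable G \<inter> (U \<times> B)) = ?UB"
  proof (intro equalityI subsetI)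
    fix g assume "g \<in> (\<lambda>(g, h). g \<diamondop> h) ` (composable G \<inter> (U \<times> B))"
    then obtain u b where ub: "u \<in> U" "b \<in> B" "g = u \<diamondop> b" "src u = tgt b" by (auto simp: composable_def)
    have "u \<in> Arr" "b \<in> Arr" using ub UA BA by auto
    then show "g \<in> ?UB" using ub by (auto simp: set_mult_def intro!: bexI[of _ b])
  next
    fix g assume "g \<in> ?UB"
    then obtain b where b: "g \<in> Arr" "b \<in> B" "src b = src g" "g \<diamondop> ivt b \<in> U" by (auto simp: set_mult_def)
    then have bA: "b \<in> Arr" using BA by auto
    have "g = g \<diamondop> ivt b \<diamondop> b" using b bA by simp
    moreover have "(g \<diamondop> ivt b, b) \<in> composable G" using b bA by (simp add: composable_def)
    ultimately show "g \<in> (\<lambda>(g, h). g \<diamondop> h) ` (composable G \<inter> (U \<times> B))" using b by force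
  qed
  ultimately have 1: "compactin ?X ?UB" by simp
  \<comment> \<open>The inverse of \<open>src\<close> on \<open>B\<close> is continuous, hence so is
    the choice of the divisor in \<open>\<psi>\<close>.\<close>
  obtain \<tau> where \<tau>: "homeomorphic_maps (subtopology ?X B) (subtopology (objects G) (src ` B)) src \<tau>"
    using src_homeomorphic[OF Bo inj] homeomorphic_map_maps by blast
  have topB: "topspace (subtopology ?X B) = B" using BA by auto
  have \<tau>c: "continuous_map (subtopology (objects G) (src ` B)) (subtopology ?X B) \<tau>"
    and \<tau>b: "\<And>b. b \<in> B \<Longrightarrow> \<tau> (src b) = b"
    using \<tau> topB unfolding homeomorphic_maps_def by auto
  define W where "W = {g \<in> Arr. src g \<in> src ` B}"
  have Wo: "openin ?X W" unfolding W_def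
    by (rule openin_continuous_map_preimage[OF continuous_dmap src_open_map[OF Bo]])
  have topW: "topspace (subtopology ?X W) = W" by (auto simp: W_def)
  define \<psi> where "\<psi> g = g \<diamondop> ivt (\<tau> (src g))" for g
  have srcW: "continuous_map (subtopology ?X W) (subtopology (objects G) (src ` B)) src"
    by (rule continuous_map_into_subtopology[OF continuous_map_from_subtopology[OF continuous_dmap]])
      (auto simp: W_def)
  have "continuous_map (subtopology ?X W) ?X (\<tau> \<circ> src)"
    using continuous_map_compose[OF srcW \<tau>c] continuous_map_in_subtopology by blast
  then have "continuous_map (subtopology ?X W) ?X (ivt \<circ> (\<tau> \<circ> src))"
    by (rule continuous_map_compose[OF _ continuous_inv])
  then have "continuous_map (subtopology ?X W) ?P (\<lambda>g. (g, ivt (\<tau> (src g))))"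
    by (intro continuous_map_pairedI) (auto simp: o_def intro: continuous_map_from_subtopology)
  moreover have "(g, ivt (\<tau> (src g))) \<in> composable G" if "g \<in> W" for g
    using that BA \<tau>b by (auto simp: W_def composable_def)
  ultimately have "continuous_map (subtopology ?X W) (subtopology ?P (composable G)) (\<lambda>g. (g, ivt (\<tau> (src g))))"
    by (intro continuous_map_into_subtopology) (auto simp: topW)
  from continuous_map_compose[OF this continuous_mult]
  have \<psi>c: "continuous_map (subtopology ?X W) ?X \<psi>" by (simp add: o_def \<psi>_def[abs_def])
  have UB: "?UB = {g \<in> topspace (subtopology ?X W). \<psi> g \<in> U}"
    unfolding topW
  proof (intro equalityI subsetI)
    fix g assume "g \<in> ?UB"
    then obtain b where b: "g \<in> Arr" "b \<in> B" "src b = src g" "g \<diamondop> ivt b \<in> U" by (auto simp: set_mult_def)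
    have "src g \<in> src ` B" using b(2) unfolding b(3)[symmetric] by (rule imageI)
    moreover have "\<tau> (src g) = b" using \<tau>b[OF b(2)] b(3) by simp
    ultimately show "g \<in> {g \<in> W. \<psi> g \<in> U}" using b by (simp add: W_def \<psi>_def)
  next
    fix g assume g: "g \<in> {g \<in> W. \<psi> g \<in> U}"
    then obtain b where b: "b \<in> B" "src g = src b" "g \<in> Arr" by (auto simp: W_def)
    then have "g \<diamondop> ivt b \<in> U" using g \<tau>b[OF b(1)] by (simp add: \<psi>_def)
    then show "g \<in> ?UB" using b by (auto simp: set_mult_def)
  qed
  have "openin (subtopology ?X W) ?UB" unfolding UB by (rule openin_continuous_map_preimage[OF \<psi>c Uo])
  then have 2: "openin ?X ?UB" using Wo openin_trans_full by blast
  have UBW: "?UB \<subseteq> W" unfolding UB by auto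
  have UBA: "?UB \<subseteq> Arr" by (auto simp: set_mult_def)
  have "Hausdorff_space (subtopology ?X ?UB)"
  proof (rule Hausdorff_space_injective_preimage[OF UH])
    have "continuous_map (subtopology (subtopology ?X W) ?UB) ?X \<psi>"
      by (rule continuous_map_from_subtopology[OF \<psi>c])
    moreover have "W \<inter> ?UB = ?UB" using UBW by auto
    ultimately have "continuous_map (subtopology ?X ?UB) ?X \<psi>" by (simp add: subtopology_subtopology)
    then show "continuous_map (subtopology ?X ?UB) (subtopology ?X U) \<psi>"
      by (rule continuous_map_into_subtopology) (use UB in auto)
    show "inj_on \<psi> (topspace (subtopology ?X ?UB))"
    proof (rule inj_onI)
      fix g h assume gh: "g \<in> topspace (subtopology ?X ?UB)" "h \<in> topspace (subtopology ?X ?UB)" "\<psi> g = \<psi> h"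
      obtain b c where b: "b \<in> B" "src b = src g" and c: "c \<in> B" "src c = src h"
        using gh by (auto simp: set_mult_def)
      have A: "g \<in> Arr" "h \<in> Arr" "b \<in> Arr" "c \<in> Arr" using gh b c BA by auto
      \<comment> \<open>Equal quotients have equal sources, which are the ranges of the divisors;
        injectivity of \<open>tgt\<close> on \<open>B\<close> then identifies the divisors.\<close>
      have eq: "g \<diamondop> ivt b = h \<diamondop> ivt c" using gh(3) \<tau>b[OF b(1)] \<tau>b[OF c(1)] b c by (simp add: \<psi>_def)
      then have "src (g \<diamondop> ivt b) = src (h \<diamondop> ivt c)" by simp
      then have "tgt b = tgt c" using A b c by simp
      then have "b = c" using injt b c by (auto dest: inj_onD)
      have "g = g \<diamondop> ivt b \<diamondop> b" using A b by simp
      also have "\<dots> = h \<diamondop> ivt c \<diamondop> b" unfolding eq ..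
      also have "\<dots> = h" using \<open>b = c\<close> A c by simp
      finally show "g = h" .
    qed
  qed
  then show ?thesis using 1 2 by (simp add: compact_open_def)
qed

end

section \<open>The groupoid algebra is closed under convolution\<close>

locale ample_coefficients = R?: cring R + ample_groupoid G
  for R :: "('r, 'm) ring_scheme" (structure) and G :: "('o, 'a, 'z) groupoid_scheme"

sublocale ample_coefficients \<subseteq> groupoid_coefficients
  by unfold_locales

context ample_coefficients
begin

abbreviation "GA \<equiv> groupoid_algebra R G"

definition chi where "chi c U = (\<lambda>g\<in>Arr. if g \<in> U then c else \<zero>)"

lemma chi_apply [simp]: "g \<in> Arr \<Longrightarrow> chi c U g = (if g \<in> U then c else \<zero>)"
  by (simp add: chi_def)

lemma chi_extensional [simp]: "chi c U \<in> extensional Arr"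
  by (simp add: chi_def)

lemma GA_simps [simp]:
  "f1 \<otimes>\<^bsub>GA\<^esub> f2 = conv f1 f2" "f1 \<oplus>\<^bsub>GA\<^esub> f2 = fplus f1 f2" "\<zero>\<^bsub>GA\<^esub> = fzero"
  by (simp_all add: groupoid_algebra_def conv_def fzero_def fplus_def)

text \<open>The span of bisections in inductive form: each step adds one function whose fibres are
  finite. \<open>GA_carrier\<close> shows that this is the whole groupoid algebra.\<close>

inductive_set bispan where
  zero: "fzero \<in> bispan"
| add: "\<lbrakk>f \<in> bispan; bisection B; c \<in> carrier R\<rbrakk> \<Longrightarrow> fplus f (chi c B) \<in> bispan"

lemma bispan_val: "f \<in> bispan \<Longrightarrow> f \<in> Arr \<rightarrow>\<^sub>E carrier R"
proof (induction rule: bispan.induct)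
  case (add f B c)
  then have "f g \<in> carrier R" if "g \<in> Arr" for g using that by auto
  then show ?case using add.hyps(3) by (auto simp: PiE_def)
qed (auto simp: PiE_def)

lemma bispan_funcset: "f \<in> bispan \<Longrightarrow> f \<in> Arr \<rightarrow> carrier R"
  using bispan_val by (auto simp: PiE_def)

lemma chi_funcset: "c \<in> carrier R \<Longrightarrow> chi c U \<in> Arr \<rightarrow> carrier R"
  by auto

lemma fiber_finite_fplus:
  assumes "fiber_finite f" "fiber_finite f'"
  shows "fiber_finite (fplus f f')"
  unfolding fiber_finite_def
proof
  fix y
  have "{h \<in> Arr. src h = y \<and> fplus f f' h \<noteq> \<zero>}
     \<subseteq> {h \<in> Arr. src h = y \<and> f h \<noteq> \<zero>} \<union> {h \<in> Arr. src h = y \<and> f' h \<noteq> \<zero>}" by auto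
  then show "finite {h \<in> Arr. src h = y \<and> fplus f f' h \<noteq> \<zero>}"
    by (rule finite_subset) (use assms in \<open>auto simp: fiber_finite_def\<close>)
qed

lemma fiber_finite_chi:
  assumes "bisection B"
  shows "fiber_finite (chi c B)"
  unfolding fiber_finite_def
proof
  fix y
  have "{h \<in> Arr. src h = y \<and> chi c B h \<noteq> \<zero>} \<subseteq> {h \<in> B. src h = y}" by (auto split: if_splits)
  moreover have "finite {h \<in> B. src h = y}"
  proof (rule finite_if_finite_subsets_card_bdd[of _ 1, THEN conjunct1])
    fix F assume F: "F \<subseteq> {h \<in> B. src h = y}" "finite F"
    have inj: "inj_on src B" using assms by (simp add: bisection_def)
    have "a = b" if "a \<in> F" "b \<in> F" for a b using that F(1) by (intro inj_onD[OF inj]) auto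
    then show "card F \<le> 1" using F(2) by (simp add: card_le_Suc0_iff_eq)
  qed
  ultimately show "finite {h \<in> Arr. src h = y \<and> chi c B h \<noteq> \<zero>}" by (rule finite_subset)
qed

lemma bispan_fiber_finite: "f \<in> bispan \<Longrightarrow> fiber_finite f"
proof (induction rule: bispan.induct)
  case zero
  have "{h \<in> Arr. src h = y \<and> fzero h \<noteq> \<zero>} = {}" for y by auto
  then show ?case unfolding fiber_finite_def by (metis finite.emptyI)
qed (simp add: fiber_finite_fplus fiber_finite_chi)

lemma ext_eqI: "f \<in> extensional Arr \<Longrightarrow> f' \<in> extensional Arr \<Longrightarrow> (\<And>g. g \<in> Arr \<Longrightarrow> f g = f' g) \<Longrightarrow> f = f'"
  by (rule extensionalityI)

lemma bispan_plus:
  assumes "f \<in> bispan" "f' \<in> bispan"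
  shows "fplus f f' \<in> bispan"
  using assms(2,1)
proof (induction rule: bispan.induct)
  case zero
  have "fplus f fzero = f"
    by (rule ext_eqI) (use bispan_val[OF zero] funcset_mem[OF bispan_funcset[OF zero]] in \<open>auto simp: PiE_def\<close>)
  then show ?case using zero by simp
next
  case (add f' B c)
  have "fplus f (fplus f' (chi c B)) = fplus (fplus f f') (chi c B)"
    by (rule ext_eqI)
      (use funcset_mem[OF bispan_funcset[OF add.prems]] funcset_mem[OF bispan_funcset[OF add.hyps(1)]] add.hyps(3)
        in \<open>simp_all add: a_assoc\<close>)
  then show ?case using bispan.add[OF add.IH[OF add.prems] add.hyps(2,3)] by simp
qed

lemma bispan_neg: "f \<in> bispan \<Longrightarrow> fneg f \<in> bispan"
proof (induction rule: bispan.induct)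
  case zero
  have "fneg fzero = fzero" by (rule ext_eqI) auto
  then show ?case using bispan.zero by simp
next
  case (add f B c)
  have "fneg (fplus f (chi c B)) = fplus (fneg f) (chi (\<ominus> c) B)"
    by (rule ext_eqI) (use funcset_mem[OF bispan_funcset[OF add.hyps(1)]] add.hyps(3) in \<open>simp_all add: minus_add\<close>)
  then show ?case using bispan.add[OF add.IH add.hyps(2), of "\<ominus> c"] add.hyps(3) by simp
qed

lemma chi_bisection_in: "bisection B \<Longrightarrow> c \<in> carrier R \<Longrightarrow> chi c B \<in> bispan"
proof -
  assume B: "bisection B" "c \<in> carrier R"
  have "fplus fzero (chi c B) = chi c B" by (rule ext_eqI) (use B in auto)
  then show ?thesis using bispan.add[OF bispan.zero B] by simp
qed

text \<open>A compact open set is a finite union of bisections inside it. Removing from each one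
  those already treated makes them disjoint, and the differences stay compact open because all of
  them lie in \<open>U\<close>.\<close>

lemma chi_in:
  assumes U: "compact_open (arrows G) U" and c: "c \<in> carrier R"
  shows "chi c U \<in> bispan"
proof -
  have Uo: "openin (arrows G) U" and Uc: "compactin (arrows G) U" using U by (auto simp: compact_open_def)
  define \<U> where "\<U> = {B. bisection B \<and> B \<subseteq> U}"
  have "\<forall>B\<in>\<U>. openin (arrows G) B" by (auto simp: \<U>_def bisection_def compact_open_def)
  moreover have "U \<subseteq> \<Union>\<U>"
  proof
    fix g assume "g \<in> U"
    then obtain B where "bisection B" "g \<in> B" "B \<subseteq> U" using exists_bisection[OF Uo] by blast
    then show "g \<in> \<Union>\<U>" by (auto simp: \<U>_def)
  qed
  ultimately obtain \<F> where \<F>: "finite \<F>" "\<F> \<subseteq> \<U>" "U \<subseteq> \<Union>\<F>" using Uc unfolding compactin_def by meson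
  have "chi c (\<Union>\<F>) \<in> bispan" using \<F>(1,2)
  proof (induction \<F>)
    case empty
    have "chi c (\<Union>{}) = fzero" by (rule ext_eqI) auto
    then show ?case using bispan.zero by simp
  next
    case (insert B \<F>)
    have B: "bisection B" "B \<subseteq> U" using insert.prems by (auto simp: \<U>_def)
    have "compact_open (arrows G) (B - \<Union>\<F>)"
    proof (rule compact_open_Diff[OF U _ B(2)])
      show "compact_open (arrows G) B" using B by (simp add: bisection_def)
      show "compactin (arrows G) (\<Union>\<F>)" "openin (arrows G) (\<Union>\<F>)" "\<Union>\<F> \<subseteq> U"
        using insert by (auto simp: \<U>_def bisection_def compact_open_def intro!: compactin_Union)
    qed
    moreover have "inj_on src (B - \<Union>\<F>)" "inj_on tgt (B - \<Union>\<F>)"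
      using B(1) by (simp_all add: bisection_def inj_on_diff)
    ultimately have "bisection (B - \<Union>\<F>)" by (simp add: bisection_def)
    moreover have "chi c (\<Union>(insert B \<F>)) = fplus (chi c (\<Union>\<F>)) (chi c (B - \<Union>\<F>))"
      by (rule ext_eqI) (use c in auto)
    ultimately show ?case using insert bispan.add c by auto
  qed
  moreover have "\<Union>\<F> = U" using \<F> by (auto simp: \<U>_def)
  ultimately show ?thesis by simp
qed

lemma GA_carrier: "carrier GA = bispan"
proof -
  have car: "carrier GA = {\<lambda>g\<in>Arr. \<Oplus>U\<in>F. c U \<otimes> char_fun R Arr U g | F c.
           finite F \<and> (\<forall>U\<in>F. compact_open (arrows G) U \<and> c U \<in> carrier R)}"
    by (simp add: groupoid_algebra_def)
  have cf: "char_fun R Arr U g = (if g \<in> U then \<one> else \<zero>)" if "g \<in> Arr" for U g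
    using that by (simp add: char_fun_def)
  show ?thesis
  proof (intro equalityI subsetI)
    fix f assume "f \<in> carrier GA"
    then obtain F c where F: "finite F" "\<forall>U\<in>F. compact_open (arrows G) U \<and> c U \<in> carrier R"
        "f = (\<lambda>g\<in>Arr. \<Oplus>U\<in>F. c U \<otimes> char_fun R Arr U g)" unfolding car by blast
    have "(\<lambda>g\<in>Arr. \<Oplus>U\<in>F. c U \<otimes> char_fun R Arr U g) \<in> bispan" using F(1,2)
    proof (induction F)
      case empty
      have "(\<lambda>g\<in>Arr. \<Oplus>U\<in>{}. c U \<otimes> char_fun R Arr U g) = fzero" by (rule ext_eqI) auto
      then show ?case using bispan.zero by simp
    next
      case (insert U F)
      have "(\<lambda>g\<in>Arr. \<Oplus>V\<in>insert U F. c V \<otimes> char_fun R Arr V g)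
        = fplus (\<lambda>g\<in>Arr. \<Oplus>V\<in>F. c V \<otimes> char_fun R Arr V g) (chi (c U) U)"
      proof (rule ext_eqI)
        fix g assume g: "g \<in> Arr"
        have "(\<Oplus>V\<in>insert U F. c V \<otimes> char_fun R Arr V g)
          = c U \<otimes> char_fun R Arr U g \<oplus> (\<Oplus>V\<in>F. c V \<otimes> char_fun R Arr V g)"
          using insert g by (intro finsum_insert) (auto simp: cf)
        moreover have "(\<Oplus>V\<in>F. c V \<otimes> char_fun R Arr V g) \<in> carrier R"
          using insert g by (intro finsum_closed) (auto simp: cf)
        ultimately show "(\<lambda>g\<in>Arr. \<Oplus>V\<in>insert U F. c V \<otimes> char_fun R Arr V g) g
          = fplus (\<lambda>g\<in>Arr. \<Oplus>V\<in>F. c V \<otimes> char_fun R Arr V g) (chi (c U) U) g"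
          using g insert by (simp add: cf a_comm)
      qed auto
      moreover have "(\<lambda>g\<in>Arr. \<Oplus>V\<in>F. c V \<otimes> char_fun R Arr V g) \<in> bispan"
        by (rule insert.IH) (use insert.prems in blast)
      moreover have "chi (c U) U \<in> bispan" using insert.prems by (intro chi_in) auto
      ultimately show ?case using bispan_plus by simp
    qed
    then show "f \<in> bispan" using F(3) by simp
  next
    fix f assume "f \<in> bispan"
    then show "f \<in> carrier GA"
    proof (induction rule: bispan.induct)
      case zero
      have "fzero = (\<lambda>g\<in>Arr. \<Oplus>U\<in>{}. \<zero> \<otimes> char_fun R Arr U g)" by (rule ext_eqI) auto
      then show ?case unfolding car
        by (intro CollectI exI[of _ "{}"] exI[of _ "\<lambda>_. \<zero>"] conjI) auto
    next
      case (add f B c)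
      then obtain F d where F: "finite F" "\<forall>U\<in>F. compact_open (arrows G) U \<and> d U \<in> carrier R"
          "f = (\<lambda>g\<in>Arr. \<Oplus>U\<in>F. d U \<otimes> char_fun R Arr U g)" unfolding car by blast
      \<comment> \<open>Sums in \<open>groupoid_algebra\<close> are indexed by sets, not by terms:
        if \<open>B\<close> already occurs in \<open>F\<close>, its coefficient is increased instead
        of a term being added.\<close>
      define F0 where "F0 = F - {B}"
      define d' where "d' = d(B := (if B \<in> F then d B \<oplus> c else c))"
      have Bc: "compact_open (arrows G) B" using add by (simp add: bisection_def)
      have "fplus f (chi c B) = (\<lambda>g\<in>Arr. \<Oplus>U\<in>insert B F0. d' U \<otimes> char_fun R Arr U g)"
      proof (rule ext_eqI)
        fix g assume g: "g \<in> Arr"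
        define s where "s = (\<Oplus>U\<in>F0. d U \<otimes> char_fun R Arr U g)"
        have s: "s \<in> carrier R" unfolding s_def using F(2) g by (intro finsum_closed) (auto simp: cf F0_def)
        have "(\<Oplus>U\<in>insert B F0. d' U \<otimes> char_fun R Arr U g)
           = d' B \<otimes> char_fun R Arr B g \<oplus> (\<Oplus>U\<in>F0. d' U \<otimes> char_fun R Arr U g)"
          using F g add by (intro finsum_insert) (auto simp: cf F0_def d'_def)
        also have "(\<Oplus>U\<in>F0. d' U \<otimes> char_fun R Arr U g) = s" unfolding s_def
          using F g by (intro finsum_cong') (auto simp: cf F0_def d'_def)
        finally have 1: "(\<Oplus>U\<in>insert B F0. d' U \<otimes> char_fun R Arr U g) = d' B \<otimes> char_fun R Arr B g \<oplus> s" .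
        have 2: "(\<Oplus>U\<in>F. d U \<otimes> char_fun R Arr U g) = (if B \<in> F then d B \<otimes> char_fun R Arr B g \<oplus> s else s)"
        proof (cases "B \<in> F")
          case True
          then have "F = insert B F0" by (auto simp: F0_def)
          then have "(\<Oplus>U\<in>F. d U \<otimes> char_fun R Arr U g) = (\<Oplus>U\<in>insert B F0. d U \<otimes> char_fun R Arr U g)" by simp
          also have "\<dots> = d B \<otimes> char_fun R Arr B g \<oplus> s" unfolding s_def
            using F g True by (intro finsum_insert) (auto simp: cf F0_def)
          finally show ?thesis using True by simp
        next
          case False
          then show ?thesis by (simp add: s_def F0_def)
        qed
        show "fplus f (chi c B) g = (\<lambda>g\<in>Arr. \<Oplus>U\<in>insert B F0. d' U \<otimes> char_fun R Arr U g) g"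
        proof (cases "B \<in> F")
          case True
          then have "d B \<in> carrier R" using F(2) by auto
          then show ?thesis using g s add.hyps(3) True 1 2
            by (simp add: F(3) cf d'_def a_ac)
        next
          case False
          then show ?thesis using g s add.hyps(3) 1 2 by (simp add: F(3) cf d'_def a_comm)
        qed
      qed auto
      moreover have "finite (insert B F0)" "\<forall>U\<in>insert B F0. compact_open (arrows G) U \<and> d' U \<in> carrier R"
        using F add Bc by (auto simp: F0_def d'_def)
      ultimately show ?case unfolding car by blast
    qed
  qed
qed

text \<open>At most one element of the bisection \<open>B\<close> has the same source as
  \<open>g\<close>, so at most one term of the convolution survives.\<close>

lemma conv_chi_chi:
  assumes U: "U \<subseteq> Arr" and B: "bisection B" and c: "c \<in> carrier R" "c' \<in> carrier R"
  shows "conv (chi c U) (chi c' B) = chi (c \<otimes> c') (set_mult U B)"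
proof (rule ext_eqI)
  fix g assume g: "g \<in> Arr"
  have inj: "inj_on src B" using B by (simp add: bisection_def)
  have BA: "B \<subseteq> Arr" by (rule bisection_subset[OF B])
  show "conv (chi c U) (chi c' B) g = chi (c \<otimes> c') (set_mult U B) g"
  proof (cases "\<exists>b\<in>B. src b = src g")
    case True
    then obtain b where b: "b \<in> B" "src b = src g" by blast
    have uniq: "b' = b" if "b' \<in> B" "src b' = src g" for b' using inj_onD[OF inj _ that(1) b(1)] that b by simp
    have bA: "b \<in> Arr" using b BA by auto
    have "conv (chi c U) (chi c' B) g = (\<Oplus>h\<in>{b}. chi c U (g \<diamondop> ivt h) \<otimes> chi c' B h)"
    proof (rule conv_fiber[OF chi_funcset[OF c(1)] chi_funcset[OF c(2)] g])
      show "{h \<in> Arr. src h = src g \<and> chi c' B h \<noteq> \<zero>} \<subseteq> {b}"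
      proof
        fix h assume "h \<in> {h \<in> Arr. src h = src g \<and> chi c' B h \<noteq> \<zero>}"
        then have "h \<in> B" "src h = src g" by (auto split: if_splits)
        then show "h \<in> {b}" using uniq by blast
      qed
    qed (use b bA in auto)
    also have "\<dots> = (if g \<diamondop> ivt b \<in> U then c \<otimes> c' else \<zero>)" using b bA g c by simp
    also have "g \<diamondop> ivt b \<in> U \<longleftrightarrow> g \<in> set_mult U B" unfolding set_mult_def using b g uniq by blast
    also have "(if g \<in> set_mult U B then c \<otimes> c' else \<zero>) = chi (c \<otimes> c') (set_mult U B) g" using g by simp
    finally show ?thesis .
  next
    case False
    have "conv (chi c U) (chi c' B) g = (\<Oplus>h\<in>{}. chi c U (g \<diamondop> ivt h) \<otimes> chi c' B h)"
      by (rule conv_fiber[OF chi_funcset[OF c(1)] chi_funcset[OF c(2)] g]) (use False in auto)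
    then show ?thesis using False g by (auto simp: set_mult_def)
  qed
qed auto

lemma conv_fzero_left: "f \<in> Arr \<rightarrow> carrier R \<Longrightarrow> conv fzero f = fzero"
proof (rule ext_eqI)
  fix g assume f: "f \<in> Arr \<rightarrow> carrier R" and g: "g \<in> Arr"
  have "conv fzero f g = (\<Oplus>h\<in>{}. fzero (g \<diamondop> ivt h) \<otimes> f h)"
  proof (rule conv_eq[OF _ f g])
    show "fzero \<in> Arr \<rightarrow> carrier R" by auto
    show "fzero (g \<diamondop> ivt h) \<otimes> f h = \<zero>" if "h \<in> Arr" "src h = src g" for h
      using that g funcset_mem[OF f that(1)] by simp
  qed auto
  then show "conv fzero f g = fzero g" using g by simp
qed auto

lemma conv_bispan:
  assumes "f \<in> bispan" "f' \<in> bispan"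
  shows "conv f f' \<in> bispan"
proof -
  have 1: "conv f (chi c B) \<in> bispan" if "bisection B" "c \<in> carrier R" for c B
    using assms(1)
  proof (induction rule: bispan.induct)
    case zero
    then show ?case using conv_fzero_left[OF chi_funcset] that bispan.zero by simp
  next
    case (add f B' c')
    have "conv (chi c' B') (chi c B) = chi (c' \<otimes> c) (set_mult B' B)"
      by (rule conv_chi_chi) (use that add bisection_subset in auto)
    also have "\<dots> \<in> bispan"
      by (rule chi_in) (use that add compact_open_set_mult in \<open>auto simp: bisection_def[of B']\<close>)
    finally have "conv (chi c' B') (chi c B) \<in> bispan" .
    moreover have "conv (fplus f (chi c' B')) (chi c B) = fplus (conv f (chi c B)) (conv (chi c' B') (chi c B))"
      by (rule conv_add_left[OF bispan_funcset[OF add.hyps(1)] chi_funcset[OF add.hyps(3)]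
            chi_funcset[OF that(2)] fiber_finite_chi[OF that(1)]])
    ultimately show ?case using bispan_plus add.IH by simp
  qed
  show ?thesis using assms(2)
  proof (induction rule: bispan.induct)
    case zero
    have "conv f fzero = fzero"
    proof (rule ext_eqI)
      fix g assume g: "g \<in> Arr"
      have "conv f fzero g = (\<Oplus>h\<in>{}. f (g \<diamondop> ivt h) \<otimes> fzero h)"
        by (rule conv_fiber[OF bispan_funcset[OF assms(1)] _ g]) auto
      then show "conv f fzero g = fzero g" using g by simp
    qed auto
    then show ?case using bispan.zero by simp
  next
    case (add f' B c)
    have "conv f (fplus f' (chi c B)) = fplus (conv f f') (conv f (chi c B))"
      by (rule conv_add_right[OF bispan_funcset[OF assms(1)] bispan_funcset[OF add.hyps(1)]
            chi_funcset[OF add.hyps(3)] bispan_fiber_finite[OF add.hyps(1)] fiber_finite_chi[OF add.hyps(2)]])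
    then show ?case using bispan_plus add 1 by simp
  qed
qed

lemma abelian_group_GA: "abelian_group GA"
  and GA_uminus: "f \<in> carrier GA \<Longrightarrow> \<ominus>\<^bsub>GA\<^esub> f = fneg f"
proof -
  have sub: "carrier GA \<subseteq> Arr \<rightarrow>\<^sub>E carrier R" unfolding GA_carrier using bispan_val by blast
  note * = function_abelian_group[of GA Arr, OF GA_simps(3)[unfolded fzero_def] GA_simps(2)[unfolded fplus_def] sub, folded fneg_def]
  show "abelian_group GA"
    by (rule *(1)) (use bispan.zero bispan_plus bispan_neg GA_carrier in simp_all)
  show "\<ominus>\<^bsub>GA\<^esub> f = fneg f" if "f \<in> carrier GA"
    by (rule *(2)) (use that bispan.zero bispan_plus bispan_neg GA_carrier in simp_all)
qed

sublocale GA: distrib_algebra GA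
proof -
  interpret GA: abelian_group GA by (rule abelian_group_GA)
  show "distrib_algebra GA"
    by unfold_locales
      (auto simp: GA_carrier conv_bispan intro!: conv_add_right bispan_funcset bispan_fiber_finite)
qed

section \<open>Finitely many objects\<close>

text \<open>A product of arrows has the source of its right factor, so these functions form a left
  ideal for any set \<open>S\<close> of objects, open or not.\<close>

definition supported_on where
  "supported_on S = {f \<in> carrier GA. \<forall>g\<in>Arr. src g \<notin> S \<longrightarrow> f g = \<zero>}"

lemma left_ideal_supported_on: "left_ideal (supported_on S) GA"
proof (rule GA.left_idealI)
  show "supported_on S \<subseteq> carrier GA" by (auto simp: supported_on_def)
  show "\<zero>\<^bsub>GA\<^esub> \<in> supported_on S" using GA.zero_closed by (simp add: supported_on_def)
  show "f \<oplus>\<^bsub>GA\<^esub> f' \<in> supported_on S" if "f \<in> supported_on S" "f' \<in> supported_on S" for f f'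
    using that GA.a_closed[of f f'] by (simp add: supported_on_def)
  show "\<ominus>\<^bsub>GA\<^esub> f \<in> supported_on S" if "f \<in> supported_on S" for f
    using that GA.a_inv_closed[of f] by (simp add: supported_on_def GA_uminus)
  show "a \<otimes>\<^bsub>GA\<^esub> f \<in> supported_on S" if a: "a \<in> carrier GA" and f: "f \<in> supported_on S" for a f
  proof -
    have fc: "f \<in> carrier GA" using f by (simp add: supported_on_def)
    have "conv a f g = \<zero>" if g: "g \<in> Arr" "src g \<notin> S" for g
    proof -
      have "conv a f g = (\<Oplus>h\<in>{}. a (g \<diamondop> ivt h) \<otimes> f h)"
      proof (rule conv_fiber[OF _ _ g(1)])
        show "a \<in> Arr \<rightarrow> carrier R" "f \<in> Arr \<rightarrow> carrier R"
          using a fc by (simp_all only: GA_carrier bispan_funcset)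
      qed (use f g in \<open>auto simp: supported_on_def\<close>)
      then show ?thesis by simp
    qed
    then show ?thesis using GA.mult_closed[OF a fc] by (simp add: supported_on_def)
  qed
qed

text \<open>The characteristic function of a bisection around the identity arrow at
  \<open>x\<close>, with all its sources in \<open>W\<close>, separates the two left ideals.\<close>

lemma exists_bump:
  assumes "\<one> \<noteq> \<zero>" and W: "openin (objects G) W" and x: "x \<in> W" "x \<in> S" "x \<notin> S'"
    and sep: "W \<subseteq> S"
  shows "\<exists>f\<in>supported_on S. f \<notin> supported_on S'"
proof -
  have xO: "x \<in> Obj" using W x(1) openin_subset by blast
  have "openin (arrows G) {g \<in> Arr. src g \<in> W}" by (rule openin_continuous_map_preimage[OF continuous_dmap W])
  moreover have "unt x \<in> {g \<in> Arr. src g \<in> W}" using xO x(1) by simp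
  ultimately obtain B where B: "bisection B" "unt x \<in> B" "B \<subseteq> {g \<in> Arr. src g \<in> W}"
    by (rule exists_bisection) (rule that)
  have "chi \<one> B \<in> carrier GA" unfolding GA_carrier by (rule chi_bisection_in[OF B(1)]) simp
  moreover have "chi \<one> B g = \<zero>" if "g \<in> Arr" "src g \<notin> S" for g using that B(3) sep by auto
  moreover have "chi \<one> B (unt x) \<noteq> \<zero>" using B(2) xO assms(1) by simp
  ultimately have "chi \<one> B \<in> supported_on S" "chi \<one> B (unt x) \<noteq> \<zero>" by (simp_all add: supported_on_def)
  moreover have "f (unt x) = \<zero>" if "f \<in> supported_on S'" for f
    using that xO x(3) by (simp add: supported_on_def)
  ultimately show ?thesis by blast
qed

lemma supported_on_mono: "S \<subseteq> S' \<Longrightarrow> supported_on S \<subseteq> supported_on S'"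
  by (auto simp: supported_on_def)

text \<open>Only one direction is arranged: the neighbourhood of a point avoids all later points.
  This works greedily, because of two disjoint open sets at least one leaves infinitely many points
  of a given infinite set outside.\<close>

lemma exists_discrete_sequence:
  assumes inf: "infinite Obj"
  obtains x W where "\<And>n::nat. openin (objects G) (W n)" "\<And>n. x n \<in> W n" "\<And>m n. n < m \<Longrightarrow> x m \<notin> W n"
proof -
  have split: "\<exists>x W. x \<in> Y \<and> openin (objects G) W \<and> x \<in> W \<and> infinite (Y - W)"
    if Y: "Y \<subseteq> Obj" "infinite Y" for Y
  proof -
    obtain x where x: "x \<in> Y" using Y(2) by fastforce
    have "infinite (Y - {x})" using Y(2) by simp
    then have "Y - {x} \<noteq> {}" by (rule infinite_imp_nonempty)
    then obtain y where y: "y \<in> Y" "y \<noteq> x" by blast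
    obtain U V where UV: "openin (objects G) U" "openin (objects G) V" "x \<in> U" "y \<in> V" "disjnt U V"
    proof -
      have "x \<in> Obj \<and> y \<in> Obj \<and> x \<noteq> y" using x y Y(1) by blast
      then show ?thesis using Hausdorff_objects that unfolding Hausdorff_space_def by meson
    qed
    show ?thesis
    proof (cases "infinite (Y - U)")
      case True
      then show ?thesis using x UV by blast
    next
      case False
      then have "infinite (Y \<inter> U)" using Y(2) by (metis Int_Diff_Un finite_UnI)
      moreover have "Y \<inter> U \<subseteq> Y - V" using UV(5) by (auto simp: disjnt_def)
      ultimately have "infinite (Y - V)" using finite_subset by blast
      then show ?thesis using y UV by blast
    qed
  qed
  \<comment> \<open>A state consists of the points \<open>Y\<close> still available, the point
    chosen among them and its neighbourhood. The next \<open>Y\<close> is what the neighbourhood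
    leaves over.\<close>
  define P where "P n s \<longleftrightarrow> (case s of (Y, x, W) \<Rightarrow> Y \<subseteq> Obj \<and> infinite Y \<and> x \<in> Y \<and>
     openin (objects G) W \<and> x \<in> W \<and> infinite (Y - W))" for n :: nat and s :: "'o set \<times> 'o \<times> 'o set"
  define Q where "Q n s t \<longleftrightarrow> fst t = fst s - snd (snd s)" for n :: nat and s t :: "'o set \<times> 'o \<times> 'o set"
  have "\<exists>s. \<forall>n. P n (s n) \<and> Q n (s n) (s (Suc n))"
  proof (rule dependent_nat_choice)
    obtain x W where "x \<in> Obj" "openin (objects G) W" "x \<in> W" "infinite (Obj - W)"
      using split[OF subset_refl inf] by blast
    then show "\<exists>s. P 0 s" by (intro exI[of _ "(Obj, x, W)"]) (simp add: P_def inf)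
    fix s n assume s: "P n s"
    obtain Y x W where sY: "s = (Y, x, W)" by (cases s)
    then have Y: "Y - W \<subseteq> Obj" "infinite (Y - W)" using s by (auto simp: P_def)
    obtain x' W' where "x' \<in> Y - W" "openin (objects G) W'" "x' \<in> W'" "infinite (Y - W - W')"
      using split[OF Y] by blast
    then show "\<exists>t. P (Suc n) t \<and> Q n s t"
      using Y sY by (intro exI[of _ "(Y - W, x', W')"]) (simp add: P_def Q_def)
  qed
  then obtain s where s: "\<And>n. P n (s n)" "\<And>n. Q n (s n) (s (Suc n))" by blast
  define Y where "Y n = fst (s n)" for n
  define x where "x n = fst (snd (s n))" for n
  define W where "W n = snd (snd (s n))" for n
  have 1: "x n \<in> Y n" "openin (objects G) (W n)" "x n \<in> W n" for n
    using s(1)[of n] by (auto simp: P_def Y_def x_def W_def split: prod.splits)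
  have 2: "Y (Suc n) = Y n - W n" for n using s(2)[of n] by (simp add: Q_def Y_def W_def)
  have 3: "Y m \<subseteq> Y n" if "n \<le> m" for m n
    by (rule lift_Suc_antimono_le[of Y, OF _ that]) (use 2 in blast)
  have "x m \<notin> W n" if "n < m" for m n
    using 1(1)[of m] 3[of "Suc n" m] 2[of n] that by auto
  then show ?thesis using 1(2,3) by (rule that[rotated 2])
qed

text \<open>The sets \<open>S n\<close> regain the points \<open>x m\<close> one by one in the
  ascending case and lose them one by one in the descending case. A bump function at
  \<open>x N\<close> separates consecutive left ideals, and it is nonzero because the coefficient
  ring is.\<close>

lemma finite_objects_of_chain_condition:
  assumes nt: "\<one> \<noteq> \<zero>" and cc: "chain_condition up GA"
  shows "finite Obj"
proof (rule ccontr)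
  assume inf: "infinite Obj"
  obtain x W where x: "\<And>n::nat. openin (objects G) (W n)" "\<And>n. x n \<in> W n" "\<And>m n. n < m \<Longrightarrow> x m \<notin> W n"
    by (rule exists_discrete_sequence[OF inf]) (rule that)
  have inj: "x m \<noteq> x n" if "m \<noteq> n" for m n
    using x(2,3) that by (metis linorder_neqE_nat)
  have xO: "x n \<in> Obj" for n using x(1)[of n] x(2)[of n] openin_subset by blast
  define S where "S n = (if up then {y. \<forall>m\<ge>n. y \<noteq> x m} else {y. \<forall>m<n. y \<noteq> x m})" for n
  have "chain up (\<lambda>n. supported_on (S n))"
  proof -
    have "if up then S n \<subseteq> S (Suc n) else S (Suc n) \<subseteq> S n" for n
    proof (cases up)
      case True
      then show ?thesis unfolding S_def by (auto dest: Suc_leD)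
    next
      case False
      then show ?thesis unfolding S_def by (simp add: Collect_mono_iff less_SucI)
    qed
    then show ?thesis unfolding chain_def
      by (cases up) (simp_all add: supported_on_mono)
  qed
  then have "stabilizes (\<lambda>n. supported_on (S n))"
    by (intro chain_conditionD[OF cc] left_ideal_supported_on)
  then obtain N where N: "\<And>n. n \<ge> N \<Longrightarrow> supported_on (S n) = supported_on (S N)"
    unfolding stabilizes_def by blast
  have eq: "supported_on (S (Suc N)) = supported_on (S N)" using N[of "Suc N"] by simp
  show False
  proof (cases up)
    case True
    have "\<exists>f\<in>supported_on (S (Suc N)). f \<notin> supported_on (S N)"
    proof (rule exists_bump[OF nt x(1) x(2)])
      show "x N \<in> S (Suc N)" using True inj by (auto simp: S_def)
      show "x N \<notin> S N" using True by (auto simp: S_def)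
      \<comment> \<open>The points excluded in the ascending case are later than \<open>x N\<close>,
        and \<open>W N\<close> avoids these by construction.\<close>
      show "W N \<subseteq> S (Suc N)" using True x(3)[of N] by (auto simp: S_def)
    qed
    then show False using eq by blast
  next
    case False
    \<comment> \<open>In the descending case finitely many earlier points are excluded, and a finite
      subset of a Hausdorff space is closed.\<close>
    define V where "V = Obj - x ` {..<N}"
    have "openin (objects G) V" unfolding V_def
      using closedin_Hausdorff_finite[OF Hausdorff_objects, of "x ` {..<N}"] xO by (auto simp: closedin_def)
    then have "\<exists>f\<in>supported_on (S N). f \<notin> supported_on (S (Suc N))"
    proof (rule exists_bump[OF nt])
      have "x N \<notin> x ` {..<N}"
      proof
        assume "x N \<in> x ` {..<N}"
        then obtain k where "k < N" "x N = x k" by auto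
        then show False using inj[of N k] by simp
      qed
      then show "x N \<in> V" using xO by (simp add: V_def)
      show "x N \<in> S N" using False inj[of N] by (auto simp: S_def)
      show "x N \<notin> S (Suc N)" using False by (auto simp: S_def)
      show "V \<subseteq> S N" using False by (auto simp: S_def V_def)
    qed
    then show False using eq by blast
  qed
qed

lemma finite_objects_of_semisimple:
  assumes "\<one> \<noteq> \<zero>" "semisimple GA"
  shows "finite Obj"
  by (rule finite_objects_of_chain_condition[OF assms(1) GA.semisimple_chain_condition[OF assms(2)]])

text \<open>A Hausdorff space with finitely many points is discrete, and then so is the space of arrows.\<close>

lemma groupoid_algebra_eq_fs_algebra:
  assumes fin: "finite Obj"
  shows "groupoid_algebra R G = fs_algebra R G"
proof -
  interpret finite_groupoid_ring R G by unfold_locales (rule fin)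
  have discrete: "openin (objects G) S" if "S \<subseteq> Obj" for S
    using finite_topspace_imp_discrete_topology[OF refl fin Hausdorff_objects] that
    by (metis openin_discrete_topology)
  have sing: "bisection {g}" if g: "g \<in> Arr" for g
  proof -
    have "openin (arrows G) {h \<in> Arr. src h \<in> {src g}}"
      by (rule openin_continuous_map_preimage[OF continuous_dmap discrete]) (use g in auto)
    moreover have "g \<in> {h \<in> Arr. src h \<in> {src g}}" using g by simp
    ultimately obtain B where B: "bisection B" "g \<in> B" "B \<subseteq> {h \<in> Arr. src h \<in> {src g}}"
      by (rule exists_bisection) (rule that)
    have "inj_on src B" using B(1) by (simp add: bisection_def)
    \<comment> \<open>All of \<open>B\<close> lies over the single object \<open>src g\<close>, and
      \<open>src\<close> is injective on it.\<close>
    then have "B = {g}" using B(2,3) by (auto dest: inj_onD)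
    then show ?thesis using B(1) by simp
  qed
  have "bispan = carrier A"
  proof (intro equalityI subsetI)
    fix f assume "f \<in> bispan"
    then show "f \<in> carrier A"
    proof (induction rule: bispan.induct)
      case (add f B c)
      have "B \<subseteq> Arr" using add by (intro bisection_subset)
      then have "inj_on src B" "src ` B \<subseteq> Obj" using add by (auto simp: bisection_def)
      then have "finite B" using fin finite_subset finite_imageD by blast
      then have "chi c B \<in> carrier A" by (rule A_carrierI) (use add in \<open>auto simp: chi_def\<close>)
      then show ?case using add A_add_in by blast
    qed (rule A_zero_in)
  next
    fix f assume "f \<in> carrier A"
    then show "f \<in> bispan"
    proof (induction rule: A_induct)
      case (add f c a)
      have "mono c a = chi c {a}" by (simp add: mono_def chi_def)
      then show ?case using bispan.add[OF add.IH sing[OF add.hyps(3)] add.hyps(2)] by simp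
    qed (rule bispan.zero)
  qed
  then have "carrier GA = carrier (fs_algebra R G)" by (simp add: GA_carrier)
  then show ?thesis by (simp add: fs_algebra_def)
qed

end

section \<open>Decomposition into matrix algebras\<close>

lemma matrix_algebra_simps:
  "carrier (matrix_algebra n A) = {..<n} \<times> {..<n} \<rightarrow>\<^sub>E carrier A"
  "mult (matrix_algebra n A) = (\<lambda>M N. \<lambda>(i, j)\<in>{..<n} \<times> {..<n}. \<Oplus>\<^bsub>A\<^esub>k\<in>{..<n}. M (i, k) \<otimes>\<^bsub>A\<^esub> N (k, j))"
  "add (matrix_algebra n A) = (\<lambda>M N. \<lambda>p\<in>{..<n} \<times> {..<n}. M p \<oplus>\<^bsub>A\<^esub> N p)"
  "smult (matrix_algebra n A) = (\<lambda>r M. \<lambda>p\<in>{..<n} \<times> {..<n}. r \<odot>\<^bsub>A\<^esub> M p)"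
  by (simp_all add: matrix_algebra_def)

lemma product_algebra_simps:
  "carrier (product_algebra I A) = (\<Pi>\<^sub>E i\<in>I. carrier (A i))"
  "mult (product_algebra I A) = (\<lambda>f g. \<lambda>i\<in>I. f i \<otimes>\<^bsub>A i\<^esub> g i)"
  "add (product_algebra I A) = (\<lambda>f g. \<lambda>i\<in>I. f i \<oplus>\<^bsub>A i\<^esub> g i)"
  "smult (product_algebra I A) = (\<lambda>r f. \<lambda>i\<in>I. r \<odot>\<^bsub>A i\<^esub> f i)"
  by (simp_all add: product_algebra_def)

context finite_groupoid_ring
begin

abbreviation CC where "CC x \<equiv> group_algebra R (isotropy_group G x)"

lemma CC_add: "f \<oplus>\<^bsub>CC x\<^esub> f' = (\<lambda>h\<in>isot x. f h \<oplus> f' h)"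
  and CC_smult: "c \<odot>\<^bsub>CC x\<^esub> f = (\<lambda>h\<in>isot x. c \<otimes> f h)"
  by (simp_all add: group_algebra_def)

lemma CC_mult_closed:
  assumes x: "x \<in> Obj" and f: "f \<in> carrier (CC x)" "f' \<in> carrier (CC x)"
  shows "f \<otimes>\<^bsub>CC x\<^esub> f' \<in> carrier (CC x)"
proof -
  interpret C: group_ring R "isotropy_group G x" by (rule group_ring_isotropy[OF x])
  show ?thesis using C.C.A.m_closed f by (simp only: group_algebra_eq)
qed

lemma CC_mult_apply:
  assumes x: "x \<in> Obj" and f: "f \<in> carrier (CC x)" "f' \<in> carrier (CC x)" and h: "h \<in> isot x"
  shows "(f \<otimes>\<^bsub>CC x\<^esub> f') h = (\<Oplus>k\<in>{k \<in> isot x. f' k \<noteq> \<zero>}. f (h \<diamondop> ivt k) \<otimes> f' k)"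
proof -
  interpret C: group_ring R "isotropy_group G x" by (rule group_ring_isotropy[OF x])
  have fC: "f \<in> carrier C.C.A" "f' \<in> carrier C.C.A" using f by (simp_all only: group_algebra_eq)
  let ?B = "{k \<in> isot x. f' k \<noteq> \<zero>}"
  have "(f \<otimes>\<^bsub>CC x\<^esub> f') h = C.C.conv f f' h" by (simp add: group_algebra_eq)
  also have "\<dots> = (\<Oplus>k\<in>?B. f (h \<diamondop> inv\<^bsub>isotropy_group G x\<^esub> k) \<otimes> f' k)"
    using C.C.conv_fiber[OF C.C.A_funcset[OF fC(1)] C.C.A_funcset[OF fC(2)], of h ?B] C.C.A_finite[OF fC(2)] h
    by (simp del: isot_iff)
  also have "\<dots> = (\<Oplus>k\<in>?B. f (h \<diamondop> ivt k) \<otimes> f' k)"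
  proof (rule finsum_cong')
    fix k assume k: "k \<in> ?B"
    then show "f (h \<diamondop> inv\<^bsub>isotropy_group G x\<^esub> k) \<otimes> f' k = f (h \<diamondop> ivt k) \<otimes> f' k"
      using isotropy_inv[OF x] by simp
  next
    show "(\<lambda>k. f (h \<diamondop> ivt k) \<otimes> f' k) \<in> ?B \<rightarrow> carrier R"
    proof
      fix k assume k: "k \<in> ?B"
      then have "h \<diamondop> ivt k \<in> isot x" using h by simp
      then have "f (h \<diamondop> ivt k) \<in> carrier R" using f(1) unfolding isot_algebra_carrier by blast
      moreover have "f' k \<in> carrier R" using f(2) k unfolding isot_algebra_carrier by blast
      ultimately show "f (h \<diamondop> ivt k) \<otimes> f' k \<in> carrier R" by simp
    qed
  qed simp
  finally show ?thesis .
qed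

lemma CC_finsum_apply:
  assumes x: "x \<in> Obj" and K: "finite K" "\<And>k. k \<in> K \<Longrightarrow> F k \<in> carrier (CC x)" and h: "h \<in> isot x"
  shows "(\<Oplus>\<^bsub>CC x\<^esub>k\<in>K. F k) h = (\<Oplus>k\<in>K. F k h)"
proof -
  interpret C: group_ring R "isotropy_group G x" by (rule group_ring_isotropy[OF x])
  have "\<And>k. k \<in> K \<Longrightarrow> F k \<in> carrier C.C.A" using K(2) by (simp only: group_algebra_eq)
  then show ?thesis using C.C.A_finsum_apply[OF K(1), of F h] h by (simp add: group_algebra_eq)
qed

lemma CC_finsum_closed:
  assumes x: "x \<in> Obj" and K: "\<And>k. k \<in> K \<Longrightarrow> F k \<in> carrier (CC x)"
  shows "(\<Oplus>\<^bsub>CC x\<^esub>k\<in>K. F k) \<in> carrier (CC x)"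
proof -
  interpret C: group_ring R "isotropy_group G x" by (rule group_ring_isotropy[OF x])
  show ?thesis using C.GA.finsum_closed[of F K] K by auto
qed

text \<open>With a base object \<open>x i\<close> in each orbit and an arrow \<open>T i j\<close>
  from it to the \<open>j\<close>-th object, every arrow is \<open>a i j l h\<close> for exactly one
  choice of indices. The orbit selects the factor, \<open>j\<close> and \<open>l\<close> the matrix
  entry, and the loop \<open>h\<close> the group element. Without objects the product is
  empty.\<close>

theorem algebra_isomorphic_matrix_product:
  "\<exists>(k::nat) (n :: nat \<Rightarrow> nat) x.
     (\<forall>i<k. 0 < n i \<and> x i \<in> Obj) \<and>
     algebra_isomorphic R A (product_algebra {..<k} (\<lambda>i. matrix_algebra (n i) (CC (x i))))"
proof -
  have fin_rep: "finite (rep ` Obj)" using finite_objects by simp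
  define k where "k = card (rep ` Obj)"
  obtain x where x: "bij_betw x {..<k} (rep ` Obj)"
    using ex_bij_betw_nat_finite[OF fin_rep] by (auto simp: k_def atLeast0LessThan)
  define orb where "orb i = {y \<in> Obj. rep y = x i}" for i
  define n where "n i = card (orb i)" for i
  have fin_orb: "finite (orb i)" for i using finite_objects by (simp add: orb_def)
  have "\<exists>b. bij_betw b {..<n i} (orb i)" for i
    using ex_bij_betw_nat_finite[OF fin_orb[of i]] by (simp add: n_def atLeast0LessThan)
  then obtain b where b: "\<And>i. bij_betw (b i) {..<n i} (orb i)" by metis
  have xrep: "x i \<in> rep ` Obj" if "i < k" for i using x that by (auto simp: bij_betw_def)
  have xO: "x i \<in> Obj" if i: "i < k" for i
  proof -
    obtain y where y: "y \<in> Obj" "x i = rep y" using xrep[OF i] by auto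
    obtain t where "t \<in> Arr" "src t = rep y" by (rule rep_arrow[OF y(1)]) (rule that)
    then show ?thesis using y(2) dmap_closed[of t] by simp
  qed
  have npos: "0 < n i" if i: "i < k" for i
  proof -
    have "orb i \<noteq> {}" using xrep[OF i] by (auto simp: orb_def)
    then show ?thesis using fin_orb by (simp add: n_def card_gt_0_iff)
  qed
  have borb: "b i j \<in> Obj" "rep (b i j) = x i" if "j < n i" for i j
    using b[of i] that by (auto simp: bij_betw_def orb_def)
  have binj: "j = l" if "b i j = b i l" "j < n i" "l < n i" for i j l
    using b[of i] that by (auto simp: bij_betw_def dest: inj_onD)
  define T where "T i j = (SOME t. t \<in> Arr \<and> src t = x i \<and> tgt t = b i j)" for i j
  have T: "T i j \<in> Arr" "src (T i j) = x i" "tgt (T i j) = b i j" if "j < n i" for i j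
  proof -
    have "\<exists>t. t \<in> Arr \<and> src t = x i \<and> tgt t = b i j"
      by (rule rep_arrow[OF borb(1)[OF that]]) (use borb(2)[OF that] in auto)
    then have "T i j \<in> Arr \<and> src (T i j) = x i \<and> tgt (T i j) = b i j" unfolding T_def by (rule someI_ex)
    then show "T i j \<in> Arr" "src (T i j) = x i" "tgt (T i j) = b i j" by auto
  qed
  \<comment> \<open>\<open>j\<close> is the position of the range and \<open>l\<close> that of the
    source, matching row and column in a matrix product.\<close>
  define a where "a i j l h = T i j \<diamondop> h \<diamondop> ivt (T i l)" for i j l h
  have a: "a i j l h \<in> Arr" "src (a i j l h) = b i l" "tgt (a i j l h) = b i j"
    if "j < n i" "l < n i" "h \<in> isot (x i)" for i j l h
    using that T[OF that(1)] T[OF that(2)] by (simp_all add: a_def)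
  have a_inv: "ivt (T i j) \<diamondop> a i j l h \<diamondop> T i l = h"
    if "j < n i" "l < n i" "h \<in> isot (x i)" for i j l h
    using that T[OF that(1)] T[OF that(2)] by (simp add: a_def comp_assoc)
  have a_surj: "\<exists>i<k. \<exists>j<n i. \<exists>l<n i. \<exists>h\<in>isot (x i). g = a i j l h" if g: "g \<in> Arr" for g
  proof -
    have "rep (src g) \<in> rep ` Obj" using g by simp
    then obtain i where i: "i < k" "x i = rep (src g)" using x by (force simp: bij_betw_def)
    have "b i ` {..<n i} = orb i" using b[of i] by (simp add: bij_betw_def)
    then have "src g \<in> b i ` {..<n i}" "tgt g \<in> b i ` {..<n i}"
      using g i rep_eq[OF g] by (auto simp: orb_def)
    then obtain l j where lj: "l < n i" "b i l = src g" "j < n i" "b i j = tgt g" by auto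
    note Tj = T[OF lj(3)] and Tl = T[OF lj(1)]
    define h where "h = ivt (T i j) \<diamondop> g \<diamondop> T i l"
    have "h \<in> isot (x i)" using g Tj Tl lj by (simp add: h_def)
    moreover have "g = a i j l h" using g Tj Tl lj by (simp add: h_def a_def comp_assoc)
    ultimately show ?thesis using i lj by blast
  qed
  have a_uniq: "i = i' \<and> j = j' \<and> l = l' \<and> h = h'"
    if eq: "a i j l h = a i' j' l' h'" and 1: "i < k" "j < n i" "l < n i" "h \<in> isot (x i)"
      and 2: "i' < k" "j' < n i'" "l' < n i'" "h' \<in> isot (x i')" for i j l h i' j' l' h'
  proof -
    have s: "b i l = b i' l'" "b i j = b i' j'"
      using a(2,3)[OF 1(2-4)] a(2,3)[OF 2(2-4)] eq by auto
    then have "x i = x i'" using borb(2)[OF 1(2)] borb(2)[OF 2(2)] by simp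
    then have i: "i = i'" using x 1 2 by (auto simp: bij_betw_def dest: inj_onD)
    then have jl: "j = j'" "l = l'" using s binj 1 2 by auto
    have "h = ivt (T i j) \<diamondop> a i j l h \<diamondop> T i l" using a_inv[OF 1(2-4)] by simp
    also have "\<dots> = ivt (T i' j') \<diamondop> a i' j' l' h' \<diamondop> T i' l'" unfolding eq using i jl by simp
    also have "\<dots> = h'" by (rule a_inv[OF 2(2-4)])
    finally show ?thesis using i jl by simp
  qed
  \<comment> \<open>The base arrows at the common source cancel. This is the matrix-unit relation
    that makes \<open>\<phi>\<close> multiplicative.\<close>
  have a_mult: "a i j l h \<diamondop> ivt (a i m l h') = a i j m (h \<diamondop> ivt h')"
    if "j < n i" "l < n i" "m < n i" "h \<in> isot (x i)" "h' \<in> isot (x i)" for i j l m h h'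
    using that T[OF that(1)] T[OF that(2)] T[OF that(3)] by (simp add: a_def inv_comp comp_assoc)
  let ?B = "product_algebra {..<k} (\<lambda>i. matrix_algebra (n i) (CC (x i)))"
  define \<phi> where "\<phi> f = (\<lambda>i\<in>{..<k}. \<lambda>p\<in>{..<n i} \<times> {..<n i}. \<lambda>h\<in>isot (x i). f (a i (fst p) (snd p) h))" for f :: "'a \<Rightarrow> 'r"
  have \<phi>_apply: "\<phi> f i (j, l) = (\<lambda>h\<in>isot (x i). f (a i j l h))" if "i < k" "j < n i" "l < n i" for f i j l
    using that by (simp add: \<phi>_def)
  have entry: "(\<lambda>h\<in>isot (x i). f (a i j l h)) \<in> carrier (CC (x i))"
    if f: "f \<in> carrier A" and i: "i < k" and jl: "j < n i" "l < n i" for f i j l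
    unfolding isot_algebra_carrier
  proof
    show "(\<lambda>h\<in>isot (x i). f (a i j l h)) \<in> isot (x i) \<rightarrow>\<^sub>E carrier R"
      using A_val[OF f] a(1)[OF jl] by (auto simp del: isot_iff)
    have "{h \<in> isot (x i). f (a i j l h) \<noteq> \<zero>} \<subseteq> (\<lambda>g. ivt (T i j) \<diamondop> g \<diamondop> T i l) ` {g \<in> Arr. f g \<noteq> \<zero>}"
    proof
      fix h assume h: "h \<in> {h \<in> isot (x i). f (a i j l h) \<noteq> \<zero>}"
      then have "h = ivt (T i j) \<diamondop> a i j l h \<diamondop> T i l" "a i j l h \<in> {g \<in> Arr. f g \<noteq> \<zero>}"
        using a_inv[OF jl] a(1)[OF jl] by (auto simp del: isot_iff)
      then show "h \<in> (\<lambda>g. ivt (T i j) \<diamondop> g \<diamondop> T i l) ` {g \<in> Arr. f g \<noteq> \<zero>}" by blast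
    qed
    then have "finite {h \<in> isot (x i). f (a i j l h) \<noteq> \<zero>}"
      using A_finite[OF f] finite_surj by blast
    then show "finite {h \<in> isot (x i). (\<lambda>h\<in>isot (x i). f (a i j l h)) h \<noteq> \<zero>}"
      by (simp del: isot_iff cong: conj_cong)
  qed
  have \<phi>_in: "\<phi> f \<in> carrier ?B" if f: "f \<in> carrier A" for f

    unfolding product_algebra_simps matrix_algebra_simps \<phi>_def
  proof (intro restrict_PiE_iff[THEN iffD2] ballI)
    fix i p assume "i \<in> {..<k}" "p \<in> {..<n i} \<times> {..<n i}"
    then show "(\<lambda>h\<in>isot (x i). f (a i (fst p) (snd p) h)) \<in> carrier (CC (x i))"
      by (intro entry[OF f]) auto
  qed
  have prod_eqI: "M = N" if M: "M \<in> carrier ?B" "N \<in> carrier ?B"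
    and eq: "\<And>i j l. i < k \<Longrightarrow> j < n i \<Longrightarrow> l < n i \<Longrightarrow> M i (j, l) = N i (j, l)" for M N
  proof (rule PiE_ext[OF M[unfolded product_algebra_simps]])
    fix i assume "i \<in> {..<k}"
    then have i: "i < k" by simp
    have "M i \<in> {..<n i} \<times> {..<n i} \<rightarrow>\<^sub>E carrier (CC (x i))" "N i \<in> {..<n i} \<times> {..<n i} \<rightarrow>\<^sub>E carrier (CC (x i))"
      using M i by (auto simp: product_algebra_simps matrix_algebra_simps)
    then show "M i = N i" by (rule PiE_ext) (use eq[OF i] in auto)
  qed
  have bij: "bij_betw \<phi> (carrier A) (carrier ?B)"
  proof (rule bij_betwI')
    fix f f' assume f: "f \<in> carrier A" "f' \<in> carrier A"
    show "\<phi> f = \<phi> f' \<longleftrightarrow> f = f'"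
    proof
      assume eq: "\<phi> f = \<phi> f'"
      show "f = f'"
      proof (rule A_eqI[OF f])
        fix g assume "g \<in> Arr"
        then obtain i j l h where g: "i < k" "j < n i" "l < n i" "h \<in> isot (x i)" "g = a i j l h"
          using a_surj by blast
        have "\<phi> f i (j, l) h = \<phi> f' i (j, l) h" using eq by simp
        then show "f g = f' g" using g \<phi>_apply[OF g(1-3)] by (simp del: isot_iff)
      qed
    qed simp
  next
    fix M assume M: "M \<in> carrier ?B"
    have Mc: "M i (j, l) \<in> carrier (CC (x i))" if "i < k" "j < n i" "l < n i" for i j l
      using M that by (auto simp: product_algebra_simps matrix_algebra_simps PiE_iff)
    \<comment> \<open>The preimage of \<open>M\<close>: the indices of an arrow exist by
      \<open>a_surj\<close> and are unique by \<open>a_uniq\<close>, so the description picks out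
      one matrix entry.\<close>
    define f where "f = (\<lambda>g\<in>Arr. THE v. \<exists>i<k. \<exists>j<n i. \<exists>l<n i. \<exists>h\<in>isot (x i). g = a i j l h \<and> v = M i (j, l) h)"
    have fa: "f (a i j l h) = M i (j, l) h" if ijlh: "i < k" "j < n i" "l < n i" "h \<in> isot (x i)" for i j l h
    proof -
      have "(THE v. \<exists>i'<k. \<exists>j'<n i'. \<exists>l'<n i'. \<exists>h'\<in>isot (x i'). a i j l h = a i' j' l' h' \<and> v = M i' (j', l') h')
          = M i (j, l) h"
      proof (rule the_equality)
        show "\<exists>i'<k. \<exists>j'<n i'. \<exists>l'<n i'. \<exists>h'\<in>isot (x i'). a i j l h = a i' j' l' h' \<and> M i (j, l) h = M i' (j', l') h'"
          using ijlh by blast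
        fix v assume "\<exists>i'<k. \<exists>j'<n i'. \<exists>l'<n i'. \<exists>h'\<in>isot (x i'). a i j l h = a i' j' l' h' \<and> v = M i' (j', l') h'"
        then obtain i' j' l' h' where *: "i' < k" "j' < n i'" "l' < n i'" "h' \<in> isot (x i')"
          "a i j l h = a i' j' l' h'" "v = M i' (j', l') h'" by blast
        show "v = M i (j, l) h" using a_uniq[OF *(5) ijlh *(1-4)] *(6) by simp
      qed
      then show ?thesis using a(1)[OF ijlh(2-4)] by (simp add: f_def)
    qed
    have fA: "f \<in> carrier A"
    proof (rule A_carrierI)
      let ?S = "\<Union>i\<in>{..<k}. \<Union>j\<in>{..<n i}. \<Union>l\<in>{..<n i}. (\<lambda>h. a i j l h) ` {h \<in> isot (x i). M i (j, l) h \<noteq> \<zero>}"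
      have "finite {h \<in> isot (x i). M i (j, l) h \<noteq> \<zero>}" if "i < k" "j < n i" "l < n i" for i j l
        using Mc[OF that] unfolding isot_algebra_carrier by blast
      then show "finite ?S" by (intro finite_UN_I finite_lessThan finite_imageI) auto
      fix g assume "g \<in> Arr"
      then obtain i j l h where g: "i < k" "j < n i" "l < n i" "h \<in> isot (x i)" "g = a i j l h"
        using a_surj by blast
      show "f g \<in> carrier R" using fa[OF g(1-4)] Mc[OF g(1-3)] g unfolding isot_algebra_carrier by auto
      show "f g = \<zero>" if "g \<notin> ?S"
      proof (rule ccontr)
        assume "f g \<noteq> \<zero>"
        then have "h \<in> {h \<in> isot (x i). M i (j, l) h \<noteq> \<zero>}" using fa[OF g(1-4)] g(4,5) by simp
        then have "g \<in> (\<lambda>h. a i j l h) ` {h \<in> isot (x i). M i (j, l) h \<noteq> \<zero>}" unfolding g(5) by (rule imageI)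
        then have "g \<in> ?S" using g(1-3) by (intro UN_I[of i] UN_I[of j] UN_I[of l]) simp_all
        then show False using that by contradiction
      qed
    qed (simp add: f_def)
    have "M = \<phi> f"
    proof (rule prod_eqI[OF M \<phi>_in[OF fA]])
      fix i j l assume ijl: "i < k" "j < n i" "l < n i"
      have "M i (j, l) \<in> isot (x i) \<rightarrow>\<^sub>E carrier R" using Mc[OF ijl] unfolding isot_algebra_carrier by blast
      then show "M i (j, l) = \<phi> f i (j, l)"
        unfolding \<phi>_apply[OF ijl] using fa[OF ijl]
        by (intro extensionalityI[of _ "isot (x i)"]) (auto simp: PiE_def simp del: isot_iff)
    qed
    then show "\<exists>f\<in>carrier A. M = \<phi> f" using fA by blast
  qed (rule \<phi>_in)
  have Bops: "(M \<oplus>\<^bsub>?B\<^esub> N) i (j, l) = M i (j, l) \<oplus>\<^bsub>CC (x i)\<^esub> N i (j, l)"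
    "(M \<otimes>\<^bsub>?B\<^esub> N) i (j, l) = (\<Oplus>\<^bsub>CC (x i)\<^esub>m\<in>{..<n i}. M i (j, m) \<otimes>\<^bsub>CC (x i)\<^esub> N i (m, l))"
    "(c \<odot>\<^bsub>?B\<^esub> M) i (j, l) = c \<odot>\<^bsub>CC (x i)\<^esub> M i (j, l)"
    if "i < k" "j < n i" "l < n i" for M N i j l c
    using that by (simp_all add: product_algebra_simps matrix_algebra_simps)
  have add: "\<phi> (f \<oplus>\<^bsub>A\<^esub> f') = \<phi> f \<oplus>\<^bsub>?B\<^esub> \<phi> f'" if f: "f \<in> carrier A" "f' \<in> carrier A" for f f'
  proof -
    have "\<phi> (fplus f f') = \<phi> f \<oplus>\<^bsub>?B\<^esub> \<phi> f'"
    unfolding \<phi>_def product_algebra_simps matrix_algebra_simps CC_add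
    by (intro restrict_ext ext) (auto simp: a simp del: isot_iff)
    then show ?thesis by simp
  qed
  have smult: "\<phi> (c \<odot>\<^bsub>A\<^esub> f) = c \<odot>\<^bsub>?B\<^esub> \<phi> f" if "c \<in> carrier R" "f \<in> carrier A" for c f
  proof -
    have "\<phi> (fscale c f) = c \<odot>\<^bsub>?B\<^esub> \<phi> f"
    unfolding \<phi>_def product_algebra_simps matrix_algebra_simps CC_smult
    by (intro restrict_ext ext) (auto simp: a simp del: isot_iff)
    then show ?thesis by simp
  qed
  have mult: "\<phi> (f \<otimes>\<^bsub>A\<^esub> f') = \<phi> f \<otimes>\<^bsub>?B\<^esub> \<phi> f'" if f: "f \<in> carrier A" "f' \<in> carrier A" for f f'
  proof (rule prod_eqI)
    show "\<phi> (f \<otimes>\<^bsub>A\<^esub> f') \<in> carrier ?B" by (rule \<phi>_in[OF A.m_closed[OF f]])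
    have ec: "\<phi> f i (j, l) \<in> carrier (CC (x i))" "\<phi> f' i (j, l) \<in> carrier (CC (x i))"
      if "i < k" "j < n i" "l < n i" for i j l
      using entry[OF f(1) that] entry[OF f(2) that] \<phi>_apply[OF that] by simp_all
    have sum_in: "(\<Oplus>\<^bsub>CC (x i)\<^esub>m\<in>{..<n i}. \<phi> f i (j, m) \<otimes>\<^bsub>CC (x i)\<^esub> \<phi> f' i (m, l)) \<in> carrier (CC (x i))"
      if "i < k" "j < n i" "l < n i" for i j l
      by (rule CC_finsum_closed[OF xO[OF that(1)]]) (use that ec CC_mult_closed[OF xO[OF that(1)]] in auto)
    show "\<phi> f \<otimes>\<^bsub>?B\<^esub> \<phi> f' \<in> carrier ?B"
      unfolding product_algebra_simps matrix_algebra_simps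
    proof (intro restrict_PiE_iff[THEN iffD2] ballI)
      fix i p assume "i \<in> {..<k}" "p \<in> {..<n i} \<times> {..<n i}"
      then show "(case p of (j, l) \<Rightarrow> \<Oplus>\<^bsub>CC (x i)\<^esub>m\<in>{..<n i}. \<phi> f i (j, m) \<otimes>\<^bsub>CC (x i)\<^esub> \<phi> f' i (m, l))
          \<in> carrier (CC (x i))"
        using sum_in[of i "fst p" "snd p"] by (simp add: case_prod_beta mem_Times_iff)
    qed
    fix i j l assume ijl: "i < k" "j < n i" "l < n i"
    note xi = xO[OF ijl(1)]
    show "\<phi> (f \<otimes>\<^bsub>A\<^esub> f') i (j, l) = (\<phi> f \<otimes>\<^bsub>?B\<^esub> \<phi> f') i (j, l)"
      unfolding Bops(2)[OF ijl]
    proof (rule extensionalityI[of _ "isot (x i)"])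
      show "\<phi> (f \<otimes>\<^bsub>A\<^esub> f') i (j, l) \<in> extensional (isot (x i))" by (simp add: \<phi>_apply[OF ijl])
      show "(\<Oplus>\<^bsub>CC (x i)\<^esub>m\<in>{..<n i}. \<phi> f i (j, m) \<otimes>\<^bsub>CC (x i)\<^esub> \<phi> f' i (m, l)) \<in> extensional (isot (x i))"
        using sum_in[OF ijl] unfolding isot_algebra_carrier PiE_def by blast
      fix h assume h: "h \<in> isot (x i)"
      let ?g = "a i j l h"
      have g: "?g \<in> Arr" "src ?g = b i l" using a[OF ijl(2,3) h] by auto
      define S where "S m = {h' \<in> isot (x i). f' (a i m l h') \<noteq> \<zero>}" for m
      have finS: "finite (S m)" if "m < n i" for m
        using entry[OF f(2) ijl(1) that ijl(3)] unfolding isot_algebra_carrier S_def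
        by (simp del: isot_iff cong: conj_cong)
      \<comment> \<open>The supports of the entries in column \<open>l\<close>, gathered into a
        finite set of arrows with the source of \<open>?g\<close>. Splitting it by the position
        \<open>m\<close> of the range yields the summation index of the matrix product.\<close>
      define Q where "Q = (\<Union>m\<in>{..<n i}. (\<lambda>h'. a i m l h') ` S m)"
      have Qsub: "Q \<subseteq> {q \<in> Arr. src q = src ?g}"
        using a(1,2)[OF _ ijl(3)] g by (auto simp: Q_def S_def simp del: isot_iff)
      have Qsup: "{q \<in> Arr. src q = src ?g \<and> f' q \<noteq> \<zero>} \<subseteq> Q"
      proof
        fix q assume q: "q \<in> {q \<in> Arr. src q = src ?g \<and> f' q \<noteq> \<zero>}"
        then obtain i' m l' h' where q': "i' < k" "m < n i'" "l' < n i'" "h' \<in> isot (x i')" "q = a i' m l' h'"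
          using a_surj[of q] by blast
        have "b i' l' = b i l" using q q' a(2)[OF q'(2-4)] g by auto
        then have "x i' = x i" using borb(2)[OF q'(3)] borb(2)[OF ijl(3)] by simp
        then have "i' = i" using x q'(1) ijl(1) by (auto simp: bij_betw_def dest: inj_onD)
        then have "l' = l" using \<open>b i' l' = b i l\<close> binj q'(3) ijl(3) by auto
        then show "q \<in> Q" using q q' \<open>i' = i\<close> by (auto simp: Q_def S_def simp del: isot_iff)
      qed
      have finQ: "finite Q" unfolding Q_def using finS by auto
      have v: "f (?g \<diamondop> ivt q) \<otimes> f' q \<in> carrier R" if "q \<in> Q" for q
        using that Qsub g A_val[OF f(1)] A_val[OF f(2)] by auto
      have "\<phi> (f \<otimes>\<^bsub>A\<^esub> f') i (j, l) h = conv f f' ?g"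
        using h by (simp add: \<phi>_apply[OF ijl] del: isot_iff)
      also have "\<dots> = (\<Oplus>q\<in>Q. f (?g \<diamondop> ivt q) \<otimes> f' q)"
        by (rule conv_fiber[OF A_funcset[OF f(1)] A_funcset[OF f(2)] g(1) finQ Qsup Qsub])
      also have "\<dots> = (\<Oplus>m\<in>{..<n i}. \<Oplus>q\<in>(\<lambda>h'. a i m l h') ` S m. f (?g \<diamondop> ivt q) \<otimes> f' q)"
        unfolding Q_def
      proof (rule R.add.finprod_UN_disjoint)
        show "pairwise (\<lambda>m m'. disjnt ((\<lambda>h'. a i m l h') ` S m) ((\<lambda>h'. a i m' l h') ` S m')) {..<n i}"
          using a_uniq ijl unfolding pairwise_def disjnt_def S_def by blast
        show "f (?g \<diamondop> ivt q) \<otimes> f' q \<in> carrier R" if "m \<in> {..<n i}" "q \<in> (\<lambda>h'. a i m l h') ` S m" for m q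
          using that v by (auto simp: Q_def)
      qed (use finS in auto)
      also have "\<dots> = (\<Oplus>m\<in>{..<n i}. (\<phi> f i (j, m) \<otimes>\<^bsub>CC (x i)\<^esub> \<phi> f' i (m, l)) h)"
      proof (rule finsum_cong')
        show "(\<lambda>m. (\<phi> f i (j, m) \<otimes>\<^bsub>CC (x i)\<^esub> \<phi> f' i (m, l)) h) \<in> {..<n i} \<rightarrow> carrier R"
        proof
          fix m assume "m \<in> {..<n i}"
          then have "\<phi> f i (j, m) \<otimes>\<^bsub>CC (x i)\<^esub> \<phi> f' i (m, l) \<in> carrier (CC (x i))"
            using CC_mult_closed[OF xi] ec ijl by simp
          then show "(\<phi> f i (j, m) \<otimes>\<^bsub>CC (x i)\<^esub> \<phi> f' i (m, l)) h \<in> carrier R"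
            using h unfolding isot_algebra_carrier by blast
        qed
        fix m assume "m \<in> {..<n i}"
        then have m: "m < n i" by simp
        have inS: "\<phi> f' i (m, l) h' = f' (a i m l h')" if "h' \<in> isot (x i)" for h'
          using that by (simp add: \<phi>_apply[OF ijl(1) m ijl(3)] del: isot_iff)
        have "(\<Oplus>q\<in>(\<lambda>h'. a i m l h') ` S m. f (?g \<diamondop> ivt q) \<otimes> f' q)
            = (\<Oplus>h'\<in>S m. f (?g \<diamondop> ivt (a i m l h')) \<otimes> f' (a i m l h'))"
        proof (rule finsum_reindex)
          show "(\<lambda>q. f (?g \<diamondop> ivt q) \<otimes> f' q) \<in> (\<lambda>h'. a i m l h') ` S m \<rightarrow> carrier R"
            using v m by (auto simp: Q_def)
          show "inj_on (\<lambda>h'. a i m l h') (S m)"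
            using a_uniq ijl m unfolding inj_on_def S_def by blast
        qed
        also have "\<dots> = (\<Oplus>h'\<in>{h' \<in> isot (x i). \<phi> f' i (m, l) h' \<noteq> \<zero>}. \<phi> f i (j, m) (h \<diamondop> ivt h') \<otimes> \<phi> f' i (m, l) h')"
        proof (rule finsum_cong')
          show "S m = {h' \<in> isot (x i). \<phi> f' i (m, l) h' \<noteq> \<zero>}" using inS unfolding S_def by auto
          fix h' assume "h' \<in> {h' \<in> isot (x i). \<phi> f' i (m, l) h' \<noteq> \<zero>}"
          then have h': "h' \<in> isot (x i)" by blast
          have hh: "h \<diamondop> ivt h' \<in> isot (x i)" using h h' by simp
          then have "\<phi> f i (j, m) (h \<diamondop> ivt h') = f (a i j m (h \<diamondop> ivt h'))"
            by (simp add: \<phi>_apply[OF ijl(1,2) m] del: isot_iff)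
          then show "f (?g \<diamondop> ivt (a i m l h')) \<otimes> f' (a i m l h') = \<phi> f i (j, m) (h \<diamondop> ivt h') \<otimes> \<phi> f' i (m, l) h'"
            using inS[OF h'] a_mult[OF ijl(2,3) m h h'] by simp
        next
          show "(\<lambda>h'. \<phi> f i (j, m) (h \<diamondop> ivt h') \<otimes> \<phi> f' i (m, l) h')
             \<in> {h' \<in> isot (x i). \<phi> f' i (m, l) h' \<noteq> \<zero>} \<rightarrow> carrier R"
          proof
            fix h' assume "h' \<in> {h' \<in> isot (x i). \<phi> f' i (m, l) h' \<noteq> \<zero>}"
            then have h': "h' \<in> isot (x i)" by blast
            have "h \<diamondop> ivt h' \<in> isot (x i)" using h h' by simp
            then have "\<phi> f i (j, m) (h \<diamondop> ivt h') \<in> carrier R"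
              using ec(1)[OF ijl(1,2) m] unfolding isot_algebra_carrier by blast
            moreover have "\<phi> f' i (m, l) h' \<in> carrier R"
              using ec(2)[OF ijl(1) m ijl(3)] h' unfolding isot_algebra_carrier by blast
            ultimately show "\<phi> f i (j, m) (h \<diamondop> ivt h') \<otimes> \<phi> f' i (m, l) h' \<in> carrier R" by simp
          qed
        qed
        also have "\<dots> = (\<phi> f i (j, m) \<otimes>\<^bsub>CC (x i)\<^esub> \<phi> f' i (m, l)) h"
          by (rule CC_mult_apply[OF xi ec(1)[OF ijl(1,2) m] ec(2)[OF ijl(1) m ijl(3)] h, symmetric])
        finally show "(\<Oplus>q\<in>(\<lambda>h'. a i m l h') ` S m. f (?g \<diamondop> ivt q) \<otimes> f' q)
          = (\<phi> f i (j, m) \<otimes>\<^bsub>CC (x i)\<^esub> \<phi> f' i (m, l)) h" .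
      qed simp
      also have "\<dots> = (\<Oplus>\<^bsub>CC (x i)\<^esub>m\<in>{..<n i}. \<phi> f i (j, m) \<otimes>\<^bsub>CC (x i)\<^esub> \<phi> f' i (m, l)) h"
        by (rule CC_finsum_apply[OF xi _ _ h, symmetric]) (use ec ijl CC_mult_closed[OF xi] in auto)
      finally show "\<phi> (f \<otimes>\<^bsub>A\<^esub> f') i (j, l) h
        = (\<Oplus>\<^bsub>CC (x i)\<^esub>m\<in>{..<n i}. \<phi> f i (j, m) \<otimes>\<^bsub>CC (x i)\<^esub> \<phi> f' i (m, l)) h" .
    qed
  qed
  have "algebra_isomorphic R A ?B"
    unfolding algebra_isomorphic_def using bij add mult smult by (intro exI[of _ \<phi>]) auto
  then show ?thesis using npos xO by blast
qed

end

text \<open>The zero ring is excluded because over it the algebra of any groupoid is zero. In the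
  Artinian and the semisimple equivalence an object is required: without objects the algebra is zero
  and says nothing about \<open>R\<close>. The Noetherian equivalence constrains \<open>R\<close>
  only through the isotropy groups and so remains true when there are none.\<close>

theorem theorem1:
  fixes G :: "('o, 'a) groupoid" and R :: "('r, 'm) ring_scheme"
  assumes ample: "ample_groupoid G"
    and comm_ring: "cring R"
    and nontrivial: "\<one>\<^bsub>R\<^esub> \<noteq> \<zero>\<^bsub>R\<^esub>"
  shows
    "(noetherian (groupoid_algebra R G) \<longleftrightarrow>
        finite (topspace (objects G)) \<and>
        (\<forall>x\<in>topspace (objects G). noetherian (group_algebra R (isotropy_group G x))))
   \<and> (topspace (objects G) \<noteq> {} \<longrightarrow>
        (artinian (groupoid_algebra R G) \<longleftrightarrow>
           finite (topspace (arrows G)) \<and> artinian R))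
   \<and> (topspace (objects G) \<noteq> {} \<longrightarrow>
        (semisimple (groupoid_algebra R G) \<longleftrightarrow>
           finite (topspace (arrows G)) \<and>
           (\<exists>Fs :: 'r ring list.
              R \<simeq> RDirProd_list Fs \<and>
              (\<forall>F\<in>set Fs. field F \<and>
                 (\<forall>x\<in>topspace (objects G).
                    \<not> characteristic F dvd order (isotropy_group G x))))))
   \<and> (noetherian (groupoid_algebra R G) \<or> artinian (groupoid_algebra R G) \<or>
        semisimple (groupoid_algebra R G) \<longrightarrow>
        (\<exists>(k::nat) (n :: nat \<Rightarrow> nat) (x :: nat \<Rightarrow> 'o).
           (\<forall>i<k. 0 < n i \<and> x i \<in> topspace (objects G)) \<and>
           algebra_isomorphic R (groupoid_algebra R G)
             (product_algebra {..<k}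
                (\<lambda>i. matrix_algebra (n i) (group_algebra R (isotropy_group G (x i)))))))"
proof -
  interpret ample_coefficients R G
    using ample comm_ring by (rule ample_coefficients.intro[rotated])
  have fin_of_cc: "finite Obj" if "chain_condition up GA" for up
    using finite_objects_of_chain_condition[OF nontrivial that] .
  have fgr: "finite_groupoid_ring R G" if "finite Obj"
    using that by unfold_locales
  have GA_eq: "GA = fs_algebra R G" if "finite Obj"
    using groupoid_algebra_eq_fs_algebra[OF that] .
  have fin_Obj: "finite Obj" if "finite Arr"
  proof -
    have "Obj \<subseteq> src ` Arr"
    proof
      fix x assume "x \<in> Obj"
      then show "x \<in> src ` Arr" by (intro image_eqI[of _ _ "unt x"]) auto
    qed
    then show ?thesis using that finite_surj by blast
  qed
  have 1: "noetherian GA \<longleftrightarrow> finite Obj \<and> (\<forall>x\<in>Obj. noetherian (group_algebra R (isotropy_group G x)))"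
    unfolding noetherian_iff
    using fin_of_cc GA_eq finite_groupoid_ring.chain_condition_isotropy[OF fgr]
      finite_groupoid_ring.chain_condition_of_isotropy[OF fgr] by metis
  have 2: "artinian GA \<longleftrightarrow> finite Arr \<and> artinian R" if ne: "Obj \<noteq> {}"
  proof
    assume art: "artinian GA"
    then have fin: "finite Obj" using fin_of_cc by (simp add: artinian_iff)
    interpret finite_groupoid_ring R G by (rule fgr[OF fin])
    have "artinian A" using art GA_eq[OF fin] by simp
    then show "finite Arr \<and> artinian R"
      using artinian_imp_finite[OF _ nontrivial] chain_condition_coefficients[OF _ ne]
      by (simp add: artinian_iff)
  next
    assume fin: "finite Arr \<and> artinian R"
    then have finO: "finite Obj" using fin_Obj by simp
    interpret finite_groupoid_ring R G by (rule fgr[OF finO])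
    show "artinian GA"
      using chain_condition_of_coefficients[of False] fin GA_eq[OF finO] by (simp add: artinian_iff)
  qed
  have 3: "semisimple GA \<longleftrightarrow> finite Arr \<and> (\<exists>Fs :: 'r ring list. R \<simeq> RDirProd_list Fs \<and>
     (\<forall>F\<in>set Fs. field F \<and> (\<forall>x\<in>Obj. \<not> characteristic F dvd order (isotropy_group G x))))"
    if ne: "Obj \<noteq> {}"
  proof
    assume ss: "semisimple GA"
    then have fin: "finite Obj" by (rule finite_objects_of_semisimple[OF nontrivial])
    interpret finite_groupoid_ring R G by (rule fgr[OF fin])
    have ssA: "semisimple A" using ss GA_eq[OF fin] by simp
    have art: "artinian A" using A.semisimple_chain_condition[OF ssA] by (simp add: artinian_iff)
    have reg: "von_neumann_regular A" by (rule A.semisimple_von_neumann_regular[OF ssA])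
    have finA: "finite Arr" by (rule artinian_imp_finite[OF art nontrivial])
    have artR: "artinian R" using chain_condition_coefficients[OF _ ne] art by (simp add: artinian_iff)
    \<comment> \<open>The orders of the isotropy groups; regularity makes each of them invertible in
      \<open>R\<close>, and this passes to every field in the decomposition.\<close>
    define N where "N = (\<lambda>x. order (isotropy_group G x)) ` Obj"
    have unit: "\<exists>\<beta>\<in>carrier R. \<beta> \<otimes>\<^bsub>R\<^esub> add_pow R m \<one>\<^bsub>R\<^esub> = \<one>\<^bsub>R\<^esub>" if m: "m \<in> N" for m
    proof -
      obtain x where x: "x \<in> Obj" "m = card (isot x)" using m by (auto simp: N_def order_def)
      have "finite (isot x)" using finA by (auto simp: isot_def intro: finite_subset)
      then show ?thesis using regular_order_unit[OF reg x(1)] x(2) by blast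
    qed
    obtain Fs :: "'r ring list" where "R \<simeq> RDirProd_list Fs"
        "\<forall>F\<in>set Fs. field F \<and> (\<forall>m\<in>N. \<not> characteristic F dvd m)"
      using artinian_regular_product_of_fields[OF artR regular_coefficients[OF reg ne] unit] by blast
    then show "finite Arr \<and> (\<exists>Fs :: 'r ring list. R \<simeq> RDirProd_list Fs \<and>
       (\<forall>F\<in>set Fs. field F \<and> (\<forall>x\<in>Obj. \<not> characteristic F dvd order (isotropy_group G x))))"
      using finA by (intro conjI exI[of _ Fs]) (auto simp: N_def)
  next
    assume asm: "finite Arr \<and> (\<exists>Fs :: 'r ring list. R \<simeq> RDirProd_list Fs \<and>
       (\<forall>F\<in>set Fs. field F \<and> (\<forall>x\<in>Obj. \<not> characteristic F dvd order (isotropy_group G x))))"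
    then obtain Fs :: "'r ring list" where finA: "finite Arr" and Fs: "R \<simeq> RDirProd_list Fs"
       "\<forall>F\<in>set Fs. field F" "\<forall>F\<in>set Fs. \<forall>x\<in>Obj. \<not> characteristic F dvd order (isotropy_group G x)" by blast
    have finO: "finite Obj" by (rule fin_Obj[OF finA])
    interpret finite_groupoid_ring R G by (rule fgr[OF finO])
    obtain \<pi> where "product_of_fields R (length Fs) ((!) Fs) \<pi>"
      using product_of_fields_RDirProd_list[OF comm_ring Fs(1,2)] .
    then interpret P: product_of_fields R "length Fs" "(!) Fs" \<pi> .
    have "von_neumann_regular A"
    proof (rule regular_of_coefficients[OF P.ideal_right_unit finA])
      show "\<exists>\<beta>\<in>carrier R. \<beta> \<otimes>\<^bsub>R\<^esub> add_pow R (card (isot x)) \<one>\<^bsub>R\<^esub> = \<one>\<^bsub>R\<^esub>" if "x \<in> Obj" for x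
        by (rule P.nat_unit) (use Fs(3) that in \<open>auto simp: order_def\<close>)
    qed
    moreover have "artinian A"
      using chain_condition_of_coefficients[OF _ finA, of False] P.artinian by (simp add: artinian_iff)
    ultimately show "semisimple GA" using A.semisimple_of_artinian_regular GA_eq[OF finO] by simp
  qed
  have 4: "\<exists>(k::nat) (n :: nat \<Rightarrow> nat) (x :: nat \<Rightarrow> 'o). (\<forall>i<k. 0 < n i \<and> x i \<in> Obj) \<and>
      algebra_isomorphic R GA
       (product_algebra {..<k} (\<lambda>i. matrix_algebra (n i) (group_algebra R (isotropy_group G (x i)))))"
    if "noetherian GA \<or> artinian GA \<or> semisimple GA"
  proof -
    have fin: "finite Obj"
      using that fin_of_cc finite_objects_of_semisimple[OF nontrivial] unfolding noetherian_iff artinian_iff by blast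
    show ?thesis
      unfolding GA_eq[OF fin] by (rule finite_groupoid_ring.algebra_isomorphic_matrix_product[OF fgr[OF fin]])
  qed
  show ?thesis using 1 2 3 4 by blast
qed

end
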